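(* Let $\mathbb{K}$ be an arbitrary algebraically closed field. If $f:\mathbb{K}^n\rightarrow\mathbb{K}^m$ is a generically finite polynomial map of degree $d$, then the set $S_f$ of points of $\mathbb{K}^m$ at which $f$ is not finite (proper) has degree of $\mathbb{K}$-uniruledness at most $d$.
   Context: All affine varieties are considered embedded in an affine space; they may be reducible. The topology is the Zariski topology. Degree: the degree of a polynomial map $f=(f_1,\dots,f_m)$ is $\max_i \deg f_i$. Parametric curve: an irreducible affine curve $\Gamma\subset\mathbb{K}^m$ is called a parametric curve of degree at most $d$ if there exists a non-constant polynomial map $\mathbb{K}\rightarrow\Gamma$ of degree at most $d$. Degree of $\mathbb{K}$-uniruledness: an affine variety has degree of $\mathbb{K}$-uniruledness at most $d$ if each of its irreducible components $X$ satisfies the following equivalent conditions (their equivalence is a known result): (1) for every point $x\in X$ there exists a parametric curve $l_x\subset X$ of degree at most $d$ passing through $x$; (2) there exists an open, non-empty subset $U\subset X$ such that for every point $x\in U$ there exists a parametric curve $l_x\subset X$ of degree at most $d$ passing through $x$; (3) there exists an affine variety $W$ of dimension $\dim X-1$ and a dominant polynomial map $\phi:\mathbb{K}\times W\ni(t,w)\mapsto\phi(t,w)\in X$ such that $\deg_t\phi\leq d$. By convention the empty set has degree of $\mathbb{K}$-uniruledness equal to zero (hence at most $d$). The set $S_f$: for a generically finite polynomial map $f:X\rightarrow Y$ between affine varieties, $f$ is finite (proper) at a point $y\in Y$ if there exists an open neighborhood $U$ of $y$ in $Y$ such that $f|_{f^{-1}(U)}:f^{-1}(U)\rightarrow U$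 is a finite map. $S_f\subset Y$ denotes the set of points of $Y$ at which $f$ is not finite (proper). *)

theory Defs
  imports "HOL-Analysis.Analysis" "HOL-Library.Poly_Mapping" "HOL-Library.Extended_Nat"
    "HOL-Computational_Algebra.Polynomial"
begin

section \<open>Multivariate polynomials\<close>

text \<open>A monomial is a finitely supported exponent function on the variables, a polynomial a finitely
  supported coefficient function on the monomials. The zero polynomial gets total degree 0.\<close>

type_synonym 'a mpoly = "(nat \<Rightarrow>\<^sub>0 nat) \<Rightarrow>\<^sub>0 'a"

definition eval_monom :: "(nat \<Rightarrow>\<^sub>0 nat) \<Rightarrow> (nat \<Rightarrow> 'a) \<Rightarrow> 'a::comm_ring_1" where
  "eval_monom a x = (\<Prod>i\<in>Poly_Mapping.keys a. x i ^ Poly_Mapping.lookup a i)"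

definition eval_mpoly :: "'a::comm_ring_1 mpoly \<Rightarrow> (nat \<Rightarrow> 'a) \<Rightarrow> 'a" where
  "eval_mpoly p x = (\<Sum>a\<in>Poly_Mapping.keys p. Poly_Mapping.lookup p a * eval_monom a x)"

definition mpolys :: "nat \<Rightarrow> 'a::comm_ring_1 mpoly set" where
  "mpolys n = {p. \<forall>a\<in>Poly_Mapping.keys p. Poly_Mapping.keys a \<subseteq> {..<n}}"

definition total_degree :: "'a::comm_ring_1 mpoly \<Rightarrow> nat" where
  "total_degree p = Max (insert 0
     ((\<lambda>a. \<Sum>i\<in>Poly_Mapping.keys a. Poly_Mapping.lookup a i) ` Poly_Mapping.keys p))"

lemma eval_mpoly_superset:
  assumes "finite A" "Poly_Mapping.keys p \<subseteq> A"
  shows "eval_mpoly p x = (\<Sum>a\<in>A. Poly_Mapping.lookup p a * eval_monom a x)"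
  unfolding eval_mpoly_def using assms
  by (intro sum.mono_neutral_left) (auto simp: in_keys_iff)

lemma eval_monom_superset:
  assumes "finite A" "Poly_Mapping.keys a \<subseteq> A"
  shows "eval_monom a x = (\<Prod>i\<in>A. x i ^ Poly_Mapping.lookup a i)"
  unfolding eval_monom_def using assms
  by (intro prod.mono_neutral_left) (auto simp: in_keys_iff)

lemma eval_monom_add: "eval_monom (a + b) x = eval_monom a x * eval_monom b x"
proof -
  let ?A = "Poly_Mapping.keys a \<union> Poly_Mapping.keys b"
  have "eval_monom c x = (\<Prod>i\<in>?A. x i ^ Poly_Mapping.lookup c i)" if "c \<in> {a, b, a + b}" for c
    by (rule eval_monom_superset) (use that Poly_Mapping.keys_add[of a b] in auto)
  then show ?thesis
    by (simp add: lookup_add power_add prod.distrib)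
qed

lemma eval_mpoly_zero [simp]: "eval_mpoly 0 x = 0"
  by (simp add: eval_mpoly_def)

lemma eval_mpoly_single: "eval_mpoly (Poly_Mapping.single a c) x = c * eval_monom a x"
  by (subst eval_mpoly_superset[of "{a}"]) auto

lemma eval_mpoly_one [simp]: "eval_mpoly 1 x = 1"
  by (simp flip: single_one add: eval_mpoly_single eval_monom_def)

lemma eval_mpoly_add: "eval_mpoly (p + q) x = eval_mpoly p x + eval_mpoly q x"
proof -
  let ?A = "Poly_Mapping.keys p \<union> Poly_Mapping.keys q"
  have "eval_mpoly r x = (\<Sum>a\<in>?A. Poly_Mapping.lookup r a * eval_monom a x)"
    if "r \<in> {p, q, p + q}" for r
    by (rule eval_mpoly_superset) (use that Poly_Mapping.keys_add[of p q] in auto)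
  then show ?thesis
    by (simp add: lookup_add distrib_right sum.distrib)
qed

lemma eval_mpoly_sum: "eval_mpoly (\<Sum>i\<in>I. p i) x = (\<Sum>i\<in>I. eval_mpoly (p i) x)"
  by (induction I rule: infinite_finite_induct) (auto simp: eval_mpoly_add)

lemma mpoly_as_sum:
  "p = (\<Sum>a\<in>Poly_Mapping.keys p. Poly_Mapping.single a (Poly_Mapping.lookup p a))"
  by (rule poly_mapping_eqI)
     (auto simp: Poly_Mapping.lookup_sum lookup_single when_def in_keys_iff)

lemma eval_mpoly_mult: "eval_mpoly (p * q) x = eval_mpoly p x * eval_mpoly q x"
proof -
  let ?s = "\<lambda>p a. Poly_Mapping.single a (Poly_Mapping.lookup p a)"
  have "p * q = (\<Sum>a\<in>Poly_Mapping.keys p. ?s p a) * (\<Sum>b\<in>Poly_Mapping.keys q. ?s q b)"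
    by (subst (1) mpoly_as_sum[of p], subst (1) mpoly_as_sum[of q]) (rule refl)
  also have "\<dots> = (\<Sum>a\<in>Poly_Mapping.keys p. \<Sum>b\<in>Poly_Mapping.keys q.
      Poly_Mapping.single (a + b) (Poly_Mapping.lookup p a * Poly_Mapping.lookup q b))"
    by (simp add: sum_product mult_single)
  finally have pq: "p * q = \<dots>" .
  show ?thesis
    by (simp only: pq eval_mpoly_sum eval_mpoly_single eval_monom_add)
       (simp add: eval_mpoly_def sum_product algebra_simps)
qed

lemma mpolys_mult: "p \<in> mpolys n \<Longrightarrow> q \<in> mpolys n \<Longrightarrow> p * q \<in> mpolys n"
  unfolding mpolys_def
proof (intro CollectI ballI)
  fix c assume pq: "p \<in> {p. \<forall>a\<in>Poly_Mapping.keys p. Poly_Mapping.keys a \<subseteq> {..<n}}"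
    "q \<in> {p. \<forall>a\<in>Poly_Mapping.keys p. Poly_Mapping.keys a \<subseteq> {..<n}}"
    and "c \<in> Poly_Mapping.keys (p * q)"
  then obtain a b where "c = a + b" "a \<in> Poly_Mapping.keys p" "b \<in> Poly_Mapping.keys q"
    using keys_mult[of p q] by blast
  then show "Poly_Mapping.keys c \<subseteq> {..<n}"
    using pq Poly_Mapping.keys_add[of a b] by blast
qed

lemma mpolys_one [simp]: "1 \<in> mpolys n"
  by (auto simp: mpolys_def simp flip: single_one)


section \<open>Affine space and the Zariski topology\<close>

definition affine_space :: "nat \<Rightarrow> (nat \<Rightarrow> 'a) set" where
  "affine_space n = PiE {..<n} (\<lambda>_. UNIV)"

definition zero_locus :: "nat \<Rightarrow> 'a::idom mpoly set \<Rightarrow> (nat \<Rightarrow> 'a) set" where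
  "zero_locus n S = {x \<in> affine_space n. \<forall>p\<in>S. eval_mpoly p x = 0}"

definition zariski :: "nat \<Rightarrow> (nat \<Rightarrow> 'a::idom) topology" where
  "zariski n = topology (\<lambda>U. \<exists>S\<subseteq>mpolys n. U = affine_space n - zero_locus n S)"

lemma istopology_zariski:
  "istopology (\<lambda>U :: (nat \<Rightarrow> 'a::idom) set. \<exists>S\<subseteq>mpolys n. U = affine_space n - zero_locus n S)"
  unfolding istopology_def
proof (intro conjI allI impI)
  fix U V :: "(nat \<Rightarrow> 'a) set"
  assume "\<exists>S\<subseteq>mpolys n. U = affine_space n - zero_locus n S"
    and "\<exists>S\<subseteq>mpolys n. V = affine_space n - zero_locus n S"
  then obtain S T where S: "S \<subseteq> mpolys n" "U = affine_space n - zero_locus n S"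
    and T: "T \<subseteq> mpolys n" "V = affine_space n - zero_locus n T" by blast
  have "(\<lambda>(p, q). p * q) ` (S \<times> T) \<subseteq> mpolys n"
    using S(1) T(1) by (auto intro!: mpolys_mult)
  moreover have "U \<inter> V = affine_space n - zero_locus n ((\<lambda>(p, q). p * q) ` (S \<times> T))"
    unfolding S(2) T(2) zero_locus_def by (auto simp: eval_mpoly_mult)
  ultimately show "\<exists>S\<subseteq>mpolys n. U \<inter> V = affine_space n - zero_locus n S" by blast
next
  fix \<K> :: "(nat \<Rightarrow> 'a) set set"
  assume "\<forall>U\<in>\<K>. \<exists>S\<subseteq>mpolys n. U = affine_space n - zero_locus n S"
  then obtain S where S: "\<forall>U\<in>\<K>. S U \<subseteq> mpolys n \<and> U = affine_space n - zero_locus n (S U)"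
    by metis
  have "\<Union>\<K> = (\<Union>U\<in>\<K>. affine_space n - zero_locus n (S U))" using S by auto
  also have "\<dots> = affine_space n - zero_locus n (\<Union>(S ` \<K>))"
    unfolding zero_locus_def by blast
  finally show "\<exists>S\<subseteq>mpolys n. \<Union>\<K> = affine_space n - zero_locus n S"
    using S by (intro exI[of _ "\<Union>(S ` \<K>)"]) auto
qed

lemma openin_zariski:
  "openin (zariski n) U \<longleftrightarrow> (\<exists>S\<subseteq>mpolys n. U = affine_space n - zero_locus n S)"
  unfolding zariski_def topology_inverse'[OF istopology_zariski] ..

lemma topspace_zariski [simp]: "topspace (zariski n) = affine_space n"
proof (rule antisym)
  show "topspace (zariski n) \<subseteq> affine_space n"
    unfolding topspace_def by (auto simp: openin_zariski)
  have "openin (zariski n) (affine_space n - zero_locus n {1})"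
    unfolding openin_zariski by (intro exI[of _ "{1}"]) auto
  moreover have "zero_locus n {1 :: 'a mpoly} = {}" by (simp add: zero_locus_def)
  ultimately show "affine_space n \<subseteq> topspace (zariski n :: (nat \<Rightarrow> 'a) topology)"
    by (metis Diff_empty openin_subset)
qed

lemma closedin_zariski: "closedin (zariski n) Z \<longleftrightarrow> (\<exists>S\<subseteq>mpolys n. Z = zero_locus n S)"
proof
  assume "closedin (zariski n) Z"
  then obtain S where "Z \<subseteq> affine_space n" "S \<subseteq> mpolys n"
      "affine_space n - Z = affine_space n - zero_locus n S"
    by (auto simp: closedin_def openin_zariski)
  moreover have "zero_locus n S \<subseteq> affine_space n" by (auto simp: zero_locus_def)
  ultimately show "\<exists>S\<subseteq>mpolys n. Z = zero_locus n S" by blast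
next
  assume "\<exists>S\<subseteq>mpolys n. Z = zero_locus n S"
  then show "closedin (zariski n) Z"
    by (auto simp: closedin_def openin_zariski zero_locus_def)
qed


section \<open>Irreducibility and dimension\<close>

definition irreducible_space :: "'b topology \<Rightarrow> bool" where
  "irreducible_space X \<longleftrightarrow> topspace X \<noteq> {} \<and>
     (\<forall>A B. closedin X A \<and> closedin X B \<and> topspace X = A \<union> B \<longrightarrow> topspace X = A \<or> topspace X = B)"

definition irreducible_components :: "'b topology \<Rightarrow> 'b set set" where
  "irreducible_components X =
     {C. C \<subseteq> topspace X \<and> irreducible_space (subtopology X C) \<and>
         (\<forall>D. D \<subseteq> topspace X \<and> irreducible_space (subtopology X D) \<and> C \<subseteq> D \<longrightarrow> D = C)}"

text \<open>Krull dimension; with this definition the empty space has dimension 0.\<close>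

definition krull_dim :: "'b topology \<Rightarrow> enat" where
  "krull_dim X = Sup {enat k | k. \<exists>C :: nat \<Rightarrow> 'b set.
     (\<forall>i\<le>k. closedin X (C i) \<and> irreducible_space (subtopology X (C i))) \<and>
     (\<forall>i<k. C i \<subset> C (Suc i))}"


section \<open>Polynomial maps\<close>

definition poly_map :: "nat \<Rightarrow> (nat \<Rightarrow> 'a::comm_ring_1 mpoly) \<Rightarrow> (nat \<Rightarrow> 'a) \<Rightarrow> (nat \<Rightarrow> 'a)" where
  "poly_map m F x = (\<lambda>i\<in>{..<m}. eval_mpoly (F i) x)"

text \<open>The value 0 is inserted only to give the map into the zero-dimensional space (\<open>m = 0\<close>)
  a degree.\<close>

definition map_degree :: "nat \<Rightarrow> (nat \<Rightarrow> 'a::comm_ring_1 mpoly) \<Rightarrow> nat" where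
  "map_degree m F = Max (insert 0 ((\<lambda>i. total_degree (F i)) ` {..<m}))"

text \<open>Finite fibres over a general point of the closure of the image. As affine space is
  irreducible, so is this closure, and its non-empty open subsets are dense.\<close>

definition generically_finite ::
    "nat \<Rightarrow> nat \<Rightarrow> ((nat \<Rightarrow> 'a::idom) \<Rightarrow> (nat \<Rightarrow> 'a)) \<Rightarrow> bool" where
  "generically_finite n m f \<longleftrightarrow>
     (\<exists>U. openin (subtopology (zariski m) (zariski m closure_of (f ` affine_space n))) U \<and>
          U \<noteq> {} \<and> (\<forall>y\<in>U. finite {x \<in> affine_space n. f x = y}))"


section \<open>Regular functions and finite morphisms\<close>

text \<open>Below, \<open>V\<close> and \<open>W\<close> are meant to be locally closed subsets of affine space, that is,
  quasi-affine varieties. Functions on \<open>V\<close> are total functions whose values outside \<open>V\<close> are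
  irrelevant.\<close>

definition regular_fun :: "nat \<Rightarrow> (nat \<Rightarrow> 'a::field) set \<Rightarrow> ((nat \<Rightarrow> 'a) \<Rightarrow> 'a) \<Rightarrow> bool" where
  "regular_fun n V g \<longleftrightarrow>
     (\<forall>x\<in>V. \<exists>U p q. openin (subtopology (zariski n) V) U \<and> x \<in> U \<and> p \<in> mpolys n \<and> q \<in> mpolys n \<and>
        (\<forall>z\<in>U. eval_mpoly q z \<noteq> 0 \<and> g z = eval_mpoly p z / eval_mpoly q z))"

definition regular_map ::
    "nat \<Rightarrow> (nat \<Rightarrow> 'a::field) set \<Rightarrow> nat \<Rightarrow> (nat \<Rightarrow> 'a) set \<Rightarrow> ((nat \<Rightarrow> 'a) \<Rightarrow> (nat \<Rightarrow> 'a)) \<Rightarrow> bool" where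
  "regular_map n V m W f \<longleftrightarrow> f ` V \<subseteq> W \<and> (\<forall>i<m. regular_fun n V (\<lambda>x. f x i))"

definition isomorphic_varieties ::
    "nat \<Rightarrow> (nat \<Rightarrow> 'a::field) set \<Rightarrow> nat \<Rightarrow> (nat \<Rightarrow> 'a) set \<Rightarrow> bool" where
  "isomorphic_varieties n V m W \<longleftrightarrow>
     (\<exists>f g. regular_map n V m W f \<and> regular_map m W n V g \<and>
        (\<forall>x\<in>V. g (f x) = x) \<and> (\<forall>y\<in>W. f (g y) = y))"

definition is_affine :: "nat \<Rightarrow> (nat \<Rightarrow> 'a::field) set \<Rightarrow> bool" where
  "is_affine n V \<longleftrightarrow> (\<exists>k Z. closedin (zariski k) Z \<and> isomorphic_varieties n V k Z)"

text \<open>The ring of regular functions on \<open>V\<close> is a finitely generated module, via pullback along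
  \<open>f\<close>, over the ring of regular functions on \<open>W\<close>.\<close>

definition module_finite ::
    "nat \<Rightarrow> (nat \<Rightarrow> 'a::field) set \<Rightarrow> nat \<Rightarrow> (nat \<Rightarrow> 'a) set \<Rightarrow> ((nat \<Rightarrow> 'a) \<Rightarrow> (nat \<Rightarrow> 'a)) \<Rightarrow> bool" where
  "module_finite n V m W f \<longleftrightarrow>
     (\<exists>G. finite G \<and> (\<forall>g\<in>G. regular_fun n V g) \<and>
        (\<forall>h. regular_fun n V h \<longrightarrow>
           (\<exists>c. (\<forall>g\<in>G. regular_fun m W (c g)) \<and> (\<forall>x\<in>V. h x = (\<Sum>g\<in>G. c g (f x) * g x)))))"

text \<open>A finite morphism: the target is covered by affine open sets whose preimages are affine and
  module-finite over them. Surjectivity or dominance is not required.\<close>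

definition finite_map ::
    "nat \<Rightarrow> (nat \<Rightarrow> 'a::field) set \<Rightarrow> nat \<Rightarrow> (nat \<Rightarrow> 'a) set \<Rightarrow> ((nat \<Rightarrow> 'a) \<Rightarrow> (nat \<Rightarrow> 'a)) \<Rightarrow> bool" where
  "finite_map n V m W f \<longleftrightarrow> regular_map n V m W f \<and>
     (\<forall>y\<in>W. \<exists>W'. openin (subtopology (zariski m) W) W' \<and> y \<in> W' \<and>
        is_affine m W' \<and> is_affine n {x \<in> V. f x \<in> W'} \<and>
        module_finite n {x \<in> V. f x \<in> W'} m W' f)"

definition finite_at ::
    "nat \<Rightarrow> (nat \<Rightarrow> 'a::field) set \<Rightarrow> nat \<Rightarrow> (nat \<Rightarrow> 'a) set \<Rightarrow> ((nat \<Rightarrow> 'a) \<Rightarrow> (nat \<Rightarrow> 'a)) \<Rightarrow>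
     (nat \<Rightarrow> 'a) \<Rightarrow> bool" where
  "finite_at n X m Y f y \<longleftrightarrow>
     (\<exists>U. openin (subtopology (zariski m) Y) U \<and> y \<in> U \<and> finite_map n {x \<in> X. f x \<in> U} m U f)"

definition nonfinite_set ::
    "nat \<Rightarrow> (nat \<Rightarrow> 'a::field) set \<Rightarrow> nat \<Rightarrow> (nat \<Rightarrow> 'a) set \<Rightarrow> ((nat \<Rightarrow> 'a) \<Rightarrow> (nat \<Rightarrow> 'a)) \<Rightarrow>
     (nat \<Rightarrow> 'a) set" where
  "nonfinite_set n X m Y f = {y \<in> Y. \<not> finite_at n X m Y f y}"


section \<open>Parametric curves and uniruledness\<close>

definition parametric_curve :: "nat \<Rightarrow> nat \<Rightarrow> (nat \<Rightarrow> 'a::field) set \<Rightarrow> bool" where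
  "parametric_curve m d \<Gamma> \<longleftrightarrow>
     closedin (zariski m) \<Gamma> \<and> irreducible_space (subtopology (zariski m) \<Gamma>) \<and>
     krull_dim (subtopology (zariski m) \<Gamma>) = 1 \<and>
     (\<exists>\<phi> :: nat \<Rightarrow> 'a poly.
        (\<forall>i<m. degree (\<phi> i) \<le> d) \<and>
        (\<forall>t. (\<lambda>i\<in>{..<m}. poly (\<phi> i) t) \<in> \<Gamma>) \<and>
        (\<exists>s t. (\<lambda>i\<in>{..<m}. poly (\<phi> i) s) \<noteq> (\<lambda>i\<in>{..<m}. poly (\<phi> i) t)))"

text \<open>The empty variety has no irreducible components, so it has degree of uniruledness at
  most \<open>d\<close> for every \<open>d\<close>.\<close>

definition uniruled_degree_le :: "nat \<Rightarrow> nat \<Rightarrow> (nat \<Rightarrow> 'a::field) set \<Rightarrow> bool" where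
  "uniruled_degree_le m d S \<longleftrightarrow> closedin (zariski m) S \<and>
     (\<forall>X\<in>irreducible_components (subtopology (zariski m) S).
        \<forall>x\<in>X. \<exists>l. parametric_curve m d l \<and> l \<subseteq> X \<and> x \<in> l)"

end

theory Submission
  imports Defs "Jordan_Normal_Form.Char_Poly" "HOL-Algebra.Algebraic_Closure_Type"
begin

text \<open>
  Write \<open>f\<close> for the polynomial map given by \<open>F\<close>, \<open>K\<close> for the ground field, and \<open>S\<close> for the set of
  points at which \<open>f\<close> is not finite. The map is finite at \<open>y\<close> exactly if each coordinate function
  \<open>x\<^sub>i\<close> satisfies an equation over \<open>K[f]\<close> whose leading coefficient does not vanish at \<open>y\<close>
  (\<open>finite_at_imp_leading_coeff\<close>, \<open>leading_coeffs_imp_finite_at\<close>). So \<open>S\<close> is closed, and a point of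
  \<open>S\<close> is one that the map can approach while some \<open>x\<^sub>i\<close> tends to infinity. Over an arbitrary field
  this is said with places: there is a place of an algebraically closed field
  containing \<open>K(x\<^sub>1, ..., x\<^sub>n)\<close>, with values in \<open>K\<close>, that maps \<open>f(\<xi>)\<close> to \<open>y\<close> and \<open>x\<^sub>i\<close> to infinity,
  where \<open>\<xi> = (x\<^sub>1, ..., x\<^sub>n)\<close> is the generic point.

  Given such a place, move \<open>\<xi>\<close> in the direction of another coordinate \<open>x\<^sub>j\<close>. The tuple
  \<open>f(\<xi> + \<kappa> T e\<^sub>j)\<close> consists of polynomials in \<open>T\<close> of degree at most \<open>d\<close>. It is not constant, since a
  generically finite map depends on \<open>x\<^sub>j\<close>. As the field is algebraically closed, the scaling \<open>\<kappa>\<close>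
  can be chosen such that all coefficients are finite at the place while one coefficient of positive
  degree is \<open>1\<close>. The images of the coefficients in \<open>K\<close> then define a non-constant polynomial curve of degree at most
  \<open>d\<close> through \<open>y\<close>; as \<open>x\<^sub>i\<close> has not been touched, it still becomes infinite, and the curve lies in \<open>S\<close>.
  For \<open>n = 1\<close> there is no second coordinate, but then \<open>x\<^sub>1\<close> is integral over \<open>K[f]\<close> and \<open>S\<close> is empty.

  The curve has to lie in a prescribed irreducible component \<open>Y\<close> of \<open>S\<close> that contains \<open>y\<close>, also
  if \<open>y\<close> lies on several components. For this the place is chosen in two steps. A valuation ring
  with maximal ideal \<open>m\<^sub>1\<close> sends \<open>f(\<xi>)\<close> to the generic point of \<open>Y\<close> and \<open>x\<^sub>i\<close> to infinity
  (\<open>valuation_ring_exists\<close>), and the place refines it so that \<open>f(\<xi>)\<close> goes to \<open>y\<close>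
  (\<open>place_exists\<close>). The polynomials \<open>q\<close> for which the
  coefficients of \<open>q(f(\<xi> + \<kappa> T e\<^sub>j))\<close> lie in \<open>m\<^sub>1\<close> form a prime ideal \<open>Q\<close>. It consists of equations
  of \<open>Y\<close>, and it contains the leading coefficients of the equations for \<open>x\<^sub>i\<close>, so \<open>Y \<subseteq> V(Q) \<subseteq> S\<close>.
  By the Nullstellensatz \<open>V(Q)\<close> is irreducible, hence equal to \<open>Y\<close> by maximality, and the curve lies in
  \<open>V(Q)\<close> (\<open>curve_at_infinity\<close>). In this way neither limits of families of curves nor the finiteness
  of the number of components enter the argument.

  The image of a polynomial curve is itself closed, irreducible and one-dimensional
  (\<open>parametric_curve_image\<close>); closedness is again read off from a place, of \<open>K(T)\<close>.
\<close>

hide_const (open) up_ring.coeff up_ring.monom Polynomials.degree Polynomials.lead_coeff module.smult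

section \<open>Polynomials evaluated in algebras over the ground field\<close>

text \<open>Evaluation at a point with coordinates in a \<open>K\<close>-algebra with structure map
  \<open>h\<close>. The algebras that occur are \<open>K\<close> itself, the polynomial ring (then
  evaluation is substitution), the universal field \<open>\<Omega>\<close> and
  \<open>\<Omega>[T]\<close>.\<close>

definition heval :: "('a::comm_ring_1 \<Rightarrow> 'b::comm_ring_1) \<Rightarrow> 'a mpoly \<Rightarrow> (nat \<Rightarrow> 'b) \<Rightarrow> 'b" where
  "heval h p z = (\<Sum>a\<in>Poly_Mapping.keys p. h (Poly_Mapping.lookup p a) * eval_monom a z)"

lemma heval_id: "heval (\<lambda>c. c) p x = eval_mpoly p x"
  by (simp add: heval_def eval_mpoly_def)

lemma heval_superset:
  assumes "finite A" "Poly_Mapping.keys p \<subseteq> A" "h 0 = 0"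
  shows "heval h p x = (\<Sum>a\<in>A. h (Poly_Mapping.lookup p a) * eval_monom a x)"
  unfolding heval_def using assms
  by (intro sum.mono_neutral_left) (auto simp: in_keys_iff)

lemma heval_single: "h 0 = 0 \<Longrightarrow> heval h (Poly_Mapping.single a c) x = h c * eval_monom a x"
  by (subst heval_superset[of "{a}"]) auto

context comm_ring_hom
begin

lemma heval_add: "heval hom (p + q) x = heval hom p x + heval hom q x"
proof -
  let ?A = "Poly_Mapping.keys p \<union> Poly_Mapping.keys q"
  have "heval hom r x = (\<Sum>a\<in>?A. hom (Poly_Mapping.lookup r a) * eval_monom a x)"
    if "r \<in> {p, q, p + q}" for r
    by (rule heval_superset) (use that Poly_Mapping.keys_add[of p q] in auto)
  then show ?thesis
    by (simp add: lookup_add hom_add distrib_right sum.distrib)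
qed

lemma heval_0: "heval hom 0 x = 0" by (simp add: heval_def)

lemma heval_sum: "heval hom (\<Sum>i\<in>I. p i) x = (\<Sum>i\<in>I. heval hom (p i) x)"
  by (induction I rule: infinite_finite_induct) (auto simp: heval_add heval_0)

lemma heval_mult: "heval hom (p * q) x = heval hom p x * heval hom q x"
proof -
  let ?s = "\<lambda>p a. Poly_Mapping.single a (Poly_Mapping.lookup p a)"
  have "p * q = (\<Sum>a\<in>Poly_Mapping.keys p. ?s p a) * (\<Sum>b\<in>Poly_Mapping.keys q. ?s q b)"
    by (subst (1) mpoly_as_sum[of p], subst (1) mpoly_as_sum[of q]) (rule refl)
  also have "\<dots> = (\<Sum>a\<in>Poly_Mapping.keys p. \<Sum>b\<in>Poly_Mapping.keys q.
      Poly_Mapping.single (a + b) (Poly_Mapping.lookup p a * Poly_Mapping.lookup q b))"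
    by (simp add: sum_product mult_single)
  finally have pq: "p * q = \<dots>" .
  show ?thesis
    by (simp only: pq heval_sum heval_single[where h=hom, OF hom_zero] eval_monom_add)
       (simp add: heval_def sum_product hom_mult algebra_simps)
qed

lemma comm_ring_hom_heval: "comm_ring_hom (\<lambda>p. heval hom p x)"
proof
  show "heval hom 1 x = 1"
    by (simp flip: single_one add: heval_single eval_monom_def)
qed (auto simp: heval_add heval_mult heval_0)

end

lemma comm_ring_hom_id: "comm_ring_hom (\<lambda>c. c)"
  by unfold_locales auto

lemma comm_ring_hom_eval_mpoly: "comm_ring_hom (\<lambda>p. eval_mpoly p x)"
  by unfold_locales (auto simp: eval_mpoly_add eval_mpoly_mult)

definition Const :: "'a::comm_ring_1 \<Rightarrow> 'a mpoly" where
  "Const = Poly_Mapping.single 0"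
definition Var :: "nat \<Rightarrow> 'a::comm_ring_1 mpoly" where
  "Var i = Poly_Mapping.single (Poly_Mapping.single i 1) 1"

lemma comm_ring_hom_Const: "comm_ring_hom Const"
  by unfold_locales (auto simp: Const_def single_add mult_single)

lemma heval_Const: "comm_ring_hom h \<Longrightarrow> heval h (Const c) z = h c"
proof -
  assume "comm_ring_hom h" then interpret comm_ring_hom h .
  show ?thesis by (simp add: Const_def heval_single eval_monom_def)
qed

lemma heval_Var: "comm_ring_hom h \<Longrightarrow> heval h (Var i) z = z i"
proof -
  assume "comm_ring_hom h" then interpret comm_ring_hom h .
  show ?thesis by (simp add: Var_def heval_single eval_monom_def)
qed

lemma eval_Const [simp]: "eval_mpoly (Const c) x = c"
  by (simp add: Const_def eval_mpoly_single eval_monom_def)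
lemma eval_Var [simp]: "eval_mpoly (Var i) x = x i"
  by (simp add: Var_def eval_mpoly_single eval_monom_def)

lemma prod_single: "finite A \<Longrightarrow> (\<Prod>i\<in>A. Poly_Mapping.single (f i) (1::'a::comm_ring_1)) = Poly_Mapping.single (\<Sum>i\<in>A. f i :: 'b::comm_monoid_add) 1"
  by (induction A rule: finite_induct) (auto simp: mult_single)

lemma single_power: "Poly_Mapping.single (a::'b::comm_monoid_add) (1::'a::comm_ring_1) ^ k = Poly_Mapping.single ((\<Sum>i<k. a)) 1"
  by (induction k) (auto simp: mult_single add.commute)

lemma sum_const_single: "(\<Sum>i<k. Poly_Mapping.single j (1::nat)) = Poly_Mapping.single j k"
  by (induction k) (auto simp flip: single_add)

lemma Var_power: "(Var j :: 'a::comm_ring_1 mpoly) ^ k = Poly_Mapping.single (Poly_Mapping.single j k) 1"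
  unfolding Var_def single_power sum_const_single ..

lemma monomial_as_sum: "a = (\<Sum>i\<in>Poly_Mapping.keys a. Poly_Mapping.single i (Poly_Mapping.lookup a i))"
  by (rule poly_mapping_eqI)
     (auto simp: Poly_Mapping.lookup_sum lookup_single when_def in_keys_iff)

lemma eval_monom_Var: "eval_monom a Var = Poly_Mapping.single a (1::'a::comm_ring_1)"
  by (simp add: eval_monom_def Var_power prod_single flip: monomial_as_sum)

lemma heval_Const_Var: "heval Const p Var = p"
  by (simp add: heval_def eval_monom_Var Const_def mult_single flip: mpoly_as_sum)

lemma mpolys_add: "p \<in> mpolys n \<Longrightarrow> q \<in> mpolys n \<Longrightarrow> p + q \<in> mpolys n"
  using Poly_Mapping.keys_add[of p q] unfolding mpolys_def by blast
lemma mpolys_0 [simp]: "0 \<in> mpolys n" by (auto simp: mpolys_def)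
lemma mpolys_uminus: "p \<in> mpolys n \<Longrightarrow> - p \<in> mpolys n"
  by (auto simp: mpolys_def in_keys_iff)
lemma mpolys_diff: "p \<in> mpolys n \<Longrightarrow> q \<in> mpolys n \<Longrightarrow> p - q \<in> mpolys n"
  using mpolys_add[of p n "-q"] mpolys_uminus[of q n] by simp
lemma mpolys_sum: "(\<And>i. i \<in> I \<Longrightarrow> p i \<in> mpolys n) \<Longrightarrow> (\<Sum>i\<in>I. p i) \<in> mpolys n"
  by (induction I rule: infinite_finite_induct) (auto simp: mpolys_add)
lemma mpolys_prod: "(\<And>i. i \<in> I \<Longrightarrow> p i \<in> mpolys n) \<Longrightarrow> (\<Prod>i\<in>I. p i) \<in> mpolys n"
  by (induction I rule: infinite_finite_induct) (auto simp: mpolys_mult)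
lemma mpolys_power: "p \<in> mpolys n \<Longrightarrow> p ^ k \<in> mpolys n"
  by (induction k) (auto simp: mpolys_mult)
lemma mpolys_Const [simp]: "Const c \<in> mpolys n"
  by (auto simp: mpolys_def Const_def)
lemma mpolys_Var: "i < n \<Longrightarrow> Var i \<in> mpolys n"
  by (auto simp: mpolys_def Var_def)
lemma mpolys_mono: "n \<le> n' \<Longrightarrow> mpolys n \<subseteq> mpolys n'"
  by (force simp: mpolys_def)

lemma eval_uminus: "eval_mpoly (- p) x = - eval_mpoly p x"
  using eval_mpoly_add[of p "-p" x] by (simp add: eq_neg_iff_add_eq_0 add.commute)
lemma eval_diff: "eval_mpoly (p - q) x = eval_mpoly p x - eval_mpoly q x"
  using eval_mpoly_add[of p "-q" x] by (simp add: eval_uminus)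
lemma eval_prod: "eval_mpoly (\<Prod>i\<in>I. p i) x = (\<Prod>i\<in>I. eval_mpoly (p i) x)"
  by (induction I rule: infinite_finite_induct) (auto simp: eval_mpoly_mult)
lemma eval_power: "eval_mpoly (p ^ k) x = eval_mpoly p x ^ k"
  by (induction k) (auto simp: eval_mpoly_mult)

text \<open>A subring of the product of two rings, as a relation. Graphs of ring homomorphisms that are
  defined on a subring only, in particular places, have this form, and so does a subring
  \<open>R\<close> (as \<open>R \<times> UNIV\<close>).\<close>

definition ring_relation :: "('b::comm_ring_1 \<times> 'c::comm_ring_1) set \<Rightarrow> bool" where
  "ring_relation G \<longleftrightarrow> (0, 0) \<in> G \<and> (1, 1) \<in> G \<and> (\<forall>a a' b b'. (a, a') \<in> G \<longrightarrow> (b, b') \<in> G \<longrightarrow>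
     (a + b, a' + b') \<in> G \<and> (a - b, a' - b') \<in> G \<and> (a * b, a' * b') \<in> G)"

lemma ring_relationD:
  assumes "ring_relation G"
  shows "(0, 0) \<in> G" "(1, 1) \<in> G"
    "(a, a') \<in> G \<Longrightarrow> (b, b') \<in> G \<Longrightarrow> (a + b, a' + b') \<in> G"
    "(a, a') \<in> G \<Longrightarrow> (b, b') \<in> G \<Longrightarrow> (a - b, a' - b') \<in> G"
    "(a, a') \<in> G \<Longrightarrow> (b, b') \<in> G \<Longrightarrow> (a * b, a' * b') \<in> G"
  using assms unfolding ring_relation_def by blast+

lemma ring_relation_sum:
  assumes "ring_relation G" "\<And>i. i \<in> I \<Longrightarrow> (f i, f' i) \<in> G"
  shows "((\<Sum>i\<in>I. f i), (\<Sum>i\<in>I. f' i)) \<in> G"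
  using assms(2)
  by (induction I rule: infinite_finite_induct) (auto intro: ring_relationD[OF assms(1)])

lemma ring_relation_prod:
  assumes "ring_relation G" "\<And>i. i \<in> I \<Longrightarrow> (f i, f' i) \<in> G"
  shows "((\<Prod>i\<in>I. f i), (\<Prod>i\<in>I. f' i)) \<in> G"
  using assms(2)
  by (induction I rule: infinite_finite_induct) (auto intro: ring_relationD[OF assms(1)])

lemma ring_relation_power:
  assumes "ring_relation G" "(a, a') \<in> G"
  shows "(a ^ k, a' ^ k) \<in> G"
  using assms(2) by (induction k) (auto intro: ring_relationD[OF assms(1)])

lemma heval_ring_relation:
  assumes G: "ring_relation G" and "\<And>c. (h c, h' c) \<in> G" and "\<And>l. l < n \<Longrightarrow> (z l, z' l) \<in> G"
    and "p \<in> mpolys n"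
  shows "(heval h p z, heval h' p z') \<in> G"
  unfolding heval_def eval_monom_def
  by (intro ring_relation_sum[OF G] ring_relationD(5)[OF G] assms ring_relation_prod[OF G] ring_relation_power[OF G])
     (use assms(4) in \<open>auto simp: mpolys_def\<close>)

lemma ex_mpolys: "\<exists>n. p \<in> mpolys n"
proof -
  have "finite (\<Union>a\<in>Poly_Mapping.keys p. Poly_Mapping.keys a)" by auto
  then obtain n where "(\<Union>a\<in>Poly_Mapping.keys p. Poly_Mapping.keys a) \<subseteq> {..<n}"
    using finite_nat_iff_bounded by blast
  then show ?thesis unfolding mpolys_def by blast
qed

lemma heval_cong:
  assumes "p \<in> mpolys n" "\<And>l. l < n \<Longrightarrow> z l = z' l"
  shows "heval h p z = heval h p z'"
  unfolding heval_def eval_monom_def using assms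
  by (intro sum.cong prod.cong refl arg_cong2[of _ _ _ _ "(*)"]) (force simp: mpolys_def)+

lemma eval_mpoly_cong:
  assumes "p \<in> mpolys n" "\<And>l. l < n \<Longrightarrow> z l = z' l"
  shows "eval_mpoly p z = eval_mpoly p z'"
  using heval_cong[of p n z z' "\<lambda>c. c"] assms by (simp add: heval_id)

text \<open>Evaluation uses only ring operations, so every ring homomorphism passes through it. Specialisation
  of curves, substitution and restriction to a parameter value are all instances.\<close>

lemma heval_natural:
  assumes "comm_ring_hom f"
  shows "f (heval h p z) = heval (\<lambda>c. f (h c)) p (\<lambda>l. f (z l))"
proof -
  interpret comm_ring_hom f by fact
  show ?thesis
  by (auto simp: heval_def eval_monom_def hom_sum hom_mult hom_power hom_prod)
qed

lemma heval_subst: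
  assumes "comm_ring_hom h"
  shows "heval h (heval Const p F) z = heval h p (\<lambda>l. heval h (F l) z)"
  using heval_natural[OF comm_ring_hom.comm_ring_hom_heval[OF assms, where x = z], of Const p F]
  by (simp add: heval_Const[OF assms])

lemma eval_subst: "eval_mpoly (heval Const p F) x = eval_mpoly p (\<lambda>l. eval_mpoly (F l) x)"
  using heval_subst[OF comm_ring_hom_id, of p F x] by (simp add: heval_id)

lemma mpolys_subst:
  assumes "p \<in> mpolys m" "\<And>l. l < m \<Longrightarrow> F l \<in> mpolys n"
  shows "heval Const p F \<in> mpolys n"
proof -
  have "(heval Const p F, heval (\<lambda>c. c) p (\<lambda>_. 0)) \<in> mpolys n \<times> UNIV"
    by (rule heval_ring_relation[OF _ _ _ assms(1)])
       (auto simp: ring_relation_def mpolys_add mpolys_diff mpolys_mult assms(2))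
  then show ?thesis by blast
qed

text \<open>The identification of \<open>K[x\<^sub>0, ..., x\<^sub>n]\<close> with \<open>K[x\<^sub>0, ...,
  x\<^sub>n\<^sub>-\<^sub>1][x\<^sub>n]\<close>, on which inductions over the number of variables
  rest.\<close>

lemma mpolys_Suc_iff:
  "p \<in> mpolys (Suc n) \<longleftrightarrow> (\<exists>P. (\<forall>k. coeff P k \<in> mpolys n) \<and> p = poly P (Var n))"
proof
  assume p: "p \<in> mpolys (Suc n)"
  let ?Q = "\<lambda>p. \<exists>P. (\<forall>k. coeff P k \<in> mpolys n) \<and> p = poly P (Var n)"
  have sing: "?Q (Poly_Mapping.single a c)" if "Poly_Mapping.keys a \<subseteq> {..<Suc n}" for a c
  proof -
    define k where "k = Poly_Mapping.lookup a n"
    define b where "b = Poly_Mapping.update n 0 a"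
    have kb: "Poly_Mapping.keys b \<subseteq> {..<n}"
      using that by (auto simp: b_def keys_update less_Suc_eq)
    have a: "a = b + Poly_Mapping.single n k"
      by (rule poly_mapping_eqI) (auto simp: b_def k_def lookup_add lookup_update lookup_single when_def)
    have "Poly_Mapping.single a c = poly (monom (Poly_Mapping.single b c) k) (Var n)"
      by (simp add: poly_monom Var_power mult_single a)
    moreover have "\<forall>j. coeff (monom (Poly_Mapping.single b c) k) j \<in> mpolys n"
      using kb by (auto simp: coeff_monom mpolys_def)
    ultimately show ?thesis by blast
  qed
  have add: "?Q (p + q)" if "?Q p" "?Q q" for p q
  proof -
    from that obtain P P' where "\<forall>k. coeff P k \<in> mpolys n" "p = poly P (Var n)"
      "\<forall>k. coeff P' k \<in> mpolys n" "q = poly P' (Var n)" by blast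
    then show ?thesis by (intro exI[of _ "P + P'"]) (auto simp: mpolys_add)
  qed
  have "?Q (\<Sum>a\<in>A. Poly_Mapping.single a (Poly_Mapping.lookup p a))" if "finite A" "A \<subseteq> Poly_Mapping.keys p" for A
    using that
  proof (induction A rule: finite_induct)
    case empty
    then show ?case by (auto intro!: exI[of _ 0])
  next
    case (insert a A)
    have "Poly_Mapping.keys a \<subseteq> {..<Suc n}" using p insert by (auto simp: mpolys_def)
    from add[OF sing[OF this]] insert show ?case by simp
  qed
  from this[of "Poly_Mapping.keys p"] show "?Q p" by (simp flip: mpoly_as_sum)
next
  assume "\<exists>P. (\<forall>k. coeff P k \<in> mpolys n) \<and> p = poly P (Var n)"
  then obtain P where P: "\<forall>k. coeff P k \<in> mpolys n" "p = poly P (Var n)" by blast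
  then show "p \<in> mpolys (Suc n)"
    using mpolys_mono[of n "Suc n"]
    by (auto simp: poly_altdef intro!: mpolys_sum mpolys_mult mpolys_power mpolys_Var)
qed

lemma mpolys_0_iff: "p \<in> mpolys 0 \<longleftrightarrow> (\<exists>c. p = Const c)"
proof
  assume "p \<in> mpolys 0"
  then have "Poly_Mapping.keys p \<subseteq> {0}" by (auto simp: mpolys_def)
  then have "p = Const (Poly_Mapping.lookup p 0)"
    by (intro poly_mapping_eqI) (auto simp: Const_def lookup_single when_def in_keys_iff)
  then show "\<exists>c. p = Const c" ..
qed auto

lemma eval_poly_Var:
  "eval_mpoly (poly P (Var n)) x = poly (map_poly (\<lambda>a. eval_mpoly a x) P) (x n)"
proof -
  interpret comm_ring_hom "\<lambda>p. eval_mpoly p x" by (rule comm_ring_hom_eval_mpoly)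
  show ?thesis using poly_map_poly[of P "Var n"] by simp
qed


lemma infinite_UNIV_alg_closed: "infinite (UNIV :: 'a::alg_closed_field set)"
proof
  assume fin: "finite (UNIV :: 'a set)"
  define p where "p = (\<Prod>c\<in>(UNIV::'a set). [:-c, 1:]) + 1"
  have "poly p c = 1" for c
    using fin by (simp add: p_def poly_prod)
  moreover have "degree (\<Prod>c\<in>(UNIV::'a set). [:-c, 1:]) = card (UNIV :: 'a set)"
    by (subst degree_prod_eq_sum_degree) auto
  then have "degree p > 0"
    using fin by (simp add: p_def degree_add_eq_left finite_UNIV_card_ge_0)
  ultimately show False using alg_closed_imp_poly_has_root[of p] by auto
qed

lemma poly_eq_0_if_all_roots:
  "(\<And>t. poly p t = 0) \<Longrightarrow> p = (0 :: 'a::alg_closed_field poly)"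
  using poly_roots_finite[of p] infinite_UNIV_alg_closed[where ?'a='a] by auto

lemma mpoly_eq_0_if_vanishes:
  fixes p :: "'a::alg_closed_field mpoly"
  assumes "p \<in> mpolys n" "\<And>x. eval_mpoly p x = 0"
  shows "p = 0"
  using assms
proof (induction n arbitrary: p)
  case 0
  then obtain c where c: "p = Const c" by (auto simp: mpolys_0_iff)
  have "c = 0" using 0(2)[of "\<lambda>_. 0"] unfolding c by simp
  then show ?case by (simp add: c Const_def)
next
  case (Suc n)
  then obtain P where P: "\<forall>k. coeff P k \<in> mpolys n" "p = poly P (Var n)" by (auto simp: mpolys_Suc_iff)
  have "coeff P k = 0" for k
  proof (rule Suc.IH)
    fix x :: "nat \<Rightarrow> 'a"
    interpret comm_ring_hom "\<lambda>p. eval_mpoly p x" by (rule comm_ring_hom_eval_mpoly)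
    have "poly (map_poly (\<lambda>a. eval_mpoly a x) P) t = 0" for t
    proof -
      have "map_poly (\<lambda>a. eval_mpoly a x) P = map_poly (\<lambda>a. eval_mpoly a (x(n := t))) P"
        using P(1) by (intro poly_eqI) (auto simp: coeff_map_poly intro!: eval_mpoly_cong[of _ n])
      then show ?thesis using Suc.prems(2)[of "x(n := t)"] unfolding P(2) eval_poly_Var
        by (simp only: fun_upd_same)
    qed
    then have "map_poly (\<lambda>a. eval_mpoly a x) P = 0" by (rule poly_eq_0_if_all_roots)
    then show "eval_mpoly (coeff P k) x = 0" by (metis coeff_0 coeff_map_poly_hom)
  qed (use P in auto)
  then have "P = 0" by (simp add: poly_eq_iff)
  with P show ?case by simp
qed

lemma comm_ring_hom_comp: "comm_ring_hom f \<Longrightarrow> comm_ring_hom g \<Longrightarrow> comm_ring_hom (\<lambda>x. f (g x))"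
proof -
  assume "comm_ring_hom f" "comm_ring_hom g"
  then interpret f: comm_ring_hom f + g: comm_ring_hom g by auto
  show ?thesis by unfold_locales (auto simp: g.hom_add f.hom_add g.hom_mult f.hom_mult)
qed

section \<open>Subrings, ideals and valuation rings\<close>

definition subring_set :: "'b::comm_ring_1 set \<Rightarrow> bool" where
  "subring_set R \<longleftrightarrow> 0 \<in> R \<and> 1 \<in> R \<and> (\<forall>a\<in>R. \<forall>b\<in>R. a + b \<in> R \<and> a - b \<in> R \<and> a * b \<in> R)"

definition ideal_of :: "'b::comm_ring_1 set \<Rightarrow> 'b set \<Rightarrow> bool" where
  "ideal_of I R \<longleftrightarrow> I \<subseteq> R \<and> 0 \<in> I \<and> (\<forall>a\<in>I. \<forall>b\<in>I. a + b \<in> I) \<and> (\<forall>a\<in>I. \<forall>r\<in>R. r * a \<in> I)"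

lemma subring_setD:
  assumes "subring_set R"
  shows "0 \<in> R" "1 \<in> R" "a \<in> R \<Longrightarrow> b \<in> R \<Longrightarrow> a + b \<in> R" "a \<in> R \<Longrightarrow> b \<in> R \<Longrightarrow> a - b \<in> R"
    "a \<in> R \<Longrightarrow> b \<in> R \<Longrightarrow> a * b \<in> R" "a \<in> R \<Longrightarrow> - a \<in> R"
proof -
  show "a \<in> R \<Longrightarrow> - a \<in> R" using assms unfolding subring_set_def by (metis diff_0)
qed (use assms in \<open>unfold subring_set_def, blast\<close>)+

lemma ideal_ofD:
  assumes "ideal_of I R"
  shows "a \<in> I \<Longrightarrow> a \<in> R" "0 \<in> I" "a \<in> I \<Longrightarrow> b \<in> I \<Longrightarrow> a + b \<in> I" "a \<in> I \<Longrightarrow> r \<in> R \<Longrightarrow> r * a \<in> I"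
    "a \<in> I \<Longrightarrow> r \<in> R \<Longrightarrow> a * r \<in> I"
  using assms unfolding ideal_of_def by (auto simp: mult.commute)

lemma ideal_of_diff:
  assumes "ideal_of I R" "subring_set R" "a \<in> I" "b \<in> I"
  shows "a - b \<in> I"
  using ideal_ofD(3)[OF assms(1,3) ideal_ofD(4)[OF assms(1,4), of "-1"]] subring_setD(2,6)[OF assms(2)] by simp

lemma subring_set_sum: "subring_set R \<Longrightarrow> (\<And>i. i \<in> I \<Longrightarrow> f i \<in> R) \<Longrightarrow> (\<Sum>i\<in>I. f i) \<in> R"
  by (induction I rule: infinite_finite_induct) (auto simp: subring_setD)

lemma subring_set_power: "subring_set R \<Longrightarrow> a \<in> R \<Longrightarrow> a ^ k \<in> R"
  by (induction k) (auto simp: subring_setD)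

lemma ideal_of_sum: "ideal_of J R \<Longrightarrow> (\<And>i. i \<in> I \<Longrightarrow> f i \<in> J) \<Longrightarrow> (\<Sum>i\<in>I. f i) \<in> J"
  by (induction I rule: infinite_finite_induct) (auto simp: ideal_ofD)

lemma ideal_add_principal:
  assumes P: "ideal_of P R" and R: "subring_set R" and f: "f \<in> R"
  shows "ideal_of {a * f + b | a b. a \<in> R \<and> b \<in> P} R" (is "ideal_of ?J R")
    and "P \<subseteq> {a * f + b | a b. a \<in> R \<and> b \<in> P}" and "f \<in> {a * f + b | a b. a \<in> R \<and> b \<in> P}"
proof -
  note Rs = subring_setD[OF R] and Ps = ideal_ofD[OF P]
  have J: "a * f + b \<in> ?J" if "a \<in> R" "b \<in> P" for a b using that by blast
  show PJ: "P \<subseteq> ?J"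
  proof
    fix b assume "b \<in> P" then show "b \<in> ?J" using J[OF Rs(1), of b] by simp
  qed
  show "f \<in> ?J" using J[OF Rs(2) Ps(2)] by simp
  show "ideal_of ?J R"
    unfolding ideal_of_def
  proof (intro conjI ballI)
    show "?J \<subseteq> R"
    proof
      fix x assume "x \<in> ?J"
      then obtain a b where *: "x = a * f + b" "a \<in> R" "b \<in> P" by blast
      show "x \<in> R" unfolding *(1) by (intro Rs(3,5) * f Ps(1)[OF *(3)])
    qed
    show "0 \<in> ?J" using PJ Ps(2) by blast
  next
    fix x y assume "x \<in> ?J" "y \<in> ?J"
    then obtain a b a' b' where *: "x = a * f + b" "y = a' * f + b'" "a \<in> R" "a' \<in> R" "b \<in> P" "b' \<in> P"
      by blast
    then have "x + y = (a + a') * f + (b + b')" by (simp add: algebra_simps)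
    then show "x + y \<in> ?J" using * Rs(3) Ps(3) by blast
  next
    fix x y assume "x \<in> ?J" and y: "y \<in> R"
    then obtain a b where *: "x = a * f + b" "a \<in> R" "b \<in> P" by blast
    then have "y * x = (y * a) * f + (y * b)" by (simp add: algebra_simps)
    moreover have "y * a \<in> R" "y * b \<in> P" using Rs(5)[OF y *(2)] Ps(4)[OF *(3) y] by auto
    ultimately show "y * x \<in> ?J" by blast
  qed
qed

definition prime_ideal_of :: "'b::comm_ring_1 set \<Rightarrow> 'b set \<Rightarrow> bool" where
  "prime_ideal_of P R \<longleftrightarrow> ideal_of P R \<and> 1 \<notin> P \<and> (\<forall>a\<in>R. \<forall>b\<in>R. a * b \<in> P \<longrightarrow> a \<in> P \<or> b \<in> P)"

lemma prime_ideal_of_power: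
  assumes "prime_ideal_of P R" "subring_set R" "a \<in> R" "a ^ k \<in> P"
  shows "a \<in> P"
  using assms(4)
proof (induction k)
  case (Suc k)
  then show ?case using assms(1,3) subring_set_power[OF assms(2,3)] unfolding prime_ideal_of_def by auto
qed (use assms(1) in \<open>auto simp: prime_ideal_of_def\<close>)

definition polys_over :: "'b::comm_ring_1 set \<Rightarrow> 'b poly set" where
  "polys_over R = {P. \<forall>k. coeff P k \<in> R}"

lemma subring_polys_over: "subring_set R \<Longrightarrow> subring_set (polys_over R)"
  unfolding subring_set_def polys_over_def
  by (auto simp: coeff_mult coeff_pCons subring_set_def split: nat.split intro!: subring_set_sum)

lemma ideal_polys_over: "ideal_of I R \<Longrightarrow> ideal_of (polys_over I) (polys_over R)"
  unfolding polys_over_def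
  by (subst ideal_of_def) (auto simp: coeff_mult ideal_ofD intro!: ideal_of_sum)

lemma subring_set_image:
  assumes "comm_ring_hom f" "subring_set R"
  shows "subring_set (f ` R)"
proof -
  interpret comm_ring_hom f by fact
  note R = subring_setD[OF assms(2)]
  show ?thesis
    unfolding subring_set_def ball_simps
  proof (intro conjI ballI)
    show "0 \<in> f ` R" "1 \<in> f ` R" using R(1,2) hom_zero hom_one by (metis imageI)+
  next
    fix a b assume "a \<in> R" "b \<in> R"
    then show "f a + f b \<in> f ` R" "f a - f b \<in> f ` R" "f a * f b \<in> f ` R"
      using R by (auto simp flip: hom_add hom_minus hom_mult)
  qed
qed

lemma ideal_of_image:
  assumes "comm_ring_hom f" "ideal_of I R"
  shows "ideal_of (f ` I) (f ` R)"
proof -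
  interpret comm_ring_hom f by fact
  note I = ideal_ofD[OF assms(2)]
  show ?thesis
    unfolding ideal_of_def ball_simps
  proof (intro conjI ballI)
    show "f ` I \<subseteq> f ` R" using I(1) by blast
    show "0 \<in> f ` I" using I(2) hom_zero by (metis imageI)
  next
    fix a b assume "a \<in> I" "b \<in> I"
    then show "f a + f b \<in> f ` I" using I(3) by (auto simp flip: hom_add)
  next
    fix a b assume "a \<in> I" "b \<in> R"
    then show "f b * f a \<in> f ` I" using I(4) by (auto simp flip: hom_mult)
  qed
qed

lemma comm_ring_hom_poly: "comm_ring_hom (\<lambda>P. poly P x)"
  by unfold_locales auto

text \<open>The heart of Chevalley's extension theorem: \<open>1\<close> cannot be expressed both as a
  combination of positive powers of \<open>x\<close> and of \<open>1/x\<close> with coefficients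
  in \<open>m\<close>. Otherwise take such relations of minimal degrees; the shorter one,
  multiplied by a power of \<open>x\<close>, cancels the top term of the longer one, and the
  constant term changes only by an element of \<open>m\<close>, so that it can be normalised to
  \<open>1\<close> again.\<close>

lemma no_two_sided_relation:
  fixes x :: "'w::field"
  assumes V: "subring_set V" and m: "ideal_of m V" and unit: "\<And>a. a \<in> m \<Longrightarrow> a \<noteq> 1 \<and> inverse (1 - a) \<in> V"
    and "x \<noteq> 0"
    and P: "coeff P 0 = 1" "\<And>k. k > 0 \<Longrightarrow> coeff P k \<in> m" "poly P x = 0"
    and Q: "coeff Q 0 = 1" "\<And>k. k > 0 \<Longrightarrow> coeff Q k \<in> m" "poly Q (inverse x) = 0"
  shows False
  using assms(4-)
proof (induction "degree P + degree Q" arbitrary: P Q x rule: less_induct)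
  case less
  have main: False if less: "\<And>P' Q' x. degree P' + degree Q' < degree P + degree Q \<Longrightarrow> x \<noteq> 0 \<Longrightarrow>
     coeff P' 0 = 1 \<Longrightarrow> (\<And>k. k > 0 \<Longrightarrow> coeff P' k \<in> m) \<Longrightarrow> poly P' x = 0 \<Longrightarrow>
     coeff Q' 0 = 1 \<Longrightarrow> (\<And>k. k > 0 \<Longrightarrow> coeff Q' k \<in> m) \<Longrightarrow> poly Q' (inverse x) = 0 \<Longrightarrow> False"
    and x: "x \<noteq> 0" and P: "coeff P 0 = 1" "\<And>k. k > 0 \<Longrightarrow> coeff P k \<in> m" "poly P x = 0"
    and Q: "coeff Q 0 = 1" "\<And>k. k > 0 \<Longrightarrow> coeff Q k \<in> m" "poly Q (inverse x) = 0"
    and le: "degree Q \<le> degree P" for P Q x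
  proof -
    define N where "N = degree P"
    have "N > 0"
    proof (rule ccontr)
      assume "\<not> N > 0"
      then have "P = [:1:]" using P(1) unfolding N_def by (metis degree_0_id neq0_conv)
      with P(3) show False by simp
    qed
    define R where "R = (\<Sum>j\<le>N. monom (coeff Q (N - j)) j)"
    have cR: "coeff R j = (if j \<le> N then coeff Q (N - j) else 0)" for j
      by (simp add: R_def coeff_sum)
    have "poly R x = (\<Sum>j\<le>N. coeff Q (N - j) * x ^ j)"
      by (simp add: R_def poly_sum poly_monom)
    also have "\<dots> = (\<Sum>k\<le>N. coeff Q k * x ^ (N - k))"
      by (rule sum.reindex_bij_witness[of _ "\<lambda>k. N - k" "\<lambda>k. N - k"]) auto
    also have "\<dots> = x ^ N * (\<Sum>k\<le>N. coeff Q k * inverse x ^ k)"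
      unfolding sum_distrib_left using x by (intro sum.cong) (auto simp: power_diff field_simps)
    also have "(\<Sum>k\<le>N. coeff Q k * inverse x ^ k) = (\<Sum>k\<le>degree Q. coeff Q k * inverse x ^ k)"
      using le by (intro sum.mono_neutral_right) (auto simp: N_def coeff_eq_0)
    finally have R0: "poly R x = 0" using Q(3) by (simp add: poly_altdef)
    define c where "c = 1 - coeff P N * coeff Q N"
    have Qc: "coeff Q k \<in> V" for k
      using Q(1) Q(2)[of k] ideal_ofD(1)[OF m] subring_setD(2)[OF V] by (cases k) auto
    have "coeff P N * coeff Q N \<in> m" using P(2) \<open>N > 0\<close> Qc ideal_ofD(5)[OF m] by blast
    from unit[OF this] have c: "c \<noteq> 0" "inverse c \<in> V" by (auto simp: c_def)
    define P' where "P' = smult (inverse c) (P - smult (coeff P N) R)"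
    have c': "coeff P' k = inverse c * (coeff P k - coeff P N * coeff R k)" for k
      by (simp add: P'_def)
    have "coeff P' 0 = 1" using c by (simp add: c' P(1) cR flip: c_def)
    moreover have "coeff P' k \<in> m" if "k > 0" for k
      unfolding c' using that P(2) Qc
      by (intro ideal_ofD(4)[OF m] c ideal_of_diff[OF m V] ideal_ofD(5)[OF m]) (auto simp: cR \<open>N > 0\<close> subring_setD[OF V])
    moreover have "poly P' x = 0" using R0 P by (simp add: P'_def)
    moreover have "degree P' < N"
    proof -
      have "coeff P' k = 0" if "k \<ge> N" for k
        using that by (cases "k = N") (auto simp: c' cR Q(1) N_def coeff_eq_0)
      then show ?thesis using \<open>N > 0\<close> by (metis leI leading_coeff_0_iff degree_0)
    qed
    ultimately show False using less[of P' Q x] x Q by (auto simp: N_def)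
  qed
  show False
  proof (cases "degree Q \<le> degree P")
    case True
    show False
      by (rule main[of P Q x]) (use less True in \<open>blast+\<close>)
  next
    case False
    show False
    proof (rule main[of Q P "inverse x"])
      fix P' Q' :: "'w poly" and y
      assume "degree P' + degree Q' < degree Q + degree P" "y \<noteq> 0"
        "coeff P' 0 = 1" "\<And>k. k > 0 \<Longrightarrow> coeff P' k \<in> m" "poly P' y = 0"
        "coeff Q' 0 = 1" "\<And>k. k > 0 \<Longrightarrow> coeff Q' k \<in> m" "poly Q' (inverse y) = 0"
      then show False by (intro less.hyps[of P' Q' y]) auto
    qed (use less.prems False in auto)
  qed
qed

text \<open>Zorn's lemma gives a maximal pair of a ring \<open>V\<close> and an ideal \<open>m\<close>
  avoiding \<open>S\<close>. Localising at the differences of elements of \<open>S\<close> and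
  \<open>m\<close> and adjoining an element or its inverse must not enlarge the pair; the two
  possible obstructions to adjoining \<open>x\<close> and \<open>1/x\<close> exclude each other by
  the previous lemma. With \<open>S\<close> the complement of a prime ideal \<open>\<pp>\<close>
  in \<open>R\<close>, the ideal \<open>m\<close> meets \<open>R\<close> exactly in
  \<open>\<pp>\<close>.\<close>

lemma valuation_ring_exists:
  fixes R \<pp> S :: "'w::field set"
  assumes R: "subring_set R" and \<pp>: "ideal_of \<pp> R"
    and S: "S \<subseteq> R" "1 \<in> S" "\<And>s t. s \<in> S \<Longrightarrow> t \<in> S \<Longrightarrow> s * t \<in> S" "S \<inter> \<pp> = {}"
  shows "\<exists>V m. subring_set V \<and> R \<subseteq> V \<and> ideal_of m V \<and> \<pp> \<subseteq> m \<and> S \<inter> m = {} \<and>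
    (\<forall>x. x \<in> V \<or> inverse x \<in> m)"
proof -
  define adm where "adm V m \<longleftrightarrow> subring_set V \<and> R \<subseteq> V \<and> ideal_of m V \<and> \<pp> \<subseteq> m \<and> S \<inter> m = {}" for V m
  define A where "A = {G :: ('w + 'w) set. adm (Inl -` G) (Inr -` G)}"
  have "\<exists>M\<in>A. \<forall>Y\<in>A. M \<subseteq> Y \<longrightarrow> Y = M"
  proof (rule subset_Zorn_nonempty)
    have "Inl ` R \<union> Inr ` \<pp> \<in> A"
      using assms by (simp add: A_def adm_def vimage_Un inj_vimage_image_eq)
         (auto simp: vimage_def image_iff)
    then show "A \<noteq> {}" by blast
  next
    fix C assume C: "C \<noteq> {}" "subset.chain A C"
    have two: "\<exists>Y\<in>C. a \<in> Y \<and> b \<in> Y" if "a \<in> \<Union>C" "b \<in> \<Union>C" for a b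
      using that C(2) unfolding subset.chain_def by blast
    have CA: "adm (Inl -` Y) (Inr -` Y)" if "Y \<in> C" for Y
      using C(2) that by (auto simp: subset.chain_def A_def)
    obtain Y0 where "Y0 \<in> C" using C(1) by blast
    have "adm (Inl -` \<Union>C) (Inr -` \<Union>C)"
      unfolding adm_def
    proof (intro conjI)
      show "subring_set (Inl -` \<Union>C)"
        unfolding subring_set_def
      proof (intro conjI ballI)
        fix a b assume "a \<in> Inl -` \<Union>C" "b \<in> Inl -` \<Union>C"
        then obtain Y where "Y \<in> C" "a \<in> Inl -` Y" "b \<in> Inl -` Y" using two[of "Inl a" "Inl b"] by auto
        with CA[of Y] show "a + b \<in> Inl -` \<Union>C" "a - b \<in> Inl -` \<Union>C" "a * b \<in> Inl -` \<Union>C"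
          by (auto simp: adm_def subring_set_def)
      qed (use CA[OF \<open>Y0 \<in> C\<close>] \<open>Y0 \<in> C\<close> in \<open>auto simp: adm_def subring_set_def\<close>)
      show "ideal_of (Inr -` \<Union>C) (Inl -` \<Union>C)"
        unfolding ideal_of_def
      proof (intro conjI ballI)
        show "Inr -` \<Union>C \<subseteq> Inl -` \<Union>C"
        proof
          fix a assume "a \<in> Inr -` \<Union>C"
          then obtain Y where "Y \<in> C" "a \<in> Inr -` Y" by auto
          with CA[of Y] have "a \<in> Inl -` Y" unfolding adm_def ideal_of_def by blast
          with \<open>Y \<in> C\<close> show "a \<in> Inl -` \<Union>C" by auto
        qed
        show "0 \<in> Inr -` \<Union>C" using CA[OF \<open>Y0 \<in> C\<close>] \<open>Y0 \<in> C\<close> by (auto simp: adm_def ideal_of_def)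
      next
        fix a b assume "a \<in> Inr -` \<Union>C" "b \<in> Inr -` \<Union>C"
        then obtain Y where "Y \<in> C" "a \<in> Inr -` Y" "b \<in> Inr -` Y" using two[of "Inr a" "Inr b"] by auto
        with CA[of Y] have "a + b \<in> Inr -` Y" unfolding adm_def ideal_of_def by blast
        with \<open>Y \<in> C\<close> show "a + b \<in> Inr -` \<Union>C" by blast
      next
        fix a b assume "a \<in> Inr -` \<Union>C" "b \<in> Inl -` \<Union>C"
        then obtain Y where "Y \<in> C" "a \<in> Inr -` Y" "b \<in> Inl -` Y" using two[of "Inr a" "Inl b"] by auto
        with CA[of Y] have "b * a \<in> Inr -` Y" unfolding adm_def ideal_of_def by blast
        with \<open>Y \<in> C\<close> show "b * a \<in> Inr -` \<Union>C" by blast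
      qed
      show "R \<subseteq> Inl -` \<Union>C" "\<pp> \<subseteq> Inr -` \<Union>C"
        using CA[OF \<open>Y0 \<in> C\<close>] \<open>Y0 \<in> C\<close> by (auto simp: adm_def)
      have "S \<inter> Inr -` Y = {}" if "Y \<in> C" for Y using CA[OF that] by (simp add: adm_def)
      then show "S \<inter> Inr -` \<Union>C = {}" by blast
    qed
    then show "\<Union>C \<in> A" by (simp add: A_def)
  qed
  then obtain M where M: "M \<in> A" "\<And>Y. Y \<in> A \<Longrightarrow> M \<subseteq> Y \<Longrightarrow> Y = M" by blast
  define V m where "V = Inl -` M" and "m = Inr -` M"
  have adm: "adm V m" using M(1) by (simp add: A_def V_def m_def)
  have max: "V' = V \<and> m' = m" if "adm V' m'" "V \<subseteq> V'" "m \<subseteq> m'" for V' m'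
  proof -
    let ?Y = "Inl ` V' \<union> Inr ` m'"
    have v: "Inl -` ?Y = V'" "Inr -` ?Y = m'" by (auto simp: vimage_def image_iff)
    have "M \<subseteq> ?Y"
    proof
      fix g assume "g \<in> M" then show "g \<in> ?Y" using that(2,3) by (cases g) (auto simp: V_def m_def)
    qed
    then have "?Y = M" using that(1) by (intro M(2)) (simp_all only: A_def v mem_Collect_eq)
    then show ?thesis using v by (simp add: V_def m_def)
  qed
  have V: "subring_set V" "R \<subseteq> V" and m: "ideal_of m V" "\<pp> \<subseteq> m" "S \<inter> m = {}"
    using adm by (auto simp: adm_def)
  note Vs = subring_setD[OF V(1)] and ms = ideal_ofD[OF m(1)]
  have SV: "s \<in> V" if "s \<in> S" for s using that S(1) V(2) by blast
  have nS: "s \<noteq> t" if "s \<in> S" "t \<in> m" for s t using that m(3) by blast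

  have unit: "s - b \<noteq> 0 \<and> inverse (s - b) \<in> V" if "s \<in> S" "b \<in> m" for s b
  proof -
    \<comment> \<open>Localise at the multiplicative set \<open>T\<close>; the ideal still avoids \<open>S\<close>, so
      nothing new arises.\<close>
    define T where "T = {s - b | s b. s \<in> S \<and> b \<in> m}"
    have T1: "1 \<in> T" using S(2) ms(2) unfolding T_def by (metis (mono_tags, lifting) diff_zero mem_Collect_eq)
    have T0: "t \<noteq> 0" if "t \<in> T" for t using that nS by (auto simp: T_def)
    have TV: "t \<in> V" if "t \<in> T" for t using that SV Vs ms(1) by (auto simp: T_def)
    have Tm: "t * u \<in> T" if "t \<in> T" "u \<in> T" for t u
    proof -
      from that obtain s b s' b' where *: "t = s - b" "u = s' - b'" "s \<in> S" "s' \<in> S" "b \<in> m" "b' \<in> m"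
        by (auto simp: T_def)
      have "t * u = s * s' - (s * b' + (s' - b') * b)" unfolding *(1,2) by (simp add: algebra_simps)
      moreover have "s * b' + (s' - b') * b \<in> m" using * by (intro ms Vs SV) auto
      ultimately show ?thesis using S(3) * unfolding T_def by blast
    qed
    define V' m' where "V' = {a / t | a t. a \<in> V \<and> t \<in> T}" and "m' = {a / t | a t. a \<in> m \<and> t \<in> T}"
    have divV: "a / t \<in> V'" if "a \<in> V" "t \<in> T" for a t using that unfolding V'_def by blast
    have divm: "a / t \<in> m'" if "a \<in> m" "t \<in> T" for a t using that unfolding m'_def by blast
    have subV: "V \<subseteq> V'" using divV[OF _ T1] by auto
    have subm: "m \<subseteq> m'" using divm[OF _ T1] by auto
    have "adm V' m'"
      unfolding adm_def
    proof (intro conjI)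
      show "subring_set V'"
        unfolding subring_set_def
      proof (intro conjI ballI)
        fix x y assume "x \<in> V'" "y \<in> V'"
        then obtain a t b u where *: "x = a / t" "y = b / u" "a \<in> V" "b \<in> V" "t \<in> T" "u \<in> T"
          by (auto simp: V'_def)
        have "x + y = (a * u + b * t) / (t * u)" "x - y = (a * u - b * t) / (t * u)" "x * y = (a * b) / (t * u)"
          using * T0 by (auto simp: field_simps)
        moreover have "a * u + b * t \<in> V" "a * u - b * t \<in> V" "a * b \<in> V" using * TV by (auto intro!: Vs)
        ultimately show "x + y \<in> V'" "x - y \<in> V'" "x * y \<in> V'" using Tm[OF *(5,6)] unfolding V'_def by blast+
      next
        show "0 \<in> V'" "1 \<in> V'" using Vs(1,2) subV by auto
      qed
      show "ideal_of m' V'"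
        unfolding ideal_of_def
      proof (intro conjI ballI)
        show "m' \<subseteq> V'" using ms(1) by (auto simp: m'_def V'_def)
        show "0 \<in> m'" using ms(2) subm by auto
      next
        fix x y assume "x \<in> m'" "y \<in> m'"
        then obtain a t b u where *: "x = a / t" "y = b / u" "a \<in> m" "b \<in> m" "t \<in> T" "u \<in> T"
          by (auto simp: m'_def)
        have "x + y = (a * u + b * t) / (t * u)" using * T0 by (auto simp: field_simps)
        moreover have "a * u + b * t \<in> m" by (intro ms(3,5) TV *)
        ultimately show "x + y \<in> m'" using Tm[OF *(5,6)] unfolding m'_def by blast
      next
        fix x y assume "x \<in> m'" "y \<in> V'"
        then obtain a t b u where *: "x = a / t" "y = b / u" "a \<in> m" "b \<in> V" "t \<in> T" "u \<in> T"
          by (auto simp: m'_def V'_def)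
        have "y * x = (b * a) / (t * u)" using * T0 by (auto simp: field_simps)
        moreover have "b * a \<in> m" by (intro ms(4) *)
        ultimately show "y * x \<in> m'" using Tm[OF *(5,6)] unfolding m'_def by blast
      qed
      show "R \<subseteq> V'" "\<pp> \<subseteq> m'" using V(2) m(2) subV subm by auto
      show "S \<inter> m' = {}"
      proof (rule ccontr)
        assume "S \<inter> m' \<noteq> {}"
        then obtain s a s' b where *: "s \<in> S" "s = a / (s' - b)" "a \<in> m" "s' \<in> S" "b \<in> m"
          by (auto simp: m'_def T_def)
        have "s' - b \<noteq> 0" using nS[of s' b] * by auto
        then have "s * s' = a + s * b" using * by (simp add: field_simps)
        moreover have "a + s * b \<in> m" using * by (intro ms SV)
        ultimately show False using nS[OF S(3)[OF *(1,4)]] by metis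
      qed
    qed
    then have "V' = V" using max subV subm by blast
    moreover have "s - b \<in> T" using that unfolding T_def by blast
    then have "1 / (s - b) \<in> V'" using divV Vs(2) by blast
    ultimately show ?thesis using T0[OF \<open>s - b \<in> T\<close>] by (simp add: inverse_eq_divide)
  qed

  have rel: "\<exists>P. coeff P 0 = 1 \<and> (\<forall>k>0. coeff P k \<in> m) \<and> poly P x = 0" if "x \<notin> V" for x
  proof -
    \<comment> \<open>Adjoining \<open>x\<close> must fail, so an element \<open>s \<in> S\<close> is a polynomial in
      \<open>x\<close> with coefficients in \<open>m\<close>.\<close>
    define V' m' where "V' = (\<lambda>P. poly P x) ` polys_over V" and "m' = (\<lambda>P. poly P x) ` polys_over m"
    have C: "[:c:] \<in> polys_over I" if "c \<in> I" "0 \<in> I" for c I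
      using that by (auto simp: polys_over_def coeff_pCons split: nat.split)
    note pV = subring_setD[OF subring_polys_over[OF V(1)]] and pm = ideal_ofD[OF ideal_polys_over[OF m(1)]]
    have sub: "V \<subseteq> V'" "m \<subseteq> m'"
      using C[of _ V] C[of _ m] Vs(1) ms(2) unfolding V'_def m'_def by force+
    have "x \<in> V'"
      using Vs(1,2) unfolding V'_def by (intro image_eqI[of _ _ "[:0,1:]"]) (auto simp: polys_over_def coeff_pCons split: nat.split)
    have "S \<inter> m' \<noteq> {}"
    proof
      assume "S \<inter> m' = {}"
      moreover have "subring_set V'" "ideal_of m' V'"
        unfolding V'_def m'_def using V(1) m(1)
        by (auto intro!: subring_set_image ideal_of_image comm_ring_hom_poly subring_polys_over ideal_polys_over)
      ultimately have "adm V' m'" using V(2) m(2) sub by (auto simp: adm_def)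
      with max sub have "V' = V" by blast
      with \<open>x \<in> V'\<close> that show False by simp
    qed
    then obtain s P where P: "s \<in> S" "s = poly P x" "\<And>k. coeff P k \<in> m" by (auto simp: m'_def polys_over_def)
    define c where "c = s - coeff P 0"
    have c: "c \<noteq> 0" "inverse c \<in> V" using unit P by (auto simp: c_def)
    define Q where "Q = smult (inverse c) ([:s:] - P)"
    have "coeff Q 0 = 1" using c by (simp add: Q_def c_def[symmetric])
    moreover have "coeff Q k \<in> m" if "k > 0" for k
    proof -
      have "coeff Q k = - inverse c * coeff P k" using that by (cases k) (auto simp: Q_def)
      then show ?thesis using ms(4)[OF P(3) Vs(6)[OF c(2)]] by (simp only:)
    qed
    moreover have "poly Q x = 0" by (simp add: Q_def P(2))
    ultimately show ?thesis by blast
  qed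
  have dich: "x \<in> V \<or> inverse x \<in> V" for x
  proof (rule ccontr)
    assume *: "\<not> (x \<in> V \<or> inverse x \<in> V)"
    then have "x \<noteq> 0" using Vs(1) by auto
    obtain P Q where "coeff P 0 = 1" "\<forall>k>0. coeff P k \<in> m" "poly P x = 0"
       "coeff Q 0 = 1" "\<forall>k>0. coeff Q k \<in> m" "poly Q (inverse x) = 0"
      using * rel by blast
    then show False
      using unit[OF S(2)] \<open>x \<noteq> 0\<close> by (intro no_two_sided_relation[OF V(1) m(1), of x P Q]) auto
  qed
  have inv: "inverse a \<in> V" if "a \<in> V" "a \<notin> m" for a
  proof -
    define m' where "m' = {r * a + b | r b. r \<in> V \<and> b \<in> m}"
    have m': "ideal_of m' V" "m \<subseteq> m'" "a \<in> m'"
      unfolding m'_def by (rule ideal_add_principal[OF m(1) V(1) that(1)])+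
    then have "S \<inter> m' \<noteq> {}" using max[of V m'] that(2) V m(2) by (auto simp: adm_def)
    then obtain s b \<mu> where *: "s \<in> S" "s = b * a + \<mu>" "\<mu> \<in> m" "b \<in> V" by (auto simp: m'_def)
    have "b * a \<noteq> 0 \<and> inverse (b * a) \<in> V" using unit[of s \<mu>] * by simp
    moreover have "inverse a = b * inverse (b * a)" if "b * a \<noteq> 0" using that by (simp add: field_simps)
    ultimately show ?thesis using *(4) Vs(5) by metis
  qed
  have "x \<in> V \<or> inverse x \<in> m" for x
    using dich[of x] inv[of "inverse x"] by auto
  then show ?thesis by (intro exI[of _ V] exI[of _ m] conjI allI V m)
qed

lemma prime_polys_over:
  assumes V: "subring_set V" and m: "prime_ideal_of m V"
  shows "prime_ideal_of (polys_over m) (polys_over V)"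
proof -
  have mi: "ideal_of m V" using m by (simp add: prime_ideal_of_def)
  show ?thesis
    unfolding prime_ideal_of_def
  proof (intro conjI ballI impI)
    show "ideal_of (polys_over m) (polys_over V)" by (rule ideal_polys_over[OF mi])
    show "1 \<notin> polys_over m"
    proof
      assume "1 \<in> polys_over m"
      then have "coeff 1 0 \<in> m" unfolding polys_over_def by blast
      then show False using m by (simp add: prime_ideal_of_def)
    qed
  next
    fix A B assume AB: "A \<in> polys_over V" "B \<in> polys_over V" "A * B \<in> polys_over m"
    show "A \<in> polys_over m \<or> B \<in> polys_over m"
    proof (rule ccontr)
      assume "\<not> ?thesis"
      then have ex: "\<exists>i. coeff A i \<notin> m" "\<exists>j. coeff B j \<notin> m" by (auto simp: polys_over_def)
      define i where "i = (LEAST i. coeff A i \<notin> m)"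
      define j where "j = (LEAST j. coeff B j \<notin> m)"
      have i: "coeff A i \<notin> m" "\<And>k. k < i \<Longrightarrow> coeff A k \<in> m"
        unfolding i_def using LeastI_ex[OF ex(1)] not_less_Least by blast+
      have j: "coeff B j \<notin> m" "\<And>k. k < j \<Longrightarrow> coeff B k \<in> m"
        unfolding j_def using LeastI_ex[OF ex(2)] not_less_Least by blast+
      have cV: "coeff A k \<in> V" "coeff B k \<in> V" for k using AB by (auto simp: polys_over_def)
      have "coeff (A * B) (i + j) = coeff A i * coeff B j + (\<Sum>k\<in>{..i + j} - {i}. coeff A k * coeff B (i + j - k))"
        unfolding coeff_mult by (subst sum.remove[of _ i]) auto
      moreover have "(\<Sum>k\<in>{..i + j} - {i}. coeff A k * coeff B (i + j - k)) \<in> m"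
      proof (rule ideal_of_sum[OF mi])
        fix k assume k: "k \<in> {..i + j} - {i}"
        show "coeff A k * coeff B (i + j - k) \<in> m"
        proof (cases "k < i")
          case True
          then show ?thesis using ideal_ofD(5)[OF mi i(2) cV(2)] by blast
        next
          case False
          then have "i + j - k < j" using k by auto
          then show ?thesis using ideal_ofD(4)[OF mi j(2) cV(1)] by blast
        qed
      qed
      moreover have "coeff (A * B) (i + j) \<in> m" using AB(3) by (simp add: polys_over_def)
      ultimately have "coeff A i * coeff B j \<in> m"
        using ideal_of_diff[OF mi V] by (metis add_diff_cancel_right')
      then show False using m cV i(1) j(1) unfolding prime_ideal_of_def by blast
    qed
  qed
qed

lemma valuation_ring_prime:
  fixes V m :: "'w::field set"
  assumes "subring_set V" "ideal_of m V" "1 \<notin> m" "\<And>x. x \<in> V \<or> inverse x \<in> m"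
  shows "prime_ideal_of m V"
  unfolding prime_ideal_of_def
proof (intro conjI ballI impI assms)
  fix a b assume ab: "a \<in> V" "b \<in> V" "a * b \<in> m"
  show "a \<in> m \<or> b \<in> m"
  proof (rule ccontr)
    assume *: "\<not> (a \<in> m \<or> b \<in> m)"
    then have "inverse a \<in> V" "inverse b \<in> V" "a \<noteq> 0" "b \<noteq> 0"
      using assms(4)[of "inverse a"] assms(4)[of "inverse b"] ideal_ofD(2)[OF assms(2)] by auto
    then have "inverse b * (inverse a * (a * b)) \<in> m" using ideal_ofD(4)[OF assms(2)] ab(3) by blast
    then show False using \<open>a \<noteq> 0\<close> \<open>b \<noteq> 0\<close> assms(3) by (simp add: field_simps)
  qed
qed

text \<open>The divisibility relation of a valuation ring is a total preorder.\<close>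

lemma valuation_ring_common_multiple:
  fixes V :: "'w::field set"
  assumes V: "subring_set V" "\<And>x. x \<in> V \<or> inverse x \<in> V" and M: "finite M" "M \<noteq> {}" "0 \<notin> M"
  shows "\<exists>\<mu>\<in>M. \<forall>\<nu>\<in>M. \<mu> / \<nu> \<in> V"
  using M
proof (induction M rule: finite_ne_induct)
  case (singleton a)
  then show ?case using subring_setD(2)[OF V(1)] by simp
next
  case (insert a M)
  then obtain \<mu> where \<mu>: "\<mu> \<in> M" "\<forall>\<nu>\<in>M. \<mu> / \<nu> \<in> V" by auto
  have nz: "a \<noteq> 0" "\<mu> \<noteq> 0" using insert \<mu> by auto
  show ?case
  proof (cases "\<mu> / a \<in> V")
    case True
    then show ?thesis using \<mu> by blast
  next
    case False
    then have "inverse (\<mu> / a) \<in> V" using V(2) by blast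
    then have am: "a / \<mu> \<in> V" by (simp add: field_simps)
    have "a / \<nu> \<in> V" if "\<nu> \<in> M" for \<nu>
    proof -
      have "(a / \<mu>) * (\<mu> / \<nu>) \<in> V" using subring_setD(5)[OF V(1) am] \<mu>(2) that by blast
      then show ?thesis using nz by simp
    qed
    moreover have "a / a \<in> V" using nz subring_setD(2)[OF V(1)] by simp
    ultimately show ?thesis by blast
  qed
qed

section \<open>Places with values in an algebraically closed field\<close>

lemma ring_relation_subring: "ring_relation G \<Longrightarrow> subring_set {a. \<exists>c. (a, c) \<in> G}"
  unfolding subring_set_def by (blast intro: ring_relationD)

lemma ring_relation_kernel: "ring_relation G \<Longrightarrow> ideal_of {a. (a, 0) \<in> G} {a. \<exists>c. (a, c) \<in> G}"
  unfolding ideal_of_def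
  using ring_relationD(3)[of G _ 0 _ 0] ring_relationD(5)[of G _ _ _ 0] ring_relationD(1)[of G] by auto

text \<open>The extension of a partial homomorphism to polynomials, coefficient by coefficient.\<close>

definition poly_relation :: "('b::comm_ring_1 \<times> 'c::comm_ring_1) set \<Rightarrow> ('b poly \<times> 'c poly) set" where
  "poly_relation G = {(P, Q). \<forall>k. (coeff P k, coeff Q k) \<in> G}"

lemma poly_relation_const:
  assumes "ring_relation G" "(a, b) \<in> G"
  shows "([:a:], [:b:]) \<in> poly_relation G"
  using assms ring_relationD(1)[OF assms(1)] unfolding poly_relation_def
  by (auto simp: coeff_pCons split: nat.split)

lemma poly_relation_monom:
  assumes "ring_relation G" "(a, b) \<in> G"
  shows "(monom a k, monom b k) \<in> poly_relation G"
  using assms ring_relationD(1)[OF assms(1)] unfolding poly_relation_def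
  by auto

lemma ring_relation_poly_relation:
  assumes G: "ring_relation G"
  shows "ring_relation (poly_relation G)"
proof -
  have one: "(1, 1) \<in> poly_relation G"
    using poly_relation_const[OF G ring_relationD(2)[OF G]] by (simp add: one_pCons)
  have zero: "(0, 0) \<in> poly_relation G"
    using poly_relation_const[OF G ring_relationD(1)[OF G]] by simp
  show ?thesis
    unfolding ring_relation_def
  proof (intro conjI allI impI one zero)
    fix a a' b b' assume "(a, a') \<in> poly_relation G" "(b, b') \<in> poly_relation G"
    then have *: "\<And>k. (coeff a k, coeff a' k) \<in> G" "\<And>k. (coeff b k, coeff b' k) \<in> G"
      by (auto simp: poly_relation_def)
    show "(a + b, a' + b') \<in> poly_relation G" "(a - b, a' - b') \<in> poly_relation G"
      using ring_relationD(3,4)[OF G] * by (auto simp: poly_relation_def)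
    show "(a * b, a' * b') \<in> poly_relation G"
      unfolding poly_relation_def coeff_mult mem_Collect_eq case_prod_conv
      by (intro allI ring_relation_sum[OF G] ring_relationD(5)[OF G] *)
  qed
qed

lemma ring_relation_image:
  assumes f: "comm_ring_hom f" and g: "comm_ring_hom g" and G: "ring_relation G"
  shows "ring_relation {(f a, g b) | a b. (a, b) \<in> G}"
proof -
  interpret f: comm_ring_hom f by fact
  interpret g: comm_ring_hom g by fact
  let ?H = "{(f a, g b) | a b. (a, b) \<in> G}"
  have in_H: "(f a, g b) \<in> ?H" if "(a, b) \<in> G" for a b using that by blast
  show ?thesis
    unfolding ring_relation_def
  proof (intro conjI allI impI)
    show "(0, 0) \<in> ?H" "(1, 1) \<in> ?H"
      using in_H[OF ring_relationD(1)[OF G]] in_H[OF ring_relationD(2)[OF G]] by simp_all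
  next
    fix a a' b b' assume "(a, a') \<in> ?H" "(b, b') \<in> ?H"
    then obtain c c' d d' where *: "a = f c" "a' = g c'" "b = f d" "b' = g d'" "(c, c') \<in> G" "(d, d') \<in> G"
      by blast
    show "(a + b, a' + b') \<in> ?H" "(a - b, a' - b') \<in> ?H" "(a * b, a' * b') \<in> ?H"
      unfolding * using in_H[OF ring_relationD(3)[OF G *(5,6)]] in_H[OF ring_relationD(4)[OF G *(5,6)]]
        in_H[OF ring_relationD(5)[OF G *(5,6)]]
      by (simp_all add: f.hom_add g.hom_add f.hom_minus g.hom_minus f.hom_mult g.hom_mult)
  qed
qed

text \<open>Again a maximal extension is taken, now of the graph of a homomorphism into \<open>K\<close>. If
  there is no obstruction to adjoining \<open>x\<close>, the images of the polynomials
  annihilating \<open>x\<close> have a common root \<open>c\<close>, because \<open>K\<close> is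
  algebraically closed, and \<open>c\<close> is a possible value at \<open>x\<close>. That the
  values stay in \<open>K\<close>, rather than in an extension, is what makes places produce
  points of affine space over \<open>K\<close>.\<close>

lemma place_exists:
  fixes G0 :: "('w::field \<times> 'a::alg_closed_field) set"
  assumes G0: "ring_relation G0" "\<And>b. (0, b) \<in> G0 \<Longrightarrow> b = 0"
  shows "\<exists>G. ring_relation G \<and> G0 \<subseteq> G \<and> (\<forall>b. (0, b) \<in> G \<longrightarrow> b = 0) \<and>
    (\<forall>x. (\<exists>c. (x, c) \<in> G) \<or> (inverse x, 0) \<in> G)"
proof -
  define A where "A = {G :: ('w \<times> 'a) set. ring_relation G \<and> G0 \<subseteq> G \<and> (\<forall>b. (0, b) \<in> G \<longrightarrow> b = 0)}"
  have "\<exists>M\<in>A. \<forall>Y\<in>A. M \<subseteq> Y \<longrightarrow> Y = M"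
  proof (rule subset_Zorn_nonempty)
    show "A \<noteq> {}" using assms by (auto simp: A_def)
  next
    fix C assume C: "C \<noteq> {}" "subset.chain A C"
    have two: "\<exists>Y\<in>C. a \<in> Y \<and> b \<in> Y" if "a \<in> \<Union>C" "b \<in> \<Union>C" for a b
      using that C(2) unfolding subset.chain_def by blast
    have CA: "Y \<in> A" if "Y \<in> C" for Y
      using C(2) that by (auto simp: subset.chain_def A_def)
    obtain Y0 where "Y0 \<in> C" using C(1) by blast
    note Y0 = CA[OF this, unfolded A_def, simplified]
    have "ring_relation (\<Union>C)"
      unfolding ring_relation_def
    proof (intro conjI allI impI)
      show "(0, 0) \<in> \<Union>C" "(1, 1) \<in> \<Union>C"
        using Y0 \<open>Y0 \<in> C\<close> ring_relationD(1,2)[of Y0] by blast+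
    next
      fix a a' b b' assume "(a, a') \<in> \<Union>C" "(b, b') \<in> \<Union>C"
      then obtain Y where Y: "Y \<in> C" "(a, a') \<in> Y" "(b, b') \<in> Y" using two by blast
      then have "ring_relation Y" using CA by (simp add: A_def)
      then show "(a + b, a' + b') \<in> \<Union>C" "(a - b, a' - b') \<in> \<Union>C" "(a * b, a' * b') \<in> \<Union>C"
        using Y ring_relationD(3,4,5)[of Y] by blast+
    qed
    moreover have "G0 \<subseteq> \<Union>C" using Y0 \<open>Y0 \<in> C\<close> by blast
    moreover have "\<forall>b. (0, b) \<in> \<Union>C \<longrightarrow> b = 0" using CA unfolding A_def by blast
    ultimately show "\<Union>C \<in> A" by (simp add: A_def)
  qed
  then obtain G where GA: "G \<in> A" and max: "\<And>Y. Y \<in> A \<Longrightarrow> G \<subseteq> Y \<Longrightarrow> Y = G" by blast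
  have G: "ring_relation G" "G0 \<subseteq> G" and G_fun: "\<And>b. (0, b) \<in> G \<Longrightarrow> b = 0" using GA by (auto simp: A_def)
  note Gs = ring_relationD[OF G(1)]

  have inv: "a \<noteq> 0 \<and> (inverse a, inverse b) \<in> G" if "(a, b) \<in> G" "b \<noteq> 0" for a b
  proof -
    define G' where "G' = {(x / a, u / b) | x u a b. (x, u) \<in> G \<and> (a, b) \<in> G \<and> b \<noteq> 0}"
    have G'I: "(x / a, u / b) \<in> G'" if "(x, u) \<in> G" "(a, b) \<in> G" "b \<noteq> 0" for x u a b
      using that unfolding G'_def by blast
    have nz: "a \<noteq> 0" if "(a, b) \<in> G" "b \<noteq> 0" for a b using that G_fun by blast
    have sub: "G \<subseteq> G'"
    proof
      fix y assume "y \<in> G"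
      then show "y \<in> G'" using G'I[of "fst y" "snd y" 1 1] Gs(2) by simp
    qed
    have "ring_relation G'"
      unfolding ring_relation_def
    proof (intro conjI allI impI)
      show "(0, 0) \<in> G'" "(1, 1) \<in> G'" using sub Gs by blast+
    next
      fix p p' q q' assume "(p, p') \<in> G'" "(q, q') \<in> G'"
      then obtain x u a b y v c d where *: "p = x / a" "p' = u / b" "q = y / c" "q' = v / d"
        "(x, u) \<in> G" "(a, b) \<in> G" "b \<noteq> 0" "(y, v) \<in> G" "(c, d) \<in> G" "d \<noteq> 0"
        unfolding G'_def by blast
      have "p + q = (x * c + y * a) / (a * c)" "p' + q' = (u * d + v * b) / (b * d)"
        "p - q = (x * c - y * a) / (a * c)" "p' - q' = (u * d - v * b) / (b * d)"
        "p * q = (x * y) / (a * c)" "p' * q' = (u * v) / (b * d)"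
        using * nz[of a b] nz[of c d] by (auto simp: field_simps)
      moreover have "(a * c, b * d) \<in> G" "b * d \<noteq> 0" "(x * c + y * a, u * d + v * b) \<in> G"
         "(x * c - y * a, u * d - v * b) \<in> G" "(x * y, u * v) \<in> G"
        using * by (auto intro!: Gs)
      ultimately show "(p + q, p' + q') \<in> G'" "(p - q, p' - q') \<in> G'" "(p * q, p' * q') \<in> G'"
        using G'I by auto
    qed
    moreover have "\<forall>b. (0, b) \<in> G' \<longrightarrow> b = 0"
    proof (intro allI impI)
      fix b assume "(0, b) \<in> G'"
      then obtain x u a c where *: "x / a = 0" "b = u / c" "(x, u) \<in> G" "(a, c) \<in> G" "c \<noteq> 0"
        unfolding G'_def by auto
      then have "x = 0" using nz[of a c] by simp
      then show "b = 0" using * G_fun by simp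
    qed
    ultimately have "G' = G" using max[of G'] sub G(2) by (auto simp: A_def)
    then show ?thesis using G'I[OF Gs(2) that] nz[OF that] by (simp add: inverse_eq_divide)
  qed

  define V m where "V = {a. \<exists>c. (a, c) \<in> G}" and "m = {a. (a, 0) \<in> G}"
  have V: "subring_set V" and m: "ideal_of m V"
    using ring_relation_subring[OF G(1)] ring_relation_kernel[OF G(1)] by (auto simp: V_def m_def)
  have unit: "a \<noteq> 1 \<and> inverse (1 - a) \<in> V" if "a \<in> m" for a
  proof -
    have "(1 - a, 1 - 0) \<in> G" using that Gs(4)[OF Gs(2), of a 0] by (simp add: m_def)
    from inv[OF this] show ?thesis by (auto simp: V_def)
  qed
  have rel: "\<exists>P. coeff P 0 = 1 \<and> (\<forall>k>0. coeff P k \<in> m) \<and> poly P x = 0" if "x \<notin> V" for x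
  proof (rule ccontr)
    assume no: "\<not> ?thesis"
    let ?GX = "poly_relation G"
    note GX = ring_relation_poly_relation[OF G(1)]
    note GXs = ring_relationD[OF GX]
    \<comment> \<open>A value \<open>c\<close> at \<open>x\<close> is consistent if and only if it is a root of every
      \<open>Q \<in> J\<close>. An element \<open>h \<noteq> 0\<close> of least degree divides
      them all, and it is not constant, for otherwise the excluded relation would exist.\<close>
    define J where "J = {Q. \<exists>P. (P, Q) \<in> ?GX \<and> poly P x = 0}"
    have lead: "\<exists>a. (a, lead_coeff Q) \<in> G" if "Q \<in> J" for Q
      using that by (auto simp: J_def poly_relation_def)
    have "\<exists>c. \<forall>Q\<in>J. poly Q c = 0"
    proof (cases "\<exists>h\<in>J. h \<noteq> 0")
      case False
      then show ?thesis by (metis poly_0)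
    next
      case True
      then obtain h where h: "h \<in> J" "h \<noteq> 0" and min: "\<And>g. g \<in> J \<Longrightarrow> g \<noteq> 0 \<Longrightarrow> degree h \<le> degree g"
        using exists_least_iff[of "\<lambda>d. \<exists>h\<in>J. h \<noteq> 0 \<and> degree h = d"] by (metis linorder_not_le)
      have "degree h > 0"
      proof (rule ccontr)
        assume "\<not> degree h > 0"
        then obtain e where e: "h = [:e:]" using degree_eq_zeroE by blast
        with h obtain P where P: "(P, [:e:]) \<in> ?GX" "poly P x = 0" "e \<noteq> 0" by (auto simp: J_def)
        then have Pk: "(coeff P k, coeff [:e:] k) \<in> G" for k by (auto simp: poly_relation_def)
        have P0: "coeff P 0 \<noteq> 0" "(inverse (coeff P 0), inverse e) \<in> G" using inv[OF Pk[of 0]] P(3) by auto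
        let ?Q = "smult (inverse (coeff P 0)) P"
        have "coeff ?Q k \<in> m" if "k > 0" for k
          using Gs(5)[OF P0(2) Pk[of k]] that by (cases k) (auto simp: m_def)
        moreover have "coeff ?Q 0 = 1" "poly ?Q x = 0" using P0 P by auto
        ultimately show False using no by blast
      qed
      then obtain c where c: "poly h c = 0" using alg_closed_imp_poly_has_root by blast
      have "poly Q c = 0" if "Q \<in> J" for Q
        using that
      proof (induction "degree Q" arbitrary: Q rule: less_induct)
        case less
        show ?case
        proof (cases "Q = 0")
          case False
          define k where "k = degree Q - degree h"
          have dk: "degree Q = k + degree h" using min[OF less.prems False] by (simp add: k_def)
          define q where "q = lead_coeff Q * inverse (lead_coeff h)"
          obtain a b where ab: "(a, lead_coeff Q) \<in> G" "(b, lead_coeff h) \<in> G" using lead less.prems h(1) by meson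
          have q: "(a * inverse b, q) \<in> G" unfolding q_def using ab inv[OF ab(2)] h(2) by (intro Gs(5)) auto
          obtain P1 P2 where P: "(P1, Q) \<in> ?GX" "poly P1 x = 0" "(P2, h) \<in> ?GX" "poly P2 x = 0"
            using less.prems h(1) by (auto simp: J_def)
          define Q' where "Q' = Q - monom q k * h"
          have "(P1 - monom (a * inverse b) k * P2, Q') \<in> ?GX"
            unfolding Q'_def using P q by (intro GXs poly_relation_monom[OF G(1)])
          moreover have "poly (P1 - monom (a * inverse b) k * P2) x = 0" using P by simp
          ultimately have "Q' \<in> J" unfolding J_def by blast
          moreover have "Q' = 0 \<or> degree Q' < degree Q"
          proof -
            have "q \<noteq> 0" using False h(2) by (simp add: q_def)
            then have "degree (monom q k * h) = degree Q" using h(2) dk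
              by (simp add: degree_mult_eq degree_monom_eq)
            then have "degree Q' \<le> degree Q" unfolding Q'_def by (simp add: degree_diff_le)
            moreover have "coeff (monom q k * h) (k + degree h) = lead_coeff Q"
              using h(2) by (simp add: coeff_monom_mult q_def)
            then have "coeff Q' (degree Q) = 0" by (simp add: Q'_def dk)
            ultimately show ?thesis using eq_zero_or_degree_less by blast
          qed
          ultimately have "poly Q' c = 0" using less.hyps[of Q'] by auto
          then show ?thesis by (simp add: Q'_def c)
        qed auto
      qed
      then show ?thesis by blast
    qed
    then obtain c where c: "\<And>Q. Q \<in> J \<Longrightarrow> poly Q c = 0" by blast
    define G' where "G' = {(poly P x, poly Q c) | P Q. (P, Q) \<in> ?GX}"
    have "ring_relation G'"
      unfolding G'_def by (rule ring_relation_image[OF comm_ring_hom_poly comm_ring_hom_poly GX])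
    moreover have sub: "G \<subseteq> G'"
    proof
      fix y assume "y \<in> G"
      then have "([:fst y:], [:snd y:]) \<in> ?GX" by (intro poly_relation_const[OF G(1)]) auto
      then have "(poly [:fst y:] x, poly [:snd y:] c) \<in> G'" unfolding G'_def by blast
      then show "y \<in> G'" by simp
    qed
    moreover have "\<forall>b. (0, b) \<in> G' \<longrightarrow> b = 0"
    proof (intro allI impI)
      fix b assume "(0, b) \<in> G'"
      then obtain P Q where "(P, Q) \<in> ?GX" "0 = poly P x" "b = poly Q c" unfolding G'_def by blast
      then show "b = 0" using c[of Q] by (auto simp: J_def)
    qed
    ultimately have "G' = G" using max[of G'] G(2) by (auto simp: A_def)
    moreover have "(x, c) \<in> G'"
    proof -
      have "(monom 1 1, monom 1 1) \<in> ?GX" by (intro poly_relation_monom G Gs)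
      then have "(poly (monom 1 1) x, poly (monom 1 1) c) \<in> G'" unfolding G'_def by blast
      then show ?thesis by (simp add: poly_monom)
    qed
    ultimately have "(x, c) \<in> G" by simp
    then show False using that unfolding V_def by blast
  qed
  have dich: "(\<exists>c. (x, c) \<in> G) \<or> (inverse x, 0) \<in> G" for x
  proof (cases "x \<in> V")
    case False
    have "inverse x \<in> V"
    proof (rule ccontr)
      assume "inverse x \<notin> V"
      moreover have "x \<noteq> 0" using False subring_setD(1)[OF V] by auto
      moreover obtain P Q where "coeff P 0 = 1" "\<forall>k>0. coeff P k \<in> m" "poly P x = 0"
         "coeff Q 0 = 1" "\<forall>k>0. coeff Q k \<in> m" "poly Q (inverse x) = 0"
        using False \<open>inverse x \<notin> V\<close> rel by blast
      ultimately show False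
        using unit by (intro no_two_sided_relation[OF V m, of x P Q]) auto
    qed
    then obtain c where c: "(inverse x, c) \<in> G" by (auto simp: V_def)
    moreover have "c = 0"
      using inv[OF c] False by (auto simp: V_def)
    ultimately show ?thesis by blast
  qed (auto simp: V_def)
  show ?thesis by (intro exI[of _ G] conjI allI impI G dich) (rule G_fun)
qed

section \<open>The Nullstellensatz\<close>

lemma monom_in_polys_over: "a \<in> R \<Longrightarrow> 0 \<in> R \<Longrightarrow> monom a k \<in> polys_over R"
  by (auto simp: polys_over_def)

lemma const_in_polys_over: "a \<in> R \<Longrightarrow> 0 \<in> R \<Longrightarrow> [:a:] \<in> polys_over R"
  by (auto simp: polys_over_def coeff_pCons split: nat.split)

text \<open>The bound on the degree of the quotient is part of the claim because over a ring with zero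
  divisors it does not follow from the equation.\<close>

lemma pseudo_division_over:
  fixes f g :: "'r::comm_ring_1 poly"
  assumes R: "subring_set R" and g: "g \<in> polys_over R" and f: "f \<in> polys_over R"
  shows "\<exists>N q r. q \<in> polys_over R \<and> r \<in> polys_over R \<and> smult (lead_coeff g ^ N) f = q * g + r \<and>
    (r = 0 \<or> degree r < degree g) \<and> (q = 0 \<or> degree q + degree g \<le> degree f)"
  using f
proof (induction "degree f" arbitrary: f rule: less_induct)
  case less
  note Rs = subring_setD[OF R] and Ps = subring_setD[OF subring_polys_over[OF R]]
  show ?case
  proof (cases "f = 0 \<or> degree f < degree g")
    case True
    then show ?thesis
      using less.prems Ps(1) by (intro exI[of _ 0] exI[of _ 0] exI[of _ f]) auto
  next
    case False
    define k where "k = degree f - degree g"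
    have dk: "degree f = k + degree g" using False by (simp add: k_def)
    define c where "c = lead_coeff g"
    have cR: "c \<in> R" "lead_coeff f \<in> R" using g less.prems by (auto simp: c_def polys_over_def)
    define f' where "f' = smult c f - monom (lead_coeff f) k * g"
    have smult_R: "smult a p \<in> polys_over R" if "a \<in> R" "p \<in> polys_over R" for a p
      using that Rs(5) by (auto simp: polys_over_def)
    have mon: "monom (lead_coeff f) k \<in> polys_over R" using monom_in_polys_over cR Rs(1) by blast
    have f'R: "f' \<in> polys_over R"
      unfolding f'_def using mon less.prems g cR by (intro Ps smult_R) auto
    have "coeff f' j = 0" if "j \<ge> degree f" for j
    proof (cases "j = degree f")
      case True
      then show ?thesis by (simp add: f'_def coeff_monom_mult c_def dk)
    next
      case False
      then have "j > degree f" using that by simp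
      then have "coeff f j = 0" "coeff g (j - k) = 0" using dk by (auto intro!: coeff_eq_0)
      then show ?thesis by (simp add: f'_def coeff_monom_mult)
    qed
    then have f'0: "f' = 0 \<or> degree f' < degree f"
      by (metis leI leading_coeff_0_iff)
    have "\<exists>N q r. q \<in> polys_over R \<and> r \<in> polys_over R \<and> smult (c ^ N) f' = q * g + r \<and>
      (r = 0 \<or> degree r < degree g) \<and> (q = 0 \<or> degree q + degree g \<le> degree f)"
    proof (cases "f' = 0")
      case True
      then show ?thesis using Ps(1) by (intro exI[of _ 0] exI[of _ 0] exI[of _ 0]) auto
    next
      case False
      then have lt: "degree f' < degree f" using f'0 by simp
      from less.hyps[OF this f'R] obtain N q r where
        "q \<in> polys_over R" "r \<in> polys_over R" "smult (c ^ N) f' = q * g + r"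
        "r = 0 \<or> degree r < degree g" "q = 0 \<or> degree q + degree g \<le> degree f'" unfolding c_def by blast
      then show ?thesis using lt by (intro exI[of _ N] exI[of _ q] exI[of _ r]) auto
    qed
    then obtain N q r where *: "q \<in> polys_over R" "r \<in> polys_over R" "smult (c ^ N) f' = q * g + r"
      "r = 0 \<or> degree r < degree g" "q = 0 \<or> degree q + degree g \<le> degree f" by blast
    define q' where "q' = q + smult (c ^ N) (monom (lead_coeff f) k)"
    have "smult (c ^ Suc N) f = smult (c ^ N) f' + smult (c ^ N) (monom (lead_coeff f) k) * g"
      by (simp add: f'_def smult_diff_right mult.commute[of c])
    also have "\<dots> = q' * g + r" by (simp add: *(3) q'_def algebra_simps)
    finally have "smult (c ^ Suc N) f = q' * g + r" .
    moreover have "q' \<in> polys_over R"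
      unfolding q'_def using * mon by (intro Ps smult_R subring_set_power[OF R] cR) auto
    moreover have "degree q' + degree g \<le> degree f"
    proof -
      have "degree q \<le> k" using *(5) dk by auto
      moreover have "degree (smult (c ^ N) (monom (lead_coeff f) k)) \<le> k"
        by (meson degree_monom_le degree_smult_le order_trans)
      ultimately have "degree q' \<le> k" unfolding q'_def by (rule degree_add_le)
      then show ?thesis using dk by simp
    qed
    ultimately show ?thesis using *(2,4) unfolding c_def by blast
  qed
qed

text \<open>The inductive step of the Nullstellensatz, as the statement that a general point
  \<open>\<theta>\<close> of the contracted ideal \<open>R \<inter> PP\<close> lifts to a point of
  \<open>PP\<close> at which \<open>h\<close> does not vanish. Call a polynomial bad if not all
  its coefficients lie in \<open>PP\<close>. If \<open>PP\<close> has no bad elements, any value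
  \<open>t\<close> that is not a root of \<open>h\<close> will do. Otherwise a bad \<open>p \<in>
  PP\<close> of least degree plays the role of a minimal polynomial: by pseudo-division the zeros
  of \<open>PP\<close> over \<open>\<theta>\<close> are the roots of \<open>p\<close>, provided
  that its leading coefficient \<open>c\<close> survives. As \<open>p\<close> is irreducible over
  the fraction field of \<open>R / (R \<inter> PP)\<close> and does not divide \<open>h\<close>,
  some nonzero constant \<open>w0\<close> is a combination of \<open>h\<close> and
  \<open>PP\<close>; where it survives, \<open>h\<close> is nonzero at the roots of
  \<open>p\<close>. So \<open>u = c * w0\<close> works.\<close>

lemma prime_ideal_fibre_point:
  fixes PP :: "'r::comm_ring_1 poly set"
  assumes R: "subring_set R" and PP: "prime_ideal_of PP (polys_over R)"
    and h: "h \<in> polys_over R" "h \<notin> PP"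
  obtains u where "u \<in> R" "[:u:] \<notin> PP"
    "\<And>\<theta> :: 'r \<Rightarrow> 'a::alg_closed_field. comm_ring_hom \<theta> \<Longrightarrow> (\<And>r. r \<in> R \<Longrightarrow> [:r:] \<in> PP \<Longrightarrow> \<theta> r = 0) \<Longrightarrow> \<theta> u \<noteq> 0 \<Longrightarrow>
       \<exists>t. (\<forall>g\<in>PP. poly (map_poly \<theta> g) t = 0) \<and> poly (map_poly \<theta> h) t \<noteq> 0"
proof -
  let ?RX = "polys_over R"
  note Rs = subring_setD[OF R] and RX = subring_polys_over[OF R]
  note RXs = subring_setD[OF RX]
  have PPi: "ideal_of PP ?RX" using PP by (simp add: prime_ideal_of_def)
  note PPs = ideal_ofD[OF PPi]
  have prime: "a \<in> PP \<or> b \<in> PP" if "a * b \<in> PP" "a \<in> ?RX" "b \<in> ?RX" for a b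
    using that PP by (auto simp: prime_ideal_of_def)
  have cR: "coeff g k \<in> R" if "g \<in> ?RX" for g k using that by (simp add: polys_over_def)
  have C: "[:a:] \<in> ?RX" if "a \<in> R" for a using const_in_polys_over that Rs(1) by blast
  have M: "monom a k \<in> ?RX" if "a \<in> R" for a k using monom_in_polys_over that Rs(1) by blast
  have P0i: "ideal_of {r \<in> R. [:r:] \<in> PP} R"
    unfolding ideal_of_def
  proof (intro conjI ballI)
    fix a b assume "a \<in> {r \<in> R. [:r:] \<in> PP}" "b \<in> {r \<in> R. [:r:] \<in> PP}"
    then show "a + b \<in> {r \<in> R. [:r:] \<in> PP}" using Rs(3) PPs(3)[of "[:a:]" "[:b:]"] by simp
  next
    fix a b assume "a \<in> {r \<in> R. [:r:] \<in> PP}" "b \<in> R"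
    then show "b * a \<in> {r \<in> R. [:r:] \<in> PP}" using Rs(5) PPs(4)[OF _ C[of b], of "[:a:]"] by (simp add: mult.commute)
  qed (use Rs(1) PPs(2) in auto)
  define bad where "bad g \<longleftrightarrow> (\<exists>k. [:coeff g k:] \<notin> PP)" for g
  have monPP: "monom a k \<in> PP" if "[:a:] \<in> PP" for a k
  proof -
    have "monom a k = monom 1 k * [:a:]" by (simp add: smult_monom)
    then show ?thesis using PPs(4)[OF that M[OF Rs(2)]] by simp
  qed
  have not_bad: "g \<in> PP" if "\<not> bad g" for g
  proof -
    have "(\<Sum>i\<le>degree g. monom (coeff g i) i) \<in> PP"
      using that by (intro ideal_of_sum[OF PPi] monPP) (auto simp: bad_def)
    then show ?thesis by (simp add: poly_as_sum_of_monoms)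
  qed
  have bad0: "\<not> bad 0" using PPs(2) by (simp add: bad_def)
  have minimal: "\<exists>w\<in>J. bad w \<and> [:lead_coeff w:] \<notin> PP \<and> (\<forall>g\<in>J. bad g \<longrightarrow> degree w \<le> degree g)"
    if J: "ideal_of J ?RX" "PP \<subseteq> J" and ex: "\<exists>g\<in>J. bad g" for J
  proof -
    obtain w where w: "w \<in> J" "bad w" and min: "\<And>g. g \<in> J \<Longrightarrow> bad g \<Longrightarrow> degree w \<le> degree g"
      using ex exists_least_iff[of "\<lambda>d. \<exists>h\<in>J. bad h \<and> degree h = d"] by (metis linorder_not_le)
    have "[:lead_coeff w:] \<notin> PP"
    proof
      assume l: "[:lead_coeff w:] \<in> PP"
      define w' where "w' = w - monom (lead_coeff w) (degree w)"
      have "w' \<in> J" unfolding w'_def using w(1) monPP[OF l] J by (intro ideal_of_diff[OF J(1) RX]) auto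
      obtain k where k: "[:coeff w k:] \<notin> PP" using w(2) by (auto simp: bad_def)
      then have "k \<noteq> degree w" using l by auto
      then have "coeff w' k = coeff w k" by (simp add: w'_def)
      then have "bad w'" using k unfolding bad_def by metis
      then have "w' \<noteq> 0" using bad0 by auto
      have "coeff w' j = 0" if "j \<ge> degree w" for j
        using that by (cases "j = degree w") (auto simp: w'_def coeff_eq_0)
      then have "degree w' < degree w" using \<open>w' \<noteq> 0\<close> by (metis leI leading_coeff_0_iff)
      then show False using min[OF \<open>w' \<in> J\<close> \<open>bad w'\<close>] by simp
    qed
    then show ?thesis using w min by blast
  qed
  have map0: "map_poly \<theta> g = 0" if "\<not> bad g" "g \<in> ?RX" "comm_ring_hom \<theta>" "\<And>r. r \<in> R \<Longrightarrow> [:r:] \<in> PP \<Longrightarrow> \<theta> r = 0"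
    for g and \<theta> :: "'r \<Rightarrow> 'a"
  proof -
    interpret comm_ring_hom \<theta> by fact
    show ?thesis using that(1) that(4)[OF cR[OF that(2)]] by (intro poly_eqI) (auto simp: bad_def)
  qed
  show ?thesis
  proof (cases "\<exists>g\<in>PP. bad g")
    case False
    from h(2) not_bad obtain k where k: "[:coeff h k:] \<notin> PP" unfolding bad_def by blast
    show ?thesis
    proof (rule that[of "coeff h k"])
      fix \<theta> :: "'r \<Rightarrow> 'a" assume \<theta>: "comm_ring_hom \<theta>" "\<And>r. r \<in> R \<Longrightarrow> [:r:] \<in> PP \<Longrightarrow> \<theta> r = 0" "\<theta> (coeff h k) \<noteq> 0"
      interpret comm_ring_hom \<theta> by fact
      have "map_poly \<theta> h \<noteq> 0" using \<theta>(3) by (metis coeff_0 coeff_map_poly_hom)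
      then obtain t where "poly (map_poly \<theta> h) t \<noteq> 0" using poly_eq_0_if_all_roots by blast
      moreover have "poly (map_poly \<theta> g) t = 0" if "g \<in> PP" for g
        using map0[of g \<theta>] \<theta> that False PPs(1) by simp
      ultimately show "\<exists>t. (\<forall>g\<in>PP. poly (map_poly \<theta> g) t = 0) \<and> poly (map_poly \<theta> h) t \<noteq> 0" by blast
    qed (use k h cR in auto)
  next
    case True
    obtain p where p: "p \<in> PP" "bad p" "[:lead_coeff p:] \<notin> PP" and pmin: "\<And>g. g \<in> PP \<Longrightarrow> bad g \<Longrightarrow> degree p \<le> degree g"
      using minimal[OF PPi order_refl True] by blast
    define c where "c = lead_coeff p"
    have pR: "p \<in> ?RX" using p PPs(1) by blast
    have "degree p > 0"
    proof (rule ccontr)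
      assume "\<not> degree p > 0"
      then have "p = [:lead_coeff p:]" by (metis degree_0_id neq0_conv)
      then show False using p by metis
    qed
    define J where "J = {a * h + b | a b. a \<in> ?RX \<and> b \<in> PP}"
    note Jfacts = ideal_add_principal[OF PPi RX h(1), folded J_def]
    have PJ: "PP \<subseteq> J" and hJ: "h \<in> J" and Ji: "ideal_of J ?RX" using Jfacts by auto
    note Js = ideal_ofD[OF Ji]
    obtain w where w: "w \<in> J" "bad w" "[:lead_coeff w:] \<notin> PP" and wmin: "\<And>g. g \<in> J \<Longrightarrow> bad g \<Longrightarrow> degree w \<le> degree g"
      using minimal[OF Ji PJ] p(1,2) PJ by blast
    define e where "e = lead_coeff w"
    have eR: "e \<in> R" unfolding e_def using cR Js(1)[OF w(1)] by blast
    have ePP: "[:e ^ k:] \<notin> PP" for k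
      using prime_ideal_of_power[OF PP RX C[OF eR], of k] w(3) by (auto simp: e_def poly_const_pow)
    have rem: "r \<in> PP" if "smult (e ^ k) f = q * w + r" "f \<in> J" "q \<in> ?RX" "r \<in> ?RX" "r = 0 \<or> degree r < degree w" for f q r k
    proof -
      have "r = [:e ^ k:] * f - q * w" using that(1) by simp
      moreover have "[:e ^ k:] * f \<in> J" "q * w \<in> J"
        using Js(4)[OF that(2) C[OF subring_set_power[OF R eR]]] Js(4)[OF w(1) that(3)] by blast+
      ultimately have "r \<in> J" using ideal_of_diff[OF Ji RX] by simp
      then show ?thesis using that(5) wmin[of r] not_bad[of r] bad0 by fastforce
    qed
    \<comment> \<open>If \<open>w\<close> had positive degree, it would divide \<open>p\<close> and \<open>h\<close>
      modulo \<open>PP\<close>, up to powers of \<open>e\<close>. As \<open>PP\<close> is prime,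
      \<open>w\<close> or the cofactor \<open>q\<close> of \<open>p\<close> lies in
      \<open>PP\<close>. The former implies \<open>h \<in> PP\<close>; the latter contradicts the
      choice of \<open>p\<close>, as \<open>q\<close> is bad and of smaller degree.\<close>
    have "degree w = 0"
    proof (rule ccontr)
      assume dw: "degree w \<noteq> 0"
      have wR: "w \<in> ?RX" using Js(1)[OF w(1)] .
      obtain k q r where *: "q \<in> ?RX" "r \<in> ?RX" "smult (e ^ k) p = q * w + r" "r = 0 \<or> degree r < degree w"
         "q = 0 \<or> degree q + degree w \<le> degree p"
        using pseudo_division_over[OF R wR pR] unfolding e_def by blast
      have rP: "r \<in> PP" using rem[OF *(3) _ *(1,2,4)] p(1) PJ by blast
      have "q * w = [:e ^ k:] * p - r" using *(3) by simp
      moreover have "[:e ^ k:] * p \<in> PP" using PPs(4)[OF p(1) C[OF subring_set_power[OF R eR]]] .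
      ultimately have "q * w \<in> PP" using ideal_of_diff[OF PPi RX] rP by simp
      then consider "w \<in> PP" | "q \<in> PP" using prime[OF _ *(1) wR] by blast
      then show False
      proof cases
        case 1
        obtain k q r where *: "q \<in> ?RX" "r \<in> ?RX" "smult (e ^ k) h = q * w + r" "r = 0 \<or> degree r < degree w"
          using pseudo_division_over[OF R wR h(1)] unfolding e_def by blast
        have "r \<in> PP" using rem[OF *(3) hJ *(1,2,4)] .
        moreover have "[:e ^ k:] * h = q * w + r" using *(3) by simp
        ultimately have "[:e ^ k:] * h \<in> PP" using PPs(3)[OF PPs(4)[OF 1 *(1)]] by metis
        then show False using prime[OF _ C[OF subring_set_power[OF R eR]] h(1)] ePP h(2) by blast
      next
        case 2
        have "degree w \<le> degree p" using wmin[of p] p PJ by blast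
        then have "coeff r (degree p) = 0" using *(4) by (auto intro: coeff_eq_0)
        then have top: "coeff (q * w) (degree p) = e ^ k * c"
          using arg_cong[OF *(3), of "\<lambda>f. coeff f (degree p)"] by (simp add: c_def)
        have "bad q"
        proof (rule ccontr)
          assume nb: "\<not> bad q"
          have "[:coeff (q * w) (degree p):] \<in> PP"
          proof -
            have "coeff q i \<in> {r \<in> R. [:r:] \<in> PP}" for i using nb cR[OF *(1)] by (simp add: bad_def)
            then have "coeff (q * w) (degree p) \<in> {r \<in> R. [:r:] \<in> PP}"
              unfolding coeff_mult by (intro ideal_of_sum[OF P0i] ideal_ofD(5)[OF P0i] cR[OF wR])
            then show ?thesis by simp
          qed
          then have "[:e ^ k:] * [:c:] \<in> PP" by (simp add: top mult.commute)
          then show False using prime[OF _ C[OF subring_set_power[OF R eR]] C[OF cR[OF pR]]] ePP p(3)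
            unfolding c_def by blast
        qed
        then have "degree p \<le> degree q" "q \<noteq> 0" using pmin 2 bad0 by auto
        then show False using *(5) dw by simp
      qed
    qed
    then obtain w0 where w0: "w = [:w0:]" using degree_eq_zeroE by blast
    obtain a b where ab: "w = a * h + b" "a \<in> ?RX" "b \<in> PP" using w(1) by (auto simp: J_def)
    have w0R: "w0 \<in> R" using eR by (simp add: e_def w0)
    have w0P: "[:w0:] \<notin> PP" using w(3) by (simp add: w0)
    have cRR: "c \<in> R" unfolding c_def using cR pR by blast
    show ?thesis
    proof (rule that[of "c * w0"])
      show "c * w0 \<in> R" using Rs(5) cRR w0R by blast
      have "[:c * w0:] = [:c:] * [:w0:]" by simp
      then show "[:c * w0:] \<notin> PP" using prime[OF _ C[OF cRR] C[OF w0R]] w0P p(3) unfolding c_def by metis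
    next
      fix \<theta> :: "'r \<Rightarrow> 'a" assume \<theta>: "comm_ring_hom \<theta>" "\<And>r. r \<in> R \<Longrightarrow> [:r:] \<in> PP \<Longrightarrow> \<theta> r = 0" "\<theta> (c * w0) \<noteq> 0"
      interpret comm_ring_hom \<theta> by fact
      interpret mh: map_poly_comm_ring_hom \<theta> ..
      have nz: "\<theta> c \<noteq> 0" "\<theta> w0 \<noteq> 0" using \<theta>(3) by (auto simp: hom_mult)
      have "coeff (map_poly \<theta> p) (degree p) \<noteq> 0" using nz by (simp add: c_def)
      then have "degree p \<le> degree (map_poly \<theta> p)" by (rule le_degree)
      then have "degree (map_poly \<theta> p) > 0" using \<open>degree p > 0\<close> by linarith
      then obtain t where t: "poly (map_poly \<theta> p) t = 0" using alg_closed_imp_poly_has_root by blast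
      have zero: "poly (map_poly \<theta> g) t = 0" if "g \<in> PP" for g
      proof -
        have gR: "g \<in> ?RX" using that PPs(1) by blast
        obtain k q r where *: "q \<in> ?RX" "r \<in> ?RX" "smult (c ^ k) g = q * p + r" "r = 0 \<or> degree r < degree p"
          using pseudo_division_over[OF R pR gR] unfolding c_def by blast
        have "r = [:c ^ k:] * g - q * p" using *(3) by simp
        moreover have "[:c ^ k:] * g \<in> PP" "q * p \<in> PP"
          using PPs(4)[OF that C[OF subring_set_power[OF R cRR]]] PPs(4)[OF p(1) *(1)] by blast+
        ultimately have "r \<in> PP" using ideal_of_diff[OF PPi RX] by simp
        then have "\<not> bad r" using *(4) pmin[of r] bad0 by (metis linorder_not_le)
        then have "map_poly \<theta> r = 0" using map0[OF _ *(2) \<theta>(1,2)] by blast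
        then have "smult (\<theta> (c ^ k)) (map_poly \<theta> g) = map_poly \<theta> q * map_poly \<theta> p"
          using arg_cong[OF *(3), of "map_poly \<theta>"] by (simp add: mh.hom_add mh.hom_mult map_poly_hom_smult)
        from arg_cong[OF this, of "\<lambda>f. poly f t"] show ?thesis using nz(1) t by (simp add: hom_power)
      qed
      have "map_poly \<theta> w = map_poly \<theta> a * map_poly \<theta> h + map_poly \<theta> b"
        by (simp add: ab(1) mh.hom_add mh.hom_mult)
      from arg_cong[OF this, of "\<lambda>f. poly f t"] have "\<theta> w0 = poly (map_poly \<theta> a) t * poly (map_poly \<theta> h) t"
        using zero[OF ab(3)] by (simp add: w0 map_poly_pCons_hom)
      then have "poly (map_poly \<theta> h) t \<noteq> 0" using nz(2) by auto
      with zero show "\<exists>t. (\<forall>g\<in>PP. poly (map_poly \<theta> g) t = 0) \<and> poly (map_poly \<theta> h) t \<noteq> 0" by blast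
    qed
  qed
qed

lemma eval_poly_Var_update:
  assumes "Q \<in> polys_over (mpolys n)"
  shows "eval_mpoly (poly Q (Var n)) (x(n := t)) = poly (map_poly (\<lambda>a. eval_mpoly a x) Q) t"
proof -
  have "map_poly (\<lambda>a. eval_mpoly a x) Q = map_poly (\<lambda>a. eval_mpoly a (x(n := t))) Q"
    using assms by (intro poly_eqI) (auto simp: polys_over_def coeff_map_poly intro!: eval_mpoly_cong[of _ n])
  then show ?thesis unfolding eval_poly_Var by (simp only: fun_upd_same)
qed

lemma subring_mpolys: "subring_set (mpolys n)"
  by (auto simp: subring_set_def mpolys_add mpolys_diff mpolys_mult)

lemma prime_ideal_point:
  fixes P :: "'a::alg_closed_field mpoly set"
  assumes "prime_ideal_of P (mpolys n)" "h \<in> mpolys n" "h \<notin> P"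
  shows "\<exists>x. (\<forall>p\<in>P. eval_mpoly p x = 0) \<and> eval_mpoly h x \<noteq> 0"
  using assms
proof (induction n arbitrary: P h)
  case 0
  then have P: "ideal_of P (mpolys 0)" "1 \<notin> P" by (auto simp: prime_ideal_of_def)
  have "p = 0" if p: "p \<in> P" for p
  proof (rule ccontr)
    assume "p \<noteq> 0"
    obtain c where c: "p = Const c" using mpolys_0_iff ideal_ofD(1)[OF P(1) p] by blast
    with \<open>p \<noteq> 0\<close> have "c \<noteq> 0" by (auto simp: Const_def)
    then have "Const (inverse c) * p = 1" by (simp add: c Const_def mult_single)
    moreover have "Const (inverse c) * p \<in> P" using ideal_ofD(4)[OF P(1) p] by simp
    ultimately show False using P(2) by simp
  qed
  moreover obtain c where "h = Const c" using 0 mpolys_0_iff by blast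
  moreover have "0 \<in> P" using ideal_ofD(2)[OF P(1)] .
  moreover have "c \<noteq> 0" using calculation 0(3) by (auto simp: Const_def)
  ultimately show ?case by fastforce
next
  case (Suc n)
  define PP where "PP = {Q \<in> polys_over (mpolys n). poly Q (Var n) \<in> P}"
  have Pi: "ideal_of P (mpolys (Suc n))" using Suc.prems by (simp add: prime_ideal_of_def)
  note Ps = ideal_ofD[OF Pi]
  have lift: "poly Q (Var n) \<in> mpolys (Suc n)" if "Q \<in> polys_over (mpolys n)" for Q
    using that by (auto simp: mpolys_Suc_iff polys_over_def)
  note RX = subring_polys_over[OF subring_mpolys[of n]]
  have PPi: "ideal_of PP (polys_over (mpolys n))"
    unfolding ideal_of_def using subring_setD(1,3,5)[OF RX] Ps(2,3) Ps(4)[OF _ lift] by (auto simp: PP_def)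
  have PP: "prime_ideal_of PP (polys_over (mpolys n))"
    unfolding prime_ideal_of_def
  proof (intro conjI ballI impI)
    show "1 \<notin> PP" using Suc.prems(1) by (auto simp: PP_def prime_ideal_of_def)
  next
    fix A B assume AB: "A \<in> polys_over (mpolys n)" "B \<in> polys_over (mpolys n)" "A * B \<in> PP"
    then have "poly A (Var n) * poly B (Var n) \<in> P" by (simp add: PP_def)
    then show "A \<in> PP \<or> B \<in> PP" using Suc.prems(1) AB lift by (auto simp: PP_def prime_ideal_of_def)
  qed (rule PPi)
  obtain H where H: "H \<in> polys_over (mpolys n)" "h = poly H (Var n)"
    using Suc.prems(2) by (auto simp: mpolys_Suc_iff polys_over_def)
  have "H \<notin> PP" using Suc.prems(3) H by (auto simp: PP_def)
  from prime_ideal_fibre_point[OF subring_mpolys PP H(1) this, where 'a = 'a]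
  obtain u where u: "u \<in> mpolys n" "[:u:] \<notin> PP"
    "\<And>\<theta> :: _ \<Rightarrow> 'a. comm_ring_hom \<theta> \<Longrightarrow> (\<And>r. r \<in> mpolys n \<Longrightarrow> [:r:] \<in> PP \<Longrightarrow> \<theta> r = 0) \<Longrightarrow> \<theta> u \<noteq> 0 \<Longrightarrow>
       \<exists>t. (\<forall>g\<in>PP. poly (map_poly \<theta> g) t = 0) \<and> poly (map_poly \<theta> H) t \<noteq> 0" by blast
  define P0 where "P0 = P \<inter> mpolys n"
  have const: "[:r:] \<in> PP \<longleftrightarrow> r \<in> P" if "r \<in> mpolys n" for r
    using that const_in_polys_over[of r "mpolys n"] by (auto simp: PP_def)
  have sub: "mpolys n \<subseteq> mpolys (Suc n)" by (rule mpolys_mono) simp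
  have "prime_ideal_of P0 (mpolys n)"
    unfolding prime_ideal_of_def ideal_of_def
  proof (intro conjI ballI impI)
    show "P0 \<subseteq> mpolys n" "0 \<in> P0" "1 \<notin> P0" using Suc.prems(1) Ps(2) by (auto simp: P0_def prime_ideal_of_def)
  next
    fix a b assume "a \<in> P0" "b \<in> P0"
    then show "a + b \<in> P0" using Ps(3) mpolys_add by (auto simp: P0_def)
  next
    fix a b :: "'a mpoly" assume "a \<in> P0" "b \<in> mpolys n"
    then show "b * a \<in> P0" using Ps(4)[of a b] sub mpolys_mult[of b n a] by (auto simp: P0_def)
  next
    fix a b :: "'a mpoly" assume "a \<in> mpolys n" "b \<in> mpolys n" "a * b \<in> P0"
    then show "a \<in> P0 \<or> b \<in> P0" using Suc.prems(1) sub by (auto simp: P0_def prime_ideal_of_def)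
  qed
  moreover have "u \<notin> P0" using u const by (auto simp: P0_def)
  ultimately obtain x where x: "\<forall>p\<in>P0. eval_mpoly p x = 0" "eval_mpoly u x \<noteq> 0"
    using Suc.IH[of P0 u] u(1) by blast
  obtain t where t: "\<forall>g\<in>PP. poly (map_poly (\<lambda>p. eval_mpoly p x) g) t = 0" "poly (map_poly (\<lambda>p. eval_mpoly p x) H) t \<noteq> 0"
    using u(3)[OF comm_ring_hom_eval_mpoly _ x(2)] x(1) const by (auto simp: P0_def)
  have "eval_mpoly p (x(n := t)) = 0" if p: "p \<in> P" for p
  proof -
    obtain Q where "Q \<in> polys_over (mpolys n)" "p = poly Q (Var n)"
      using Ps(1)[OF p] by (auto simp: mpolys_Suc_iff polys_over_def)
    with p t(1) show ?thesis by (simp add: eval_poly_Var_update PP_def)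
  qed
  moreover have "eval_mpoly h (x(n := t)) \<noteq> 0" using t(2) H by (simp add: eval_poly_Var_update)
  ultimately show ?case by blast
qed

text \<open>An ideal containing \<open>I\<close> that is maximal among those avoiding the powers of
  \<open>h\<close> is prime, which reduces the claim to prime ideals.\<close>

theorem nullstellensatz:
  fixes I :: "'a::alg_closed_field mpoly set"
  assumes I: "ideal_of I (mpolys n)" and h: "h \<in> mpolys n" "\<And>N. h ^ N \<notin> I"
  shows "\<exists>x\<in>affine_space n. (\<forall>p\<in>I. eval_mpoly p x = 0) \<and> eval_mpoly h x \<noteq> 0"
proof -
  define A where "A = {J. ideal_of J (mpolys n) \<and> I \<subseteq> J \<and> (\<forall>N. h ^ N \<notin> J)}"
  have "\<exists>M\<in>A. \<forall>Y\<in>A. M \<subseteq> Y \<longrightarrow> Y = M"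
  proof (rule subset_Zorn_nonempty)
    show "A \<noteq> {}" using assms by (auto simp: A_def)
  next
    fix C assume C: "C \<noteq> {}" "subset.chain A C"
    have two: "\<exists>Y\<in>C. a \<in> Y \<and> b \<in> Y" if "a \<in> \<Union>C" "b \<in> \<Union>C" for a b
      using that C(2) unfolding subset.chain_def by blast
    have CA: "ideal_of Y (mpolys n)" "I \<subseteq> Y" "\<And>N. h ^ N \<notin> Y" if "Y \<in> C" for Y
      using C(2) that by (auto simp: subset.chain_def A_def)
    obtain Y0 where Y0: "Y0 \<in> C" using C(1) by blast
    have "ideal_of (\<Union>C) (mpolys n)"
      unfolding ideal_of_def
    proof (intro conjI ballI)
      show "\<Union>C \<subseteq> mpolys n" using CA(1) ideal_ofD(1) by blast
      show "0 \<in> \<Union>C" using ideal_ofD(2)[OF CA(1)[OF Y0]] Y0 by blast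
    next
      fix a b assume "a \<in> \<Union>C" "b \<in> \<Union>C"
      then obtain Y where "Y \<in> C" "a \<in> Y" "b \<in> Y" using two by blast
      then show "a + b \<in> \<Union>C" using ideal_ofD(3)[OF CA(1)] by blast
    next
      fix a b :: "'a mpoly" assume "a \<in> \<Union>C" "b \<in> mpolys n"
      then show "b * a \<in> \<Union>C" using ideal_ofD(4)[OF CA(1)] by blast
    qed
    then show "\<Union>C \<in> A" using CA(2,3) Y0 by (auto simp: A_def)
  qed
  then obtain P where PA: "P \<in> A" and max: "\<And>Y. Y \<in> A \<Longrightarrow> P \<subseteq> Y \<Longrightarrow> Y = P" by blast
  have P: "ideal_of P (mpolys n)" "I \<subseteq> P" "\<And>N. h ^ N \<notin> P" using PA by (auto simp: A_def)
  note Ps = ideal_ofD[OF P(1)] and Rs = subring_setD[OF subring_mpolys[of n]]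
  have gen: "\<exists>N a p. a \<in> mpolys n \<and> p \<in> P \<and> h ^ N = a * f + p" if f: "f \<in> mpolys n" "f \<notin> P" for f
  proof -
    define J where "J = {a * f + b | a b. a \<in> mpolys n \<and> b \<in> P}"
    note Jfacts = ideal_add_principal[OF P(1) subring_mpolys f(1), folded J_def]
    have PJ: "P \<subseteq> J" and fJ: "f \<in> J" and Ji: "ideal_of J (mpolys n)" using Jfacts by auto
    have "J \<noteq> P" using fJ f by blast
    then have "J \<notin> A" using max PJ by blast
    then have "\<exists>N. h ^ N \<in> J" using Ji PJ P(2) by (auto simp: A_def)
    then show ?thesis unfolding J_def by blast
  qed
  have "prime_ideal_of P (mpolys n)"
    unfolding prime_ideal_of_def
  proof (intro conjI ballI impI P)
    show "1 \<notin> P" using P(3)[of 0] by simp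
  next
    fix a b assume ab: "a \<in> mpolys n" "b \<in> mpolys n" "a * b \<in> P"
    show "a \<in> P \<or> b \<in> P"
    proof (rule ccontr)
      assume "\<not> (a \<in> P \<or> b \<in> P)"
      then obtain N c p M d q where *: "c \<in> mpolys n" "p \<in> P" "h ^ N = c * a + p" "d \<in> mpolys n" "q \<in> P" "h ^ M = d * b + q"
        using gen ab by metis
      have "h ^ (N + M) = (c * d) * (a * b) + (c * a) * q + h ^ M * p"
        by (simp add: power_add *(3,6) algebra_simps)
      moreover have "\<dots> \<in> P"
        by (intro Ps(3) Ps(4)[OF ab(3)] Ps(4)[OF *(2)] Ps(4)[OF *(5)] Rs(5) * ab mpolys_power h)
      ultimately show False using P(3) by metis
    qed
  qed
  moreover have "h \<notin> P" using P(3)[of 1] by simp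
  ultimately obtain x where x: "\<forall>p\<in>P. eval_mpoly p x = 0" "eval_mpoly h x \<noteq> 0"
    using prime_ideal_point h(1) by blast
  have res: "eval_mpoly p (restrict x {..<n}) = eval_mpoly p x" if "p \<in> mpolys n" for p
    by (rule eval_mpoly_cong[OF that]) simp
  have "restrict x {..<n} \<in> affine_space n" by (simp add: affine_space_def)
  moreover have "eval_mpoly p (restrict x {..<n}) = 0" if "p \<in> I" for p
    using that P(2) Ps(1) res x(1) by auto
  ultimately show ?thesis using x(2) res[OF h(1)] by metis
qed

lemma poly_eq_sum_le:
  fixes p :: "'a::comm_ring_1 poly"
  assumes "degree p \<le> N"
  shows "poly p x = (\<Sum>k\<le>N. coeff p k * x ^ k)"
  unfolding poly_altdef using assms by (intro sum.mono_neutral_left) (auto simp: coeff_eq_0)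

section \<open>Regular functions\<close>

lemma openin_sub_zariski_basic:
  assumes "openin (subtopology (zariski m) Y) W" "y \<in> W"
  obtains s where "s \<in> mpolys m" "eval_mpoly s y \<noteq> 0"
    "\<And>z. z \<in> affine_space m \<Longrightarrow> z \<in> Y \<Longrightarrow> eval_mpoly s z \<noteq> 0 \<Longrightarrow> z \<in> W"
proof -
  obtain S where S: "S \<subseteq> mpolys m" "W = (affine_space m - zero_locus m S) \<inter> Y"
    using assms(1) by (auto simp: openin_subtopology openin_zariski)
  then obtain s where "s \<in> S" "eval_mpoly s y \<noteq> 0" using assms(2) by (auto simp: zero_locus_def)
  then show ?thesis using S by (intro that[of s]) (auto simp: zero_locus_def)
qed

lemma openin_principal:
  assumes "s \<in> mpolys m" "Y \<subseteq> affine_space m"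
  shows "openin (subtopology (zariski m) Y) {z \<in> Y. eval_mpoly s z \<noteq> 0}"
  unfolding openin_subtopology openin_zariski using assms
  by (intro exI[of _ "affine_space m - zero_locus m {s}"]) (auto simp: zero_locus_def)

lemma openin_sub_zariski_subset: "openin (subtopology (zariski m) Y) W \<Longrightarrow> W \<subseteq> Y \<and> W \<subseteq> affine_space m"
  by (auto simp: openin_subtopology openin_zariski)

text \<open>Multiplying the local fraction by a polynomial that vanishes off its domain makes the equation
  hold on all of \<open>V\<close>, so that no neighbourhood has to be carried along.\<close>

lemma regular_fun_clear_denominator:
  assumes "regular_fun n V g" "x \<in> V" "V \<subseteq> affine_space n"
  obtains p q where "p \<in> mpolys n" "q \<in> mpolys n" "eval_mpoly q x \<noteq> 0"
    "\<And>z. z \<in> V \<Longrightarrow> eval_mpoly q z * g z = eval_mpoly p z"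
proof -
  obtain U p q where U: "openin (subtopology (zariski n) V) U" "x \<in> U" and pq: "p \<in> mpolys n" "q \<in> mpolys n"
    "\<And>z. z \<in> U \<Longrightarrow> eval_mpoly q z \<noteq> 0 \<and> g z = eval_mpoly p z / eval_mpoly q z"
    using assms(1,2) unfolding regular_fun_def by metis
  obtain s where s: "s \<in> mpolys n" "eval_mpoly s x \<noteq> 0"
    "\<And>z. z \<in> affine_space n \<Longrightarrow> z \<in> V \<Longrightarrow> eval_mpoly s z \<noteq> 0 \<Longrightarrow> z \<in> U"
    using openin_sub_zariski_basic[OF U] by blast
  have "eval_mpoly (s * q) z * g z = eval_mpoly (s * p) z" if "z \<in> V" for z
    using pq(3)[of z] s(3)[of z] that assms(3) by (cases "eval_mpoly s z = 0") (auto simp: eval_mpoly_mult)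
  moreover have "eval_mpoly (s * q) x \<noteq> 0" using s pq(3)[OF U(2)] by (simp add: eval_mpoly_mult)
  ultimately show ?thesis
    by (intro that[of "s * p" "s * q"] mpolys_mult pq(1,2) s(1))
qed

lemma regular_fun_common_denominator:
  assumes "finite C" "\<And>c. c \<in> C \<Longrightarrow> regular_fun n V c" "x \<in> V" "V \<subseteq> affine_space n"
  shows "\<exists>q\<in>mpolys n. eval_mpoly q x \<noteq> 0 \<and> (\<forall>c\<in>C. \<exists>p\<in>mpolys n. \<forall>z\<in>V. eval_mpoly q z * c z = eval_mpoly p z)"
  using assms(1,2)
proof (induction C rule: finite_induct)
  case empty
  then show ?case by (intro bexI[of _ 1]) auto
next
  case (insert c C)
  then obtain q where q: "q \<in> mpolys n" "eval_mpoly q x \<noteq> 0"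
    "\<forall>c\<in>C. \<exists>p\<in>mpolys n. \<forall>z\<in>V. eval_mpoly q z * c z = eval_mpoly p z" by auto
  obtain p' q' where pq': "p' \<in> mpolys n" "q' \<in> mpolys n" "eval_mpoly q' x \<noteq> 0"
    "\<And>z. z \<in> V \<Longrightarrow> eval_mpoly q' z * c z = eval_mpoly p' z"
    using regular_fun_clear_denominator[OF insert.prems[of c] assms(3,4)] by blast
  have "\<exists>p\<in>mpolys n. \<forall>z\<in>V. eval_mpoly (q' * q) z * c' z = eval_mpoly p z" if c': "c' \<in> insert c C" for c'
  proof (cases "c' = c")
    case True
    have "eval_mpoly (q' * q) z * c z = eval_mpoly (p' * q) z" if "z \<in> V" for z
      using pq'(4)[OF that] by (simp add: eval_mpoly_mult mult.assoc flip: pq'(4)[OF that])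
    then show ?thesis using True pq' q mpolys_mult by blast
  next
    case False
    then obtain p where "p \<in> mpolys n" "\<forall>z\<in>V. eval_mpoly q z * c' z = eval_mpoly p z" using q(3) c' by blast
    then show ?thesis using pq' by (intro bexI[of _ "q' * p"]) (auto simp: eval_mpoly_mult mpolys_mult mult.assoc)
  qed
  then show ?case using q pq' by (intro bexI[of _ "q' * q"]) (auto simp: eval_mpoly_mult mpolys_mult)
qed

lemma regular_fun_quotient:
  assumes "p \<in> mpolys n" "q \<in> mpolys n" "V \<subseteq> affine_space n" "\<And>z. z \<in> V \<Longrightarrow> eval_mpoly q z \<noteq> 0"
    "\<And>z. z \<in> V \<Longrightarrow> g z = eval_mpoly p z / eval_mpoly q z"
  shows "regular_fun n V g"
  unfolding regular_fun_def
proof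
  fix x assume "x \<in> V"
  moreover have "openin (subtopology (zariski n) V) V"
    using openin_principal[of 1 n V] assms(3) by simp
  ultimately show "\<exists>U p q. openin (subtopology (zariski n) V) U \<and> x \<in> U \<and> p \<in> mpolys n \<and> q \<in> mpolys n \<and>
        (\<forall>z\<in>U. eval_mpoly q z \<noteq> 0 \<and> g z = eval_mpoly p z / eval_mpoly q z)"
    using assms by blast
qed

lemma regular_fun_poly:
  assumes "p \<in> mpolys n" "V \<subseteq> affine_space n" "\<And>z. z \<in> V \<Longrightarrow> g z = eval_mpoly p z"
  shows "regular_fun n V g"
  by (rule regular_fun_quotient[of p n 1]) (use assms in auto)

lemma regular_fun_mult:
  assumes "regular_fun n V g" "regular_fun n V h"
  shows "regular_fun n V (\<lambda>x. g x * h x)"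
  unfolding regular_fun_def
proof
  fix x assume "x \<in> V"
  obtain U p q where 1: "openin (subtopology (zariski n) V) U" "x \<in> U" "p \<in> mpolys n" "q \<in> mpolys n"
    "\<forall>z\<in>U. eval_mpoly q z \<noteq> 0 \<and> g z = eval_mpoly p z / eval_mpoly q z"
    using assms(1) \<open>x \<in> V\<close> unfolding regular_fun_def by metis
  obtain U' p' q' where 2: "openin (subtopology (zariski n) V) U'" "x \<in> U'" "p' \<in> mpolys n" "q' \<in> mpolys n"
    "\<forall>z\<in>U'. eval_mpoly q' z \<noteq> 0 \<and> h z = eval_mpoly p' z / eval_mpoly q' z"
    using assms(2) \<open>x \<in> V\<close> unfolding regular_fun_def by metis
  show "\<exists>U p q. openin (subtopology (zariski n) V) U \<and> x \<in> U \<and> p \<in> mpolys n \<and> q \<in> mpolys n \<and>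
        (\<forall>z\<in>U. eval_mpoly q z \<noteq> 0 \<and> g z * h z = eval_mpoly p z / eval_mpoly q z)"
    using 1 2 by (intro exI[of _ "U \<inter> U'"] exI[of _ "p * p'"] exI[of _ "q * q'"])
      (auto simp: mpolys_mult eval_mpoly_mult)
qed

lemma poly_map_in_affine: "poly_map m F x \<in> affine_space m"
  by (simp add: poly_map_def affine_space_def)

lemma eval_poly_map:
  "p \<in> mpolys m \<Longrightarrow> eval_mpoly p (poly_map m F x) = eval_mpoly (heval Const p F) x"
  unfolding eval_subst by (rule eval_mpoly_cong) (auto simp: poly_map_def)

lemma mpoly_eq_0_if_vanishes_affine:
  fixes p :: "'a::alg_closed_field mpoly"
  assumes "p \<in> mpolys n" "\<And>x. x \<in> affine_space n \<Longrightarrow> eval_mpoly p x = 0"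
  shows "p = 0"
proof (rule mpoly_eq_0_if_vanishes[OF assms(1)])
  fix x :: "nat \<Rightarrow> 'a"
  have "eval_mpoly p x = eval_mpoly p (restrict x {..<n})"
    by (rule eval_mpoly_cong[OF assms(1)]) auto
  also have "\<dots> = 0" by (rule assms(2)) (simp add: affine_space_def)
  finally show "eval_mpoly p x = 0" .
qed

section \<open>Finiteness and integral equations\<close>

text \<open>The polynomials \<open>g\<close> on the target for which \<open>x\<^sub>i\<close> becomes integral
  over \<open>K[f]\<close> once \<open>g(f)\<close> is inverted. The case \<open>r = 0\<close> is
  included: it gives the equations of the image.\<close>

definition leading_coeffs :: "nat \<Rightarrow> (nat \<Rightarrow> 'a::comm_ring_1 mpoly) \<Rightarrow> nat \<Rightarrow> 'a mpoly set" where
  "leading_coeffs m F i = {g \<in> mpolys m. \<exists>r a. (\<forall>k<r. a k \<in> mpolys m) \<and>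
     heval Const g F * Var i ^ r + (\<Sum>k<r. heval Const (a k) F * Var i ^ k) = 0}"

text \<open>Points of affine space take the value \<open>undefined\<close> outside the coordinates, so a
  polynomial in further variables induces the function of the polynomial in which these variables
  are replaced by that constant. This keeps the determinants below from having to be tracked
  inside \<open>mpolys m\<close>.\<close>

lemma truncate_mpoly:
  obtains p' where "p' \<in> mpolys m" "\<And>z. z \<in> affine_space m \<Longrightarrow> eval_mpoly p' z = eval_mpoly p z"
proof
  let ?p = "heval Const p (\<lambda>l. if l < m then Var l else Const undefined)"
  obtain k where "p \<in> mpolys k" using ex_mpolys by blast
  then show "?p \<in> mpolys m" by (rule mpolys_subst) (auto simp: mpolys_Var)
  show "eval_mpoly ?p z = eval_mpoly p z" if "z \<in> affine_space m" for z
    unfolding eval_subst using that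
    by (intro arg_cong[of _ _ "eval_mpoly p"]) (auto simp: affine_space_def PiE_def extensional_def)
qed

text \<open>If multiplication by \<open>t\<close> acts on a finite set of generators through the matrix
  \<open>e(A)\<close>, their values at a point form an eigenvector, so \<open>t\<close> is a root
  of the characteristic polynomial. That polynomial is taken over the coefficient ring, before
  specialisation, which gives one equation for all points.\<close>

lemma determinant_trick:
  fixes A :: "'a::comm_ring_1 mat"
  assumes A: "A \<in> carrier_mat N N" and e: "comm_ring_hom (e :: 'a \<Rightarrow> 'b::field)"
    and v: "\<exists>k<N. v k \<noteq> 0" and eig: "\<And>k. k < N \<Longrightarrow> (\<Sum>l<N. e (A $$ (k, l)) * v l) = t * v k"
  shows "poly (map_poly e (char_poly A)) t = 0"
proof -
  interpret comm_ring_hom e by fact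
  let ?A = "map_mat e A"
  have cA: "?A \<in> carrier_mat N N" using A by simp
  have "eigenvector ?A (vec N v) t"
    unfolding eigenvector_def
  proof (intro conjI)
    show "vec N v \<noteq> 0\<^sub>v (dim_row ?A)"
    proof
      assume *: "vec N v = 0\<^sub>v (dim_row ?A)"
      obtain k where "k < N" "v k \<noteq> 0" using v by blast
      then show False using arg_cong[OF *, of "\<lambda>w. vec_index w k"] A by simp
    qed
    show "?A *\<^sub>v vec N v = t \<cdot>\<^sub>v vec N v"
      using A by (intro eq_vecI) (auto simp: scalar_prod_def eig atLeast0LessThan)
  qed (use A in simp)
  then have "eigenvalue ?A t" unfolding eigenvalue_def by blast
  then show ?thesis using eigenvalue_root_char_poly[OF cA] char_poly_hom[OF A] by simp
qed

text \<open>Near \<open>y\<close> the coordinate \<open>x\<^sub>i\<close> acts on finitely many module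
  generators by a matrix of regular functions on the target. With a common denominator
  \<open>q\<close> the entries become polynomials, and the characteristic polynomial gives an
  equation for \<open>q(f) x\<^sub>i\<close>. Multiplying it by \<open>\<sigma>\<close>, which
  vanishes off the neighbourhood, makes it an identity on the whole source.\<close>

lemma finite_at_imp_leading_coeff:
  fixes F :: "nat \<Rightarrow> 'a::alg_closed_field mpoly"
  assumes F: "\<forall>i<m. F i \<in> mpolys n" and "i < n" and y: "y \<in> affine_space m"
    and fin: "finite_at n (affine_space n) m (affine_space m) (poly_map m F) y"
  shows "\<exists>g\<in>leading_coeffs m F i. eval_mpoly g y \<noteq> 0"
proof -
  let ?f = "poly_map m F"
  obtain U where U: "openin (subtopology (zariski m) (affine_space m)) U" "y \<in> U"
    and fm: "finite_map n {x \<in> affine_space n. ?f x \<in> U} m U ?f"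
    using fin unfolding finite_at_def by blast
  obtain W where W: "openin (subtopology (zariski m) U) W" "y \<in> W"
    and mf: "module_finite n {x \<in> {x \<in> affine_space n. ?f x \<in> U}. ?f x \<in> W} m W ?f"
    using fm U(2) unfolding finite_map_def by blast
  define V where "V = {x \<in> {x \<in> affine_space n. ?f x \<in> U}. ?f x \<in> W}"
  have Vaff: "V \<subseteq> affine_space n" by (auto simp: V_def)
  have Waff: "W \<subseteq> affine_space m" using openin_sub_zariski_subset[OF W(1)] by blast
  obtain s1 where s1: "s1 \<in> mpolys m" "eval_mpoly s1 y \<noteq> 0"
    "\<And>z. z \<in> affine_space m \<Longrightarrow> z \<in> affine_space m \<Longrightarrow> eval_mpoly s1 z \<noteq> 0 \<Longrightarrow> z \<in> U"
    using openin_sub_zariski_basic[OF U] by blast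
  obtain s2 where s2: "s2 \<in> mpolys m" "eval_mpoly s2 y \<noteq> 0"
    "\<And>z. z \<in> affine_space m \<Longrightarrow> z \<in> U \<Longrightarrow> eval_mpoly s2 z \<noteq> 0 \<Longrightarrow> z \<in> W"
    using openin_sub_zariski_basic[OF W] by blast
  \<comment> \<open>\<open>W\<close> is open in \<open>U\<close>, which is open in affine space, so two principal
    neighbourhoods are needed.\<close>
  define \<sigma> where "\<sigma> = s1 * s2"
  have \<sigma>: "\<sigma> \<in> mpolys m" "eval_mpoly \<sigma> y \<noteq> 0" using s1 s2 by (auto simp: \<sigma>_def mpolys_mult eval_mpoly_mult)
  have \<sigma>V: "x \<in> V" if "x \<in> affine_space n" "eval_mpoly \<sigma> (?f x) \<noteq> 0" for x
    using that s1(3)[OF poly_map_in_affine poly_map_in_affine] s2(3)[OF poly_map_in_affine]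
    by (auto simp: \<sigma>_def eval_mpoly_mult V_def)
  obtain G where G: "finite G" "\<And>g. g \<in> G \<Longrightarrow> regular_fun n V g"
    and Gspan: "\<And>h. regular_fun n V h \<Longrightarrow> \<exists>c. (\<forall>g\<in>G. regular_fun m W (c g)) \<and> (\<forall>x\<in>V. h x = (\<Sum>g\<in>G. c g (?f x) * g x))"
    using mf unfolding module_finite_def V_def[symmetric] by blast
  define N where "N = card G"
  obtain gs where gs: "bij_betw gs {..<N} G"
    using G(1) finite_same_card_bij[of "{..<N}" G] by (auto simp: N_def)
  have gsG: "gs k \<in> G" if "k < N" for k using gs that by (auto simp: bij_betw_def)
  have sumG: "(\<Sum>g\<in>G. \<phi> g) = (\<Sum>l<N. \<phi> (gs l))" for \<phi> :: "_ \<Rightarrow> 'a"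
    using sum.reindex_bij_betw[OF gs, of \<phi>] by simp
  obtain c1 where c1: "\<And>x. x \<in> V \<Longrightarrow> 1 = (\<Sum>g\<in>G. c1 g (?f x) * g x)"
    using Gspan[of "\<lambda>_. 1"] regular_fun_poly[of 1 n V "\<lambda>_. 1"] Vaff by auto
  have reg: "regular_fun n V (\<lambda>x. x i * gs k x)" if "k < N" for k
    by (rule regular_fun_mult[OF regular_fun_poly[of "Var i"] G(2)[OF gsG[OF that]]])
       (use Vaff \<open>i < n\<close> in \<open>auto simp: mpolys_Var\<close>)
  have "\<forall>k\<in>{..<N}. \<exists>c. (\<forall>g\<in>G. regular_fun m W (c g)) \<and> (\<forall>x\<in>V. x i * gs k x = (\<Sum>g\<in>G. c g (?f x) * g x))"
    by (intro ballI Gspan reg) simp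
  from bchoice[OF this] obtain c where c: "\<And>k g. k < N \<Longrightarrow> g \<in> G \<Longrightarrow> regular_fun m W (c k g)"
    "\<And>k x. k < N \<Longrightarrow> x \<in> V \<Longrightarrow> x i * gs k x = (\<Sum>g\<in>G. c k g (?f x) * g x)" by auto
  let ?C = "(\<lambda>(k, l). c k (gs l)) ` ({..<N} \<times> {..<N})"
  have "\<exists>q\<in>mpolys m. eval_mpoly q y \<noteq> 0 \<and> (\<forall>c\<in>?C. \<exists>p\<in>mpolys m. \<forall>z\<in>W. eval_mpoly q z * c z = eval_mpoly p z)"
    by (rule regular_fun_common_denominator) (use c(1) gsG W(2) Waff in auto)
  then obtain q where q: "q \<in> mpolys m" "eval_mpoly q y \<noteq> 0"
    "\<forall>c\<in>?C. \<exists>p\<in>mpolys m. \<forall>z\<in>W. eval_mpoly q z * c z = eval_mpoly p z" by blast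
  have "\<forall>kl\<in>{..<N} \<times> {..<N}. \<exists>p. \<forall>z\<in>W. eval_mpoly q z * c (fst kl) (gs (snd kl)) z = eval_mpoly p z"
  proof
    fix kl assume "kl \<in> {..<N} \<times> {..<N}"
    then have "c (fst kl) (gs (snd kl)) \<in> ?C" by (force intro: image_eqI[of _ _ kl])
    then show "\<exists>p. \<forall>z\<in>W. eval_mpoly q z * c (fst kl) (gs (snd kl)) z = eval_mpoly p z" using q(3) by blast
  qed
  from bchoice[OF this] obtain P' where P': "\<And>k l z. k < N \<Longrightarrow> l < N \<Longrightarrow> z \<in> W \<Longrightarrow> eval_mpoly q z * c k (gs l) z = eval_mpoly (P' (k, l)) z"
    by auto
  define P where "P k l = P' (k, l)" for k l
  have P: "eval_mpoly q z * c k (gs l) z = eval_mpoly (P k l) z" if "k < N" "l < N" "z \<in> W" for k l z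
    using P'[OF that] by (simp add: P_def)
  define A where "A = mat N N (\<lambda>(k, l). P k l)"
  have A: "A \<in> carrier_mat N N" by (simp add: A_def)
  define cp where "cp = char_poly A"
  have cp: "degree cp = N" "coeff cp N = 1" using degree_monic_char_poly[OF A] by (auto simp: cp_def)
  have root: "poly (map_poly (\<lambda>p. eval_mpoly p (?f x)) cp) (eval_mpoly q (?f x) * x i) = 0" if x: "x \<in> V" for x
    unfolding cp_def
  proof (rule determinant_trick[OF A comm_ring_hom_eval_mpoly, of "\<lambda>k. gs k x"])
    have fx: "?f x \<in> W" using x by (simp add: V_def)
    show "\<exists>k<N. gs k x \<noteq> 0"
    proof (rule ccontr)
      assume "\<not> ?thesis"
      then have "(\<Sum>l<N. c1 (gs l) (?f x) * gs l x) = 0" by (intro sum.neutral) auto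
      then show False using c1[OF x] by (simp add: sumG)
    qed
    fix k assume k: "k < N"
    have "(\<Sum>l<N. eval_mpoly (A $$ (k, l)) (?f x) * gs l x) = (\<Sum>l<N. eval_mpoly q (?f x) * (c k (gs l) (?f x) * gs l x))"
      using k by (intro sum.cong) (auto simp: A_def mult.assoc simp flip: P[OF _ _ fx])
    also have "\<dots> = eval_mpoly q (?f x) * x i * gs k x"
      using c(2)[OF k x] by (simp add: sumG sum_distrib_left mult.assoc)
    finally show "(\<Sum>l<N. eval_mpoly (A $$ (k, l)) (?f x) * gs l x) = eval_mpoly q (?f x) * x i * gs k x" .
  qed
  have "\<forall>k. \<exists>b. b \<in> mpolys m \<and> (\<forall>z\<in>affine_space m. eval_mpoly b z = eval_mpoly (coeff cp k) z)"
  proof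
    fix k
    obtain b where "b \<in> mpolys m" "\<And>z. z \<in> affine_space m \<Longrightarrow> eval_mpoly b z = eval_mpoly (coeff cp k) z"
      using truncate_mpoly[of m "coeff cp k"] by blast
    then show "\<exists>b. b \<in> mpolys m \<and> (\<forall>z\<in>affine_space m. eval_mpoly b z = eval_mpoly (coeff cp k) z)" by blast
  qed
  from choice[OF this] obtain b where b: "\<And>k. b k \<in> mpolys m" "\<And>k z. z \<in> affine_space m \<Longrightarrow> eval_mpoly (b k) z = eval_mpoly (coeff cp k) z"
    by auto
  define a where "a k = \<sigma> * (b k * q ^ k)" for k
  have a: "a k \<in> mpolys m" for k by (simp add: a_def b \<sigma> q mpolys_mult mpolys_power)
  let ?E = "\<Sum>k\<le>N. heval Const (a k) F * Var i ^ k"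
  have "?E = 0"
  proof (rule mpoly_eq_0_if_vanishes_affine)
    show "?E \<in> mpolys n"
      using F a \<open>i < n\<close> by (intro mpolys_sum mpolys_mult mpolys_power mpolys_Var mpolys_subst[of _ m]) auto
    fix x :: "nat \<Rightarrow> 'a" assume x: "x \<in> affine_space n"
    have "eval_mpoly ?E x = (\<Sum>k\<le>N. eval_mpoly (a k) (?f x) * x i ^ k)"
      by (simp add: eval_mpoly_sum eval_mpoly_mult eval_power eval_poly_map[OF a])
    also have "\<dots> = eval_mpoly \<sigma> (?f x) * (\<Sum>k\<le>N. eval_mpoly (coeff cp k) (?f x) * (eval_mpoly q (?f x) * x i) ^ k)"
      by (simp add: sum_distrib_left a_def eval_mpoly_mult eval_power b(2)[OF poly_map_in_affine] power_mult_distrib mult.assoc)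
    also have "(\<Sum>k\<le>N. eval_mpoly (coeff cp k) (?f x) * (eval_mpoly q (?f x) * x i) ^ k) =
       poly (map_poly (\<lambda>p. eval_mpoly p (?f x)) cp) (eval_mpoly q (?f x) * x i)"
    proof -
      have "degree (map_poly (\<lambda>p. eval_mpoly p (?f x)) cp) \<le> N" using degree_map_poly_le[of _ cp] cp by simp
      then show ?thesis by (simp add: poly_eq_sum_le coeff_map_poly)
    qed
    also have "eval_mpoly \<sigma> (?f x) * \<dots> = 0"
      using root \<sigma>V[OF x] by (cases "eval_mpoly \<sigma> (?f x) = 0") auto
    finally show "eval_mpoly ?E x = 0" .
  qed
  then have "heval Const (a N) F * Var i ^ N + (\<Sum>k<N. heval Const (a k) F * Var i ^ k) = 0"
    by (simp add: lessThan_Suc_atMost[symmetric] add.commute)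
  then have "a N \<in> leading_coeffs m F i" using a by (auto simp: leading_coeffs_def)
  moreover have "eval_mpoly (a N) y \<noteq> 0"
    using \<sigma> q b(2)[OF y, of N] cp by (simp add: a_def eval_mpoly_mult eval_power)
  ultimately show ?thesis by blast
qed

section \<open>Integral equations imply finiteness\<close>

text \<open>The denominators of a regular function on the set \<open>G \<noteq> 0\<close> form an ideal
  without zeros on that set, which contains a power of \<open>G\<close> by the Nullstellensatz.\<close>

lemma regular_fun_principal:
  fixes G :: "'a::alg_closed_field mpoly"
  assumes G: "G \<in> mpolys n" and h: "regular_fun n {x \<in> affine_space n. eval_mpoly G x \<noteq> 0} h"
  obtains N p where "p \<in> mpolys n"
    "\<And>x. x \<in> affine_space n \<Longrightarrow> eval_mpoly G x \<noteq> 0 \<Longrightarrow> eval_mpoly G x ^ N * h x = eval_mpoly p x"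
proof -
  let ?V = "{x \<in> affine_space n. eval_mpoly G x \<noteq> 0}"
  define I where "I = {a \<in> mpolys n. \<exists>b\<in>mpolys n. \<forall>x\<in>?V. eval_mpoly a x * h x = eval_mpoly b x}"
  have "ideal_of I (mpolys n)"
    unfolding ideal_of_def
  proof (intro conjI ballI)
    show "I \<subseteq> mpolys n" by (auto simp: I_def)
    show "0 \<in> I" by (auto simp: I_def intro!: bexI[of _ 0])
  next
    fix a b :: "'a mpoly" assume "a \<in> I" "b \<in> I"
    then obtain a' b' where "a' \<in> mpolys n" "b' \<in> mpolys n" "a \<in> mpolys n" "b \<in> mpolys n"
      "\<forall>x\<in>?V. eval_mpoly a x * h x = eval_mpoly a' x" "\<forall>x\<in>?V. eval_mpoly b x * h x = eval_mpoly b' x"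
      by (auto simp: I_def)
    then show "a + b \<in> I"
      by (auto simp: I_def mpolys_add eval_mpoly_add distrib_right intro!: bexI[of _ "a' + b'"])
  next
    fix a b :: "'a mpoly" assume "a \<in> I" "b \<in> mpolys n"
    then obtain a' where "a' \<in> mpolys n" "a \<in> mpolys n" "b \<in> mpolys n"
      "\<forall>x\<in>?V. eval_mpoly a x * h x = eval_mpoly a' x"
      by (auto simp: I_def)
    then show "b * a \<in> I"
      by (auto simp: I_def mpolys_mult eval_mpoly_mult mult.assoc intro!: bexI[of _ "b * a'"])
  qed
  note null = nullstellensatz[OF this G]
  have "\<exists>N. G ^ N \<in> I"
  proof (rule ccontr)
    assume "\<nexists>N. G ^ N \<in> I"
    then obtain x where x: "x \<in> ?V" "\<And>p. p \<in> I \<Longrightarrow> eval_mpoly p x = 0" using null by blast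
    obtain p q where pq: "p \<in> mpolys n" "q \<in> mpolys n" "eval_mpoly q x \<noteq> 0"
      "\<And>z. z \<in> ?V \<Longrightarrow> eval_mpoly q z * h z = eval_mpoly p z"
      using regular_fun_clear_denominator[OF h x(1)] by blast
    then have "q \<in> I" unfolding I_def by blast
    then show False using x(2) pq(3) by blast
  qed
  then obtain N b where "b \<in> mpolys n" "\<And>x. x \<in> ?V \<Longrightarrow> eval_mpoly (G ^ N) x * h x = eval_mpoly b x"
    by (auto simp: I_def)
  then show ?thesis by (intro that[of b N]) (auto simp: eval_power)
qed

text \<open>The Rabinowitsch trick: the set \<open>G \<noteq> 0\<close> is isomorphic to the hypersurface
  \<open>G x\<^sub>n = 1\<close> in one more variable.\<close>

lemma is_affine_principal:
  fixes G :: "'a::field mpoly"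
  assumes G: "G \<in> mpolys n"
  shows "is_affine n {x \<in> affine_space n. eval_mpoly G x \<noteq> 0}" (is "is_affine n ?V")
proof -
  let ?Z = "zero_locus (Suc n) {G * Var n - 1}"
  have GS: "G \<in> mpolys (Suc n)" using G mpolys_mono[of n "Suc n"] by auto
  then have Z: "closedin (zariski (Suc n)) ?Z"
    unfolding closedin_zariski
    by (intro exI[of _ "{G * Var n - 1}"]) (auto intro!: mpolys_diff mpolys_mult mpolys_Var)
  let ?f = "\<lambda>x. x(n := 1 / eval_mpoly G x)" and ?g = "\<lambda>z. restrict z {..<n}"
  have Gf: "eval_mpoly G (x(n := t)) = eval_mpoly G x" for x t by (rule eval_mpoly_cong[OF G]) auto
  have Gg: "eval_mpoly G (restrict z {..<n}) = eval_mpoly G z" for z by (rule eval_mpoly_cong[OF G]) auto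
  have inZ: "z \<in> ?Z \<longleftrightarrow> z \<in> affine_space (Suc n) \<and> eval_mpoly G z * z n = 1" for z
    by (auto simp: zero_locus_def eval_diff eval_mpoly_mult)
  have Zaff: "?Z \<subseteq> affine_space (Suc n)" by (auto simp: zero_locus_def)
  have faff: "x(n := t) \<in> affine_space (Suc n)" if "x \<in> affine_space n" for x and t :: 'a
    using that by (auto simp: affine_space_def PiE_def extensional_def)
  have "regular_map n ?V (Suc n) ?Z ?f"
    unfolding regular_map_def
  proof (intro conjI allI impI)
    show "?f ` ?V \<subseteq> ?Z" using faff by (auto simp: inZ Gf simp del: fun_upd_apply) simp
  next
    fix i assume "i < Suc n"
    show "regular_fun n ?V (\<lambda>x. ?f x i)"
    proof (cases "i = n")
      case True
      then show ?thesis using G by (intro regular_fun_quotient[of 1 _ G]) auto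
    next
      case False
      then show ?thesis using \<open>i < Suc n\<close> by (intro regular_fun_poly[of "Var i"]) (auto simp: mpolys_Var)
    qed
  qed
  moreover have "regular_map (Suc n) ?Z n ?V ?g"
    unfolding regular_map_def
  proof (intro conjI allI impI)
    have "restrict z {..<n} \<in> ?V" if "z \<in> ?Z" for z
    proof -
      have "eval_mpoly G z \<noteq> 0" using that unfolding inZ by auto
      then show ?thesis by (simp add: Gg affine_space_def)
    qed
    then show "?g ` ?Z \<subseteq> ?V" by blast
  next
    fix i assume "i < n"
    then show "regular_fun (Suc n) ?Z (\<lambda>x. ?g x i)"
      using Zaff by (intro regular_fun_poly[of "Var i"]) (auto simp: mpolys_Var)
  qed
  moreover have "\<forall>x\<in>?V. ?g (?f x) = x"
    by (auto simp: affine_space_def fun_eq_iff PiE_def extensional_def)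
  moreover have "\<forall>z\<in>?Z. ?f (?g z) = z"
  proof
    fix z assume "z \<in> ?Z"
    then have z: "z \<in> affine_space (Suc n)" "eval_mpoly G z * z n = 1" by (auto simp: inZ)
    then have "1 / eval_mpoly G z = z n" by (metis div_by_0 mult_zero_left nonzero_mult_div_cancel_left zero_neq_one)
    then show "?f (?g z) = z"
      using z(1) by (auto simp: Gg fun_eq_iff affine_space_def PiE_def extensional_def)
  qed
  ultimately have "isomorphic_varieties n ?V (Suc n) ?Z" unfolding isomorphic_varieties_def by blast
  with Z show ?thesis unfolding is_affine_def by blast
qed

text \<open>Functions that become combinations of \<open>C\<close>, with coefficients pulled back along
  \<open>f\<close>, after multiplication by a power of \<open>g(f)\<close>: the span of
  \<open>C\<close> over the polynomials on the target localised at \<open>g\<close>. Denominators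
  are cleared so that the equations hold on the whole source.\<close>

definition localized_span ::
  "nat \<Rightarrow> nat \<Rightarrow> ((nat \<Rightarrow> 'a) \<Rightarrow> (nat \<Rightarrow> 'a)) \<Rightarrow> 'a::comm_ring_1 mpoly \<Rightarrow> ((nat \<Rightarrow> 'a) \<Rightarrow> 'a) set \<Rightarrow> ((nat \<Rightarrow> 'a) \<Rightarrow> 'a) set" where
  "localized_span n m f g C = {h. \<exists>N c. (\<forall>\<gamma>\<in>C. c \<gamma> \<in> mpolys m) \<and>
     (\<forall>x\<in>affine_space n. eval_mpoly g (f x) ^ N * h x = (\<Sum>\<gamma>\<in>C. eval_mpoly (c \<gamma>) (f x) * \<gamma> x))}"

context
  fixes n m :: nat and f :: "(nat \<Rightarrow> 'a::comm_ring_1) \<Rightarrow> (nat \<Rightarrow> 'a)" and g :: "'a mpoly"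
  assumes g: "g \<in> mpolys m"
begin

lemma localized_spanI:
  "(\<And>\<gamma>. \<gamma> \<in> C \<Longrightarrow> c \<gamma> \<in> mpolys m) \<Longrightarrow>
   (\<And>x. x \<in> affine_space n \<Longrightarrow> eval_mpoly g (f x) ^ N * h x = (\<Sum>\<gamma>\<in>C. eval_mpoly (c \<gamma>) (f x) * \<gamma> x)) \<Longrightarrow> h \<in> localized_span n m f g C"
  unfolding localized_span_def by blast

lemma localized_spanE:
  assumes "h \<in> localized_span n m f g C"
  obtains N c where "\<forall>\<gamma>\<in>C. c \<gamma> \<in> mpolys m"
   "\<forall>x\<in>affine_space n. eval_mpoly g (f x) ^ N * h x = (\<Sum>\<gamma>\<in>C. eval_mpoly (c \<gamma>) (f x) * \<gamma> x)"
  using assms unfolding localized_span_def by blast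

lemma localized_span_cong:
  assumes "h \<in> localized_span n m f g C" "\<And>x. x \<in> affine_space n \<Longrightarrow> h' x = h x"
  shows "h' \<in> localized_span n m f g C"
proof -
  obtain N c where "\<forall>\<gamma>\<in>C. c \<gamma> \<in> mpolys m"
    "\<forall>x\<in>affine_space n. eval_mpoly g (f x) ^ N * h x = (\<Sum>\<gamma>\<in>C. eval_mpoly (c \<gamma>) (f x) * \<gamma> x)"
    by (rule localized_spanE[OF assms(1)]) (rule that)
  then show ?thesis by (intro localized_spanI[of C c N]) (simp_all add: assms(2))
qed

lemma localized_span_0: "(\<lambda>_. 0) \<in> localized_span n m f g C"
  by (rule localized_spanI[of C "\<lambda>_. 0" 0]) simp_all

lemma localized_span_generator:
  assumes "finite C" "\<gamma> \<in> C"
  shows "\<gamma> \<in> localized_span n m f g C"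
proof (rule localized_spanI[of C "\<lambda>\<gamma>'. if \<gamma>' = \<gamma> then 1 else 0" 0])
  fix x
  have "(\<Sum>\<gamma>'\<in>C. eval_mpoly (if \<gamma>' = \<gamma> then 1 else 0) (f x) * \<gamma>' x) = (\<Sum>\<gamma>'\<in>C. if \<gamma>' = \<gamma> then \<gamma> x else 0)"
    by (intro sum.cong) simp_all
  then show "eval_mpoly g (f x) ^ 0 * \<gamma> x = (\<Sum>\<gamma>'\<in>C. eval_mpoly (if \<gamma>' = \<gamma> then 1 else 0) (f x) * \<gamma>' x)"
    using assms by simp
qed simp

lemma localized_span_add:
  assumes "h \<in> localized_span n m f g C" "h' \<in> localized_span n m f g C"
  shows "(\<lambda>x. h x + h' x) \<in> localized_span n m f g C"
proof -
  obtain N c where 1: "\<forall>\<gamma>\<in>C. c \<gamma> \<in> mpolys m"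
    "\<forall>x\<in>affine_space n. eval_mpoly g (f x) ^ N * h x = (\<Sum>\<gamma>\<in>C. eval_mpoly (c \<gamma>) (f x) * \<gamma> x)"
    by (rule localized_spanE[OF assms(1)]) (rule that)
  obtain N' c' where 2: "\<forall>\<gamma>\<in>C. c' \<gamma> \<in> mpolys m"
    "\<forall>x\<in>affine_space n. eval_mpoly g (f x) ^ N' * h' x = (\<Sum>\<gamma>\<in>C. eval_mpoly (c' \<gamma>) (f x) * \<gamma> x)"
    by (rule localized_spanE[OF assms(2)]) (rule that)
  note * = 1(1)[rule_format] 2(1)[rule_format] 1(2)[rule_format] 2(2)[rule_format]
  have "eval_mpoly g (f x) ^ (N + N') * (h x + h' x) =
     (\<Sum>\<gamma>\<in>C. eval_mpoly (g ^ N' * c \<gamma> + g ^ N * c' \<gamma>) (f x) * \<gamma> x)" if "x \<in> affine_space n" for x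
  proof -
    have "eval_mpoly g (f x) ^ (N + N') * (h x + h' x) =
       eval_mpoly g (f x) ^ N' * (eval_mpoly g (f x) ^ N * h x) + eval_mpoly g (f x) ^ N * (eval_mpoly g (f x) ^ N' * h' x)"
      by (simp add: power_add algebra_simps)
    then show ?thesis
      unfolding *(3)[OF that] *(4)[OF that]
      by (simp add: sum_distrib_left eval_mpoly_add eval_mpoly_mult eval_power distrib_right sum.distrib mult.assoc)
  qed
  then show ?thesis
    by (intro localized_spanI[of C "\<lambda>\<gamma>. g ^ N' * c \<gamma> + g ^ N * c' \<gamma>" "N + N'"] mpolys_add mpolys_mult mpolys_power g *(1,2))
qed

lemma localized_span_mult:
  assumes "h \<in> localized_span n m f g C" "p \<in> mpolys m"
  shows "(\<lambda>x. eval_mpoly p (f x) * h x) \<in> localized_span n m f g C"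
proof -
  obtain N c where 1: "\<forall>\<gamma>\<in>C. c \<gamma> \<in> mpolys m"
    "\<forall>x\<in>affine_space n. eval_mpoly g (f x) ^ N * h x = (\<Sum>\<gamma>\<in>C. eval_mpoly (c \<gamma>) (f x) * \<gamma> x)"
    by (rule localized_spanE[OF assms(1)]) (rule that)
  note * = 1[rule_format]
  have "eval_mpoly g (f x) ^ N * (eval_mpoly p (f x) * h x) =
     (\<Sum>\<gamma>\<in>C. eval_mpoly (p * c \<gamma>) (f x) * \<gamma> x)" if "x \<in> affine_space n" for x
  proof -
    have "eval_mpoly g (f x) ^ N * (eval_mpoly p (f x) * h x) = eval_mpoly p (f x) * (eval_mpoly g (f x) ^ N * h x)"
      by (simp add: algebra_simps)
    then show ?thesis
      unfolding *(2)[OF that] by (simp add: sum_distrib_left eval_mpoly_mult mult.assoc)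
  qed
  then show ?thesis
    by (intro localized_spanI[of C "\<lambda>\<gamma>. p * c \<gamma>" N] mpolys_mult assms(2) *(1))
qed

lemma localized_span_divide:
  assumes "(\<lambda>x. eval_mpoly g (f x) ^ k * h x) \<in> localized_span n m f g C"
  shows "h \<in> localized_span n m f g C"
proof -
  obtain N c where 1: "\<forall>\<gamma>\<in>C. c \<gamma> \<in> mpolys m"
    "\<forall>x\<in>affine_space n. eval_mpoly g (f x) ^ N * (eval_mpoly g (f x) ^ k * h x) = (\<Sum>\<gamma>\<in>C. eval_mpoly (c \<gamma>) (f x) * \<gamma> x)"
    by (rule localized_spanE[OF assms(1)]) (rule that)
  then show ?thesis by (intro localized_spanI[of C c "N + k"]) (simp_all add: power_add mult.assoc)
qed

lemma localized_span_sum: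
  "(\<And>i. i \<in> I \<Longrightarrow> h i \<in> localized_span n m f g C) \<Longrightarrow> (\<lambda>x. \<Sum>i\<in>I. h i x) \<in> localized_span n m f g C"
  by (induction I rule: infinite_finite_induct) (auto simp: localized_span_0 localized_span_add)

lemma localized_span_times:
  assumes "h \<in> localized_span n m f g C" "h' \<in> localized_span n m f g D" "\<And>\<gamma> \<delta>. \<gamma> \<in> C \<Longrightarrow> \<delta> \<in> D \<Longrightarrow> (\<lambda>x. \<gamma> x * \<delta> x) \<in> localized_span n m f g E"
  shows "(\<lambda>x. h x * h' x) \<in> localized_span n m f g E"
proof -
  obtain N c where 1: "\<forall>\<gamma>\<in>C. c \<gamma> \<in> mpolys m"
    "\<forall>x\<in>affine_space n. eval_mpoly g (f x) ^ N * h x = (\<Sum>\<gamma>\<in>C. eval_mpoly (c \<gamma>) (f x) * \<gamma> x)"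
    by (rule localized_spanE[OF assms(1)]) (rule that)
  obtain N' c' where 2: "\<forall>\<delta>\<in>D. c' \<delta> \<in> mpolys m"
    "\<forall>x\<in>affine_space n. eval_mpoly g (f x) ^ N' * h' x = (\<Sum>\<delta>\<in>D. eval_mpoly (c' \<delta>) (f x) * \<delta> x)"
    by (rule localized_spanE[OF assms(2)]) (rule that)
  note * = 1(1)[rule_format] 2(1)[rule_format] 1(2)[rule_format] 2(2)[rule_format]
  have "(\<lambda>x. \<Sum>\<gamma>\<in>C. \<Sum>\<delta>\<in>D. eval_mpoly (c \<gamma> * c' \<delta>) (f x) * (\<gamma> x * \<delta> x)) \<in> localized_span n m f g E"
    using * by (intro localized_span_sum localized_span_mult assms(3) mpolys_mult) auto
  then have "(\<lambda>x. eval_mpoly g (f x) ^ (N + N') * (h x * h' x)) \<in> localized_span n m f g E"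
  proof (rule localized_span_cong)
    fix x :: "nat \<Rightarrow> 'a" assume x: "x \<in> affine_space n"
    have "eval_mpoly g (f x) ^ (N + N') * (h x * h' x) = (eval_mpoly g (f x) ^ N * h x) * (eval_mpoly g (f x) ^ N' * h' x)"
      by (simp add: power_add algebra_simps)
    also have "\<dots> = (\<Sum>\<gamma>\<in>C. \<Sum>\<delta>\<in>D. eval_mpoly (c \<gamma> * c' \<delta>) (f x) * (\<gamma> x * \<delta> x))"
      unfolding *(3)[OF x] *(4)[OF x] sum_product by (simp add: eval_mpoly_mult algebra_simps)
    finally show "eval_mpoly g (f x) ^ (N + N') * (h x * h' x) = \<dots>" .
  qed
  then show ?thesis by (rule localized_span_divide)
qed

text \<open>The integral equation for \<open>x\<^sub>k\<close> rewrites each power with exponent at least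
  \<open>r\<close> in terms of smaller ones.\<close>

lemma localized_span_powers:
  assumes gk: "gk \<in> mpolys m" "g' \<in> mpolys m" "g = g' * gk" and a: "\<And>l. l < r \<Longrightarrow> a l \<in> mpolys m"
    and eq: "\<And>x. x \<in> affine_space n \<Longrightarrow> eval_mpoly gk (f x) * x k ^ r + (\<Sum>l<r. eval_mpoly (a l) (f x) * x k ^ l) = 0"
  shows "(\<lambda>x. x k ^ j) \<in> localized_span n m f g ((\<lambda>e x. x k ^ e) ` {..<r})"
proof (induction j rule: less_induct)
  case (less j)
  show ?case
  proof (cases "j < r")
    case True
    then show ?thesis by (intro localized_span_generator) auto
  next
    case False
    have "(\<lambda>x. \<Sum>l<r. eval_mpoly (- (g' * a l)) (f x) * x k ^ (l + (j - r))) \<in> localized_span n m f g ((\<lambda>e x. x k ^ e) ` {..<r})"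
      using False gk a by (intro localized_span_sum localized_span_mult less.IH) (auto intro!: mpolys_uminus mpolys_mult)
    then have "(\<lambda>x. eval_mpoly g (f x) ^ 1 * x k ^ j) \<in> localized_span n m f g ((\<lambda>e x. x k ^ e) ` {..<r})"
    proof (rule localized_span_cong)
      fix x :: "nat \<Rightarrow> 'a" assume x: "x \<in> affine_space n"
      have "eval_mpoly g (f x) * x k ^ j = eval_mpoly g' (f x) * (eval_mpoly gk (f x) * x k ^ r) * x k ^ (j - r)"
        using False by (simp add: gk(3) eval_mpoly_mult mult.assoc flip: power_add)
      also have "eval_mpoly gk (f x) * x k ^ r = - (\<Sum>l<r. eval_mpoly (a l) (f x) * x k ^ l)"
        using eq[OF x] by (simp add: eq_neg_iff_add_eq_0)
      finally show "eval_mpoly g (f x) ^ 1 * x k ^ j = (\<Sum>l<r. eval_mpoly (- (g' * a l)) (f x) * x k ^ (l + (j - r)))"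
        by (simp add: eval_mpoly_mult eval_uminus sum_distrib_left sum_distrib_right power_add sum_negf mult.assoc)
    qed
    then show ?thesis by (rule localized_span_divide)
  qed
qed

end

text \<open>Adding one variable at a time, the generators are multiplied by the powers of the new variable
  below the degree of its integral equation.\<close>

lemma leading_coeffs_imp_spanning_set:
  fixes F :: "nat \<Rightarrow> 'a::comm_ring_1 mpoly"
  assumes F: "\<forall>i<m. F i \<in> mpolys n" and g: "g \<in> mpolys m"
    and lead: "\<And>i. i < n \<Longrightarrow> \<exists>gi g'. gi \<in> leading_coeffs m F i \<and> g' \<in> mpolys m \<and> g = g' * gi"
    and "k \<le> n"
  shows "\<exists>C. finite C \<and> C \<subseteq> eval_mpoly ` mpolys k \<and>
    (\<forall>p\<in>mpolys k. eval_mpoly p \<in> localized_span n m (poly_map m F) g C)"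
  using \<open>k \<le> n\<close>
proof (induction k)
  case 0
  let ?C = "{eval_mpoly (1 :: 'a mpoly)}"
  have "eval_mpoly p \<in> localized_span n m (poly_map m F) g ?C" if "p \<in> mpolys 0" for p
  proof -
    obtain c where c: "p = Const c" using \<open>p \<in> mpolys 0\<close> mpolys_0_iff by blast
    have "(\<lambda>x. eval_mpoly (Const c) (poly_map m F x) * eval_mpoly 1 x) \<in> localized_span n m (poly_map m F) g ?C"
      by (intro localized_span_mult[OF g] localized_span_generator[OF g]) auto
    then show ?thesis by (rule localized_span_cong[OF g]) (simp add: c)
  qed
  then show ?case by (intro exI[of _ ?C]) auto
next
  case (Suc k)
  then obtain C where C: "finite C" "C \<subseteq> eval_mpoly ` mpolys k"
    "\<And>p. p \<in> mpolys k \<Longrightarrow> eval_mpoly p \<in> localized_span n m (poly_map m F) g C" by auto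
  obtain gi g' where gi: "gi \<in> leading_coeffs m F k" "g' \<in> mpolys m" "g = g' * gi"
    using lead[of k] Suc.prems by auto
  then obtain r a where ra: "\<And>l. l < r \<Longrightarrow> a l \<in> mpolys m" "gi \<in> mpolys m"
    "heval Const gi F * Var k ^ r + (\<Sum>l<r. heval Const (a l) F * Var k ^ l) = 0"
    by (auto simp: leading_coeffs_def)
  have eq: "eval_mpoly gi (poly_map m F x) * x k ^ r + (\<Sum>l<r. eval_mpoly (a l) (poly_map m F x) * x k ^ l) = 0" for x
    using arg_cong[OF ra(3), of "\<lambda>p. eval_mpoly p x"]
    by (simp add: eval_mpoly_add eval_mpoly_mult eval_power eval_mpoly_sum eval_poly_map ra(1,2))
  define D where "D = (\<lambda>e (x :: nat \<Rightarrow> 'a). x k ^ e) ` {..<r}"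
  define E where "E = (\<lambda>(\<gamma>, \<delta>) x. \<gamma> x * \<delta> x) ` (C \<times> D)"
  have D: "(\<lambda>x. x k ^ j) \<in> localized_span n m (poly_map m F) g D" for j
    unfolding D_def by (rule localized_span_powers[OF g ra(2) gi(2,3) ra(1) eq])
  have "finite E" using C(1) by (simp add: E_def D_def)
  moreover have "E \<subseteq> eval_mpoly ` mpolys (Suc k)"
  proof
    fix h assume "h \<in> E"
    then obtain \<gamma> e where h: "\<gamma> \<in> C" "h = (\<lambda>x. \<gamma> x * x k ^ e)" by (auto simp: E_def D_def)
    then obtain p where p: "p \<in> mpolys k" "\<gamma> = eval_mpoly p" using C(2) by blast
    have "h = eval_mpoly (p * Var k ^ e)" by (simp add: h p eval_mpoly_mult eval_power fun_eq_iff)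
    moreover have "p * Var k ^ e \<in> mpolys (Suc k)"
      using p(1) mpolys_mono[of k "Suc k"] by (intro mpolys_mult mpolys_power mpolys_Var) auto
    ultimately show "h \<in> eval_mpoly ` mpolys (Suc k)" by blast
  qed
  moreover have "eval_mpoly p \<in> localized_span n m (poly_map m F) g E" if p: "p \<in> mpolys (Suc k)" for p
  proof -
    obtain P where P: "\<forall>j. coeff P j \<in> mpolys k" "p = poly P (Var k)" using p by (auto simp: mpolys_Suc_iff)
    have "(\<lambda>x. \<Sum>j\<le>degree P. eval_mpoly (coeff P j) x * x k ^ j) \<in> localized_span n m (poly_map m F) g E"
      using P(1) \<open>finite E\<close>
      by (intro localized_span_sum[OF g] localized_span_times[OF g C(3) D] localized_span_generator[OF g])
         (auto simp: E_def)
    then show ?thesis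
      by (rule localized_span_cong[OF g]) (simp add: P(2) poly_altdef eval_mpoly_sum eval_mpoly_mult eval_power)
  qed
  ultimately show ?case by blast
qed

text \<open>Let \<open>g\<close> be the product of the leading coefficients. On \<open>g \<noteq> 0\<close>,
  which is affine along with its preimage, all coordinates are integral, so monomials of bounded
  exponents generate the polynomials on the source; regular functions on the preimage are
  polynomials divided by powers of \<open>g(f)\<close>.\<close>

lemma leading_coeffs_imp_finite_at:
  fixes F :: "nat \<Rightarrow> 'a::alg_closed_field mpoly"
  assumes F: "\<forall>i<m. F i \<in> mpolys n" and y: "y \<in> affine_space m"
    and lead: "\<And>i. i < n \<Longrightarrow> \<exists>g\<in>leading_coeffs m F i. eval_mpoly g y \<noteq> 0"
  shows "finite_at n (affine_space n) m (affine_space m) (poly_map m F) y"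
proof -
  let ?f = "poly_map m F"
  have "\<forall>i\<in>{..<n}. \<exists>g. g \<in> leading_coeffs m F i \<and> eval_mpoly g y \<noteq> 0" using lead by blast
  from bchoice[OF this] obtain gi where gi: "\<And>i. i < n \<Longrightarrow> gi i \<in> leading_coeffs m F i" "\<And>i. i < n \<Longrightarrow> eval_mpoly (gi i) y \<noteq> 0"
    by auto
  have gim: "gi i \<in> mpolys m" if "i < n" for i using gi(1)[OF that] by (simp add: leading_coeffs_def)
  define g where "g = (\<Prod>i<n. gi i)"
  have g: "g \<in> mpolys m" unfolding g_def using gim by (intro mpolys_prod) auto
  have gy: "eval_mpoly g y \<noteq> 0" using gi(2) by (simp add: g_def eval_prod)
  have split: "\<exists>gi g'. gi \<in> leading_coeffs m F i \<and> g' \<in> mpolys m \<and> g = g' * gi" if "i < n" for i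
  proof (intro exI conjI)
    show "gi i \<in> leading_coeffs m F i" by (rule gi(1)[OF that])
    show "(\<Prod>i\<in>{..<n} - {i}. gi i) \<in> mpolys m" using gim by (intro mpolys_prod) auto
    show "g = (\<Prod>i\<in>{..<n} - {i}. gi i) * gi i"
      unfolding g_def using that by (subst prod.remove[of _ i]) (auto simp: mult.commute)
  qed
  obtain C where C: "finite C" "C \<subseteq> eval_mpoly ` mpolys n"
    "\<And>p. p \<in> mpolys n \<Longrightarrow> eval_mpoly p \<in> localized_span n m ?f g C"
    using leading_coeffs_imp_spanning_set[OF F g split, of n] by auto
  define U where "U = {z \<in> affine_space m. eval_mpoly g z \<noteq> 0}"
  define G where "G = heval Const g F"
  have G: "G \<in> mpolys n" unfolding G_def by (rule mpolys_subst[OF g]) (use F in auto)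
  define V where "V = {x \<in> affine_space n. eval_mpoly G x \<noteq> 0}"
  have Gg: "eval_mpoly G x = eval_mpoly g (?f x)" for x by (simp add: G_def eval_poly_map[OF g])
  have VU: "{x \<in> affine_space n. ?f x \<in> U} = V"
    by (auto simp: U_def V_def Gg poly_map_in_affine)
  have VU': "{x \<in> V. ?f x \<in> U} = V" using VU by (auto simp: V_def)
  have Uaff: "U \<subseteq> affine_space m" and Vaff: "V \<subseteq> affine_space n" by (auto simp: U_def V_def)
  have "module_finite n V m U ?f"
    unfolding module_finite_def
  proof (intro exI[of _ C] conjI allI impI ballI C(1))
    fix \<gamma> assume "\<gamma> \<in> C"
    then obtain p where "p \<in> mpolys n" "\<gamma> = eval_mpoly p" using C(2) by blast
    then show "regular_fun n V \<gamma>" using Vaff by (intro regular_fun_poly[of p]) auto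
  next
    fix h assume "regular_fun n V h"
    then obtain N p where p: "p \<in> mpolys n"
      "\<And>x. x \<in> affine_space n \<Longrightarrow> eval_mpoly G x \<noteq> 0 \<Longrightarrow> eval_mpoly G x ^ N * h x = eval_mpoly p x"
      using regular_fun_principal[OF G, of h] unfolding V_def by blast
    obtain N' c where c0: "\<forall>\<gamma>\<in>C. c \<gamma> \<in> mpolys m"
      "\<forall>x\<in>affine_space n. eval_mpoly g (?f x) ^ N' * eval_mpoly p x = (\<Sum>\<gamma>\<in>C. eval_mpoly (c \<gamma>) (?f x) * \<gamma> x)"
      by (rule localized_spanE[OF g C(3)[OF p(1)]]) (rule that)
    note c = c0[rule_format]
    define c' where "c' \<gamma> z = eval_mpoly (c \<gamma>) z / eval_mpoly (g ^ (N' + N)) z" for \<gamma> z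
    have "\<forall>\<gamma>\<in>C. regular_fun m U (c' \<gamma>)"
    proof
      fix \<gamma> assume "\<gamma> \<in> C"
      then show "regular_fun m U (c' \<gamma>)"
        using c(1) g Uaff by (intro regular_fun_quotient[of "c \<gamma>" m "g ^ (N' + N)"]) (auto simp: c'_def mpolys_power eval_power U_def)
    qed
    moreover have "h x = (\<Sum>\<gamma>\<in>C. c' \<gamma> (?f x) * \<gamma> x)" if "x \<in> V" for x
    proof -
      have x: "x \<in> affine_space n" "eval_mpoly G x \<noteq> 0" using that by (auto simp: V_def)
      have "(\<Sum>\<gamma>\<in>C. c' \<gamma> (?f x) * \<gamma> x) = (\<Sum>\<gamma>\<in>C. eval_mpoly (c \<gamma>) (?f x) * \<gamma> x) / eval_mpoly g (?f x) ^ (N' + N)"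
        by (simp add: c'_def sum_divide_distrib eval_power)
      also have "\<dots> = eval_mpoly G x ^ N' * (eval_mpoly G x ^ N * h x) / eval_mpoly G x ^ (N' + N)"
        unfolding c(2)[OF x(1), symmetric] p(2)[OF x, symmetric] Gg ..
      also have "\<dots> = h x" using x(2) by (simp add: power_add)
      finally show ?thesis by simp
    qed
    ultimately show "\<exists>c. (\<forall>g\<in>C. regular_fun m U (c g)) \<and> (\<forall>x\<in>V. h x = (\<Sum>g\<in>C. c g (?f x) * g x))" by blast
  qed
  moreover have aff: "is_affine m U" "is_affine n V" unfolding U_def V_def by (intro is_affine_principal g G)+
  moreover have "openin (subtopology (zariski m) U) U" using openin_principal[of 1 m U] Uaff by simp
  moreover have "regular_map n V m U ?f"
    unfolding regular_map_def
  proof (intro conjI allI impI)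
    show "?f ` V \<subseteq> U" using VU by blast
    fix i assume "i < m"
    then show "regular_fun n V (\<lambda>x. ?f x i)"
      using F Vaff by (intro regular_fun_poly[of "F i"]) (auto simp: poly_map_def)
  qed
  ultimately have "finite_map n V m U ?f"
    unfolding finite_map_def by (intro conjI ballI exI[of _ U]) (simp_all add: VU')
  moreover have "openin (subtopology (zariski m) (affine_space m)) U"
    unfolding U_def by (rule openin_principal[OF g]) simp
  moreover have "y \<in> U" using y gy by (simp add: U_def)
  ultimately show ?thesis unfolding finite_at_def by (intro exI[of _ U]) (simp add: VU)
qed

section \<open>Irreducible sets and polynomial curves\<close>

lemma irreducible_zariski_iff:
  assumes "Y \<subseteq> affine_space m"
  shows "irreducible_space (subtopology (zariski m) Y) \<longleftrightarrow> Y \<noteq> {} \<and>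
    (\<forall>a\<in>mpolys m. \<forall>b\<in>mpolys m. (\<forall>y\<in>Y. eval_mpoly a y * eval_mpoly b y = 0) \<longrightarrow>
       (\<forall>y\<in>Y. eval_mpoly a y = 0) \<or> (\<forall>y\<in>Y. eval_mpoly b y = 0))" (is "?L \<longleftrightarrow> ?R")
proof
  have top: "topspace (subtopology (zariski m) Y) = Y" using assms by auto
  {
    assume L: ?L
    show ?R
    proof (intro conjI ballI impI)
      show "Y \<noteq> {}" using L top by (simp add: irreducible_space_def)
      fix a b assume ab: "a \<in> mpolys m" "b \<in> mpolys m" "\<forall>y\<in>Y. eval_mpoly a y * eval_mpoly b y = 0"
      have cl: "closedin (subtopology (zariski m) Y) (zero_locus m {a} \<inter> Y)" if "a \<in> mpolys m" for a
        using that unfolding closedin_subtopology closedin_zariski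
        by (intro exI[of _ "zero_locus m {a}"] exI[of _ "{a}"] conjI) auto
      have "Y = (zero_locus m {a} \<inter> Y) \<union> (zero_locus m {b} \<inter> Y)"
        using ab(3) assms by (auto simp: zero_locus_def)
      then have "Y = zero_locus m {a} \<inter> Y \<or> Y = zero_locus m {b} \<inter> Y"
        using L cl[OF ab(1)] cl[OF ab(2)] unfolding irreducible_space_def top by blast
      then show "(\<forall>y\<in>Y. eval_mpoly a y = 0) \<or> (\<forall>y\<in>Y. eval_mpoly b y = 0)"
        by (auto simp: zero_locus_def)
    qed
  next
    assume R: ?R
    show ?L
      unfolding irreducible_space_def top
    proof (intro conjI allI impI)
      show "Y \<noteq> {}" using R by blast
      fix A B assume *: "closedin (subtopology (zariski m) Y) A \<and> closedin (subtopology (zariski m) Y) B \<and> Y = A \<union> B"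
      then obtain S T where S: "S \<subseteq> mpolys m" "A = zero_locus m S \<inter> Y" and T: "T \<subseteq> mpolys m" "B = zero_locus m T \<inter> Y"
        unfolding closedin_subtopology closedin_zariski by blast
      show "Y = A \<or> Y = B"
      proof (rule ccontr)
        assume "\<not> (Y = A \<or> Y = B)"
        then obtain y y' where y: "y \<in> Y" "y \<notin> A" "y' \<in> Y" "y' \<notin> B" using S T by blast
        then obtain s t where st: "s \<in> S" "t \<in> T" "eval_mpoly s y \<noteq> 0" "eval_mpoly t y' \<noteq> 0"
          using S(2) T(2) assms by (auto simp: zero_locus_def)
        have "\<forall>y\<in>Y. eval_mpoly s y * eval_mpoly t y = 0"
          using * S(2) T(2) st(1,2) by (auto simp: zero_locus_def)
        then have "(\<forall>y\<in>Y. eval_mpoly s y = 0) \<or> (\<forall>y\<in>Y. eval_mpoly t y = 0)"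
          using R st(1,2) S(1) T(1) by blast
        then show False using y st by blast
      qed
    qed
  }
qed

lemma ring_relation_diagonal: "subring_set R \<Longrightarrow> ring_relation {(p, p) | p. p \<in> R}"
  unfolding ring_relation_def subring_set_def by blast

lemma comm_ring_hom_const_poly: "comm_ring_hom (\<lambda>c. [:c:])"
  by unfold_locales (auto simp: one_pCons)

lemma comm_ring_hom_to_fract: "comm_ring_hom (to_fract :: 'a::idom \<Rightarrow> 'a fract)"
  by unfold_locales auto

lemma closedin_zariski_singleton: "a \<in> affine_space m \<Longrightarrow> closedin (zariski m) {a :: nat \<Rightarrow> 'a::idom}"
proof -
  assume a: "a \<in> affine_space m"
  have "{a} = zero_locus m ((\<lambda>i. Var i - Const (a i)) ` {..<m})"
  proof (intro subset_antisym subsetI)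
    fix x assume "x \<in> zero_locus m ((\<lambda>i. Var i - Const (a i)) ` {..<m})"
    then have "x \<in> affine_space m" "\<And>i. i < m \<Longrightarrow> x i = a i" by (auto simp: zero_locus_def eval_diff)
    then have "x = a" using a unfolding affine_space_def by (intro PiE_ext[of x "{..<m}" "\<lambda>_. UNIV" a]) auto
    then show "x \<in> {a}" by simp
  qed (use a in \<open>auto simp: zero_locus_def eval_diff\<close>)
  moreover have "(\<lambda>i. Var i - Const (a i)) ` {..<m} \<subseteq> mpolys m"
    by (auto intro!: mpolys_diff mpolys_Var)
  ultimately show ?thesis unfolding closedin_zariski by blast
qed

lemma finite_irreducible_singleton:
  assumes "Y \<subseteq> affine_space m" "finite Y" "irreducible_space (subtopology (zariski m) (Y :: (nat \<Rightarrow> 'a::idom) set))"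
  shows "\<exists>y. Y = {y}"
proof -
  have top: "topspace (subtopology (zariski m) Y) = Y" using assms by auto
  have fin: "closedin (subtopology (zariski m) Y) B" if "B \<subseteq> Y" for B
  proof -
    have "closedin (zariski m) (\<Union>b\<in>B. {b})"
      using that assms by (intro closedin_Union) (auto intro!: closedin_zariski_singleton dest: finite_subset)
    then show ?thesis using that unfolding closedin_subtopology by (intro exI[of _ B]) auto
  qed
  obtain y where y: "y \<in> Y" using assms(3) top by (auto simp: irreducible_space_def)
  have "Y = {y} \<union> (Y - {y})" using y by blast
  then have "Y = {y} \<or> Y = Y - {y}"
    using assms(3) fin[of "{y}"] fin[of "Y - {y}"] y unfolding irreducible_space_def top by blast
  then show ?thesis using y by blast
qed

definition curve_point :: "nat \<Rightarrow> (nat \<Rightarrow> 'a::comm_ring_1 poly) \<Rightarrow> 'a \<Rightarrow> (nat \<Rightarrow> 'a)" where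
  "curve_point m \<phi> t = (\<lambda>i\<in>{..<m}. poly (\<phi> i) t)"

lemma curve_point_affine: "curve_point m \<phi> t \<in> affine_space m"
  by (simp add: curve_point_def affine_space_def)

lemma eval_curve_point:
  assumes "p \<in> mpolys m"
  shows "eval_mpoly p (curve_point m \<phi> t) = poly (heval (\<lambda>c. [:c:]) p \<phi>) t"
proof -
  have "eval_mpoly p (curve_point m \<phi> t) = eval_mpoly p (\<lambda>i. poly (\<phi> i) t)"
    by (rule eval_mpoly_cong[OF assms]) (simp add: curve_point_def)
  also have "\<dots> = poly (heval (\<lambda>c. [:c:]) p \<phi>) t"
    using heval_natural[OF comm_ring_hom_poly[of t], of "\<lambda>c. [:c:]" p \<phi>] by (simp add: heval_id)
  finally show ?thesis .
qed

text \<open>A point \<open>y\<close> at which the equations of the curve vanish gives a homomorphism from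
  \<open>K[\<phi>]\<close> to \<open>K\<close>, which extends to a place of \<open>K(T)\<close>.
  That place is finite at \<open>T\<close>: if it sent \<open>1/T\<close> to \<open>0\<close>,
  then dividing the component \<open>\<phi> i0\<close> of positive degree by the top power of
  \<open>T\<close> would make its leading coefficient \<open>0\<close>. The value of
  \<open>T\<close> is a parameter of \<open>y\<close>.\<close>

lemma curve_image_contains_closure:
  fixes \<phi> :: "nat \<Rightarrow> 'a::alg_closed_field poly"
  assumes deg: "i0 < m" "degree (\<phi> i0) > 0" and y: "y \<in> affine_space m"
    and van: "\<forall>p\<in>mpolys m. (\<forall>t. eval_mpoly p (curve_point m \<phi> t) = 0) \<longrightarrow> eval_mpoly p y = 0"
  shows "y \<in> range (curve_point m \<phi>)"
proof -
  define emb where "emb c = to_fract [:c:]" for c :: 'a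
  have emb: "comm_ring_hom emb"
    unfolding emb_def by (rule comm_ring_hom_comp[OF comm_ring_hom_to_fract comm_ring_hom_const_poly])
  interpret emb: comm_ring_hom emb by (rule emb)
  interpret tf: comm_ring_hom "to_fract :: 'a poly \<Rightarrow> 'a poly fract" by (rule comm_ring_hom_to_fract)
  define z where "z i = to_fract (\<phi> i)" for i
  define G0 where "G0 = {(heval emb p z, eval_mpoly q y) | p q. (p, q) \<in> {(p, p) | p. p \<in> mpolys m}}"
  have "ring_relation G0"
    unfolding G0_def
    by (intro ring_relation_image emb.comm_ring_hom_heval comm_ring_hom_eval_mpoly ring_relation_diagonal subring_mpolys)
  moreover have "b = 0" if zb: "(0, b) \<in> G0" for b
  proof -
    obtain p where p: "p \<in> mpolys m" "0 = heval emb p z" "b = eval_mpoly p y" using zb unfolding G0_def by blast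
    have "to_fract (heval (\<lambda>c. [:c:]) p \<phi>) = heval emb p z"
      using heval_natural[OF comm_ring_hom_to_fract, of "\<lambda>c. [:c:]" p \<phi>] by (simp add: emb_def[abs_def] z_def[abs_def])
    then have "heval (\<lambda>c. [:c:]) p \<phi> = 0" using p(2) by simp
    then show "b = 0" using bspec[OF van p(1)] p(3) by (simp add: eval_curve_point[OF p(1)])
  qed
  ultimately obtain G where G': "ring_relation G" "G0 \<subseteq> G" "\<forall>b. (0, b) \<in> G \<longrightarrow> b = 0"
    "\<forall>x. (\<exists>c. (x, c) \<in> G) \<or> (inverse x, 0) \<in> G"
    using place_exists[of G0] by (elim exE conjE impE meta_impE) auto
  note G = G'(1,2) G'(3,4)[rule_format]
  note Gs = ring_relationD[OF G(1)]
  have uniq: "b = b'" if "(a, b) \<in> G" "(a, b') \<in> G" for a b b'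
  proof -
    have "(0, b - b') \<in> G" using Gs(4)[OF that] by simp
    from G(3)[OF this] show ?thesis by simp
  qed
  have G0I: "(heval emb p z, eval_mpoly p y) \<in> G" if "p \<in> mpolys m" for p
    using that G(2) unfolding G0_def by blast
  have cst: "(emb c, c) \<in> G" for c using G0I[of "Const c"] by (simp add: heval_Const[OF emb])
  have zG: "(z i, y i) \<in> G" if "i < m" for i using G0I[of "Var i"] that by (simp add: heval_Var[OF emb] mpolys_Var)
  define T where "T = to_fract [:0, 1 :: 'a:]"
  have T: "T \<noteq> 0" by (simp add: T_def)
  have zT: "z i = (\<Sum>k\<le>degree (\<phi> i). emb (coeff (\<phi> i) k) * T ^ k)" for i
  proof -
    have "\<phi> i = (\<Sum>k\<le>degree (\<phi> i). [:coeff (\<phi> i) k:] * [:0, 1:] ^ k)"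
      by (simp add: poly_as_sum_of_monoms flip: monom_altdef)
    then have "z i = to_fract (\<Sum>k\<le>degree (\<phi> i). [:coeff (\<phi> i) k:] * [:0, 1:] ^ k)" unfolding z_def by metis
    then show ?thesis by (simp only: tf.hom_sum tf.hom_mult tf.hom_power emb_def T_def)
  qed
  show ?thesis
  proof (cases "\<exists>c. (T, c) \<in> G")
    case True
    then obtain c where c: "(T, c) \<in> G" by blast
    have "y i = poly (\<phi> i) c" if "i < m" for i
    proof -
      have "(z i, poly (\<phi> i) c) \<in> G"
        unfolding zT poly_altdef
        by (intro ring_relation_sum[OF G(1)] Gs(5) cst ring_relation_power[OF G(1)] c)
      then show ?thesis using uniq zG[OF that] by blast
    qed
    then have "y = curve_point m \<phi> c"
      using y by (auto simp: curve_point_def affine_space_def PiE_def extensional_def fun_eq_iff)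
    then show ?thesis by blast
  next
    case False
    then have S: "(inverse T, 0) \<in> G" using G(4) by blast
    define e where "e = degree (\<phi> i0)"
    have "(z i0 * inverse T ^ e, y i0 * 0 ^ e) \<in> G"
      by (intro Gs(5) zG deg ring_relation_power[OF G(1)] S)
    moreover have "z i0 * inverse T ^ e = (\<Sum>k\<le>e. emb (coeff (\<phi> i0) k) * inverse T ^ (e - k))"
      unfolding zT sum_distrib_right e_def[symmetric]
    proof (intro sum.cong refl)
      fix k assume "k \<in> {..e}"
      then have "inverse T ^ e = inverse T ^ k * inverse T ^ (e - k)" by (simp flip: power_add)
      then show "emb (coeff (\<phi> i0) k) * T ^ k * inverse T ^ e = emb (coeff (\<phi> i0) k) * inverse T ^ (e - k)"
        using T by (simp add: power_inverse)
    qed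
    moreover have "((\<Sum>k\<le>e. emb (coeff (\<phi> i0) k) * inverse T ^ (e - k)), (\<Sum>k\<le>e. coeff (\<phi> i0) k * 0 ^ (e - k))) \<in> G"
      by (intro ring_relation_sum[OF G(1)] Gs(5) cst ring_relation_power[OF G(1)] S)
    ultimately have "y i0 * 0 ^ e = (\<Sum>k\<le>e. coeff (\<phi> i0) k * 0 ^ (e - k))" using uniq by simp
    also have "\<dots> = (\<Sum>k\<in>{e}. coeff (\<phi> i0) k * 0 ^ (e - k))"
      by (intro sum.mono_neutral_right) (auto simp: power_0_left)
    finally have "coeff (\<phi> i0) e = 0" using deg(2) by (simp add: e_def power_0_left)
    then show ?thesis using deg(2) by (simp add: e_def)
  qed
qed

text \<open>A proper closed subset pulls back to the root set of a nonzero polynomial in one variable, so it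
  is finite. Hence the image contains no irreducible closed sets other than its points and itself.\<close>

lemma parametric_curve_image:
  fixes \<phi> :: "nat \<Rightarrow> 'a::alg_closed_field poly"
  assumes deg: "\<And>i. i < m \<Longrightarrow> degree (\<phi> i) \<le> d" and i0: "i0 < m" "degree (\<phi> i0) > 0"
  shows "parametric_curve m d (range (curve_point m \<phi>))"
proof -
  let ?c = "curve_point m \<phi>"
  let ?l = "range ?c"
  let ?q = "\<lambda>p. heval (\<lambda>c. [:c:]) p \<phi>"
  have laff: "?l \<subseteq> affine_space m" using curve_point_affine by blast
  have closed: "closedin (zariski m) ?l"
  proof -
    let ?S = "{p \<in> mpolys m. \<forall>t. eval_mpoly p (?c t) = 0}"
    have "?l = zero_locus m ?S"
    proof
      show "?l \<subseteq> zero_locus m ?S" using curve_point_affine by (auto simp: zero_locus_def)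
      show "zero_locus m ?S \<subseteq> ?l"
      proof
        fix y assume "y \<in> zero_locus m ?S"
        then have y: "y \<in> affine_space m" "\<forall>p\<in>?S. eval_mpoly p y = 0" unfolding zero_locus_def by blast+
        show "y \<in> ?l"
          by (rule curve_image_contains_closure[of i0 m \<phi> y]) (use i0 y in simp_all)
      qed
    qed
    then show ?thesis unfolding closedin_zariski by (intro exI[of _ ?S]) auto
  qed
  have irr: "irreducible_space (subtopology (zariski m) ?l)"
    unfolding irreducible_zariski_iff[OF laff]
  proof (intro conjI ballI impI)
    fix a b :: "'a mpoly" assume ab: "a \<in> mpolys m" "b \<in> mpolys m" "\<forall>y\<in>?l. eval_mpoly a y * eval_mpoly b y = 0"
    then have "?q a * ?q b = 0"
      by (intro poly_eq_0_if_all_roots) (simp add: eval_curve_point)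
    then have "?q a = 0 \<or> ?q b = 0" by simp
    then show "(\<forall>y\<in>?l. eval_mpoly a y = 0) \<or> (\<forall>y\<in>?l. eval_mpoly b y = 0)"
      using ab by (auto simp: eval_curve_point)
  qed auto
  have "\<exists>s t. ?c s \<noteq> ?c t"
  proof (rule ccontr)
    assume *: "\<nexists>s t. ?c s \<noteq> ?c t"
    have "\<phi> i0 - [:poly (\<phi> i0) 0:] = 0"
    proof (rule poly_eq_0_if_all_roots)
      fix t
      have "?c t i0 = ?c 0 i0" using * by metis
      then show "poly (\<phi> i0 - [:poly (\<phi> i0) 0:]) t = 0" using i0(1) by (simp add: curve_point_def)
    qed
    then have "\<phi> i0 = [:poly (\<phi> i0) 0:]" by simp
    then have "degree (\<phi> i0) = 0" by (metis degree_pCons_0)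
    then show False using i0(2) by simp
  qed
  then obtain s t where st: "?c s \<noteq> ?c t" by blast
  have sub: "subtopology (subtopology (zariski m) ?l) C = subtopology (zariski m) C" if "C \<subseteq> ?l" for C
    using that by (simp add: subtopology_subtopology Int_absorb1)
  have cl_sub: "closedin (subtopology (zariski m) ?l) C \<longleftrightarrow> closedin (zariski m) C \<and> C \<subseteq> ?l" for C
    using closed closedin_closed_subtopology by blast
  have proper_finite: "finite C" if C: "closedin (zariski m) C" "C \<subset> ?l" for C
  proof -
    obtain S where S: "S \<subseteq> mpolys m" "C = zero_locus m S" using C(1) closedin_zariski by blast
    obtain u where "?c u \<notin> C" using C(2) by blast
    then obtain p where p: "p \<in> S" "eval_mpoly p (?c u) \<noteq> 0"
      using curve_point_affine S(2) by (auto simp: zero_locus_def)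
    have pm: "p \<in> mpolys m" using p S by blast
    have "?q p \<noteq> 0" using p(2) by (auto simp: eval_curve_point[OF pm])
    then have "finite {t. poly (?q p) t = 0}" by (rule poly_roots_finite)
    moreover have "C \<subseteq> ?c ` {t. poly (?q p) t = 0}"
    proof
      fix y assume y: "y \<in> C"
      then obtain v where "y = ?c v" using C(2) by blast
      moreover have "eval_mpoly p y = 0" using y p(1) S(2) by (auto simp: zero_locus_def)
      ultimately show "y \<in> ?c ` {t. poly (?q p) t = 0}" by (auto simp: eval_curve_point[OF pm])
    qed
    ultimately show ?thesis by (rule finite_surj)
  qed
  have "krull_dim (subtopology (zariski m) ?l) = 1"
    unfolding krull_dim_def
  proof (rule antisym)
    show "Sup {enat k |k. \<exists>C. (\<forall>i\<le>k. closedin (subtopology (zariski m) ?l) (C i) \<and>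
       irreducible_space (subtopology (subtopology (zariski m) ?l) (C i))) \<and> (\<forall>i<k. C i \<subset> C (Suc i))} \<le> 1"
    proof (rule Sup_least, clarify)
      fix k C assume C: "\<forall>i\<le>k. closedin (subtopology (zariski m) ?l) (C i) \<and>
         irreducible_space (subtopology (subtopology (zariski m) ?l) (C i))" "\<forall>i<k. C i \<subset> C (Suc i)"
      have cl: "closedin (zariski m) (C i)" "C i \<subseteq> ?l" "irreducible_space (subtopology (zariski m) (C i))" if "i \<le> k" for i
        using C(1) that cl_sub sub by auto
      have "k \<le> 1"
      proof (rule ccontr)
        assume "\<not> k \<le> 1"
        then have "C 1 \<subset> C (Suc 1)" "C 0 \<subset> C 1" "Suc 1 \<le> k" using C(2) by auto
        then have "C 1 \<subset> ?l" using cl(2)[of "Suc 1"] by blast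
        moreover have "1 \<le> k" "0 \<le> k" using \<open>\<not> k \<le> 1\<close> by auto
        ultimately have "finite (C 1)" using proper_finite cl by blast
        then obtain y where "C 1 = {y}"
          using finite_irreducible_singleton[of "C 1" m] cl[OF \<open>1 \<le> k\<close>] laff by blast
        then have "C 0 \<subseteq> {y}" "C 0 \<noteq> {y}" using \<open>C 0 \<subset> C 1\<close> by auto
        then have "C 0 = {}" by (simp add: subset_singleton_iff)
        then show False using cl(3)[OF \<open>0 \<le> k\<close>] by (simp add: irreducible_space_def)
      qed
      then show "enat k \<le> 1" by (simp add: one_enat_def)
    qed
  next
    define C where "C i = (if i = 0 then {?c s} else ?l)" for i :: nat
    have one: "irreducible_space (subtopology (zariski m) {?c s})"
      using curve_point_affine by (subst irreducible_zariski_iff) auto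
    have "(\<forall>i\<le>1. closedin (subtopology (zariski m) ?l) (C i) \<and>
       irreducible_space (subtopology (subtopology (zariski m) ?l) (C i))) \<and> (\<forall>i<1. C i \<subset> C (Suc i))"
    proof (intro conjI allI impI)
      fix i :: nat
      show "closedin (subtopology (zariski m) ?l) (C i)"
        unfolding cl_sub using closed closedin_zariski_singleton[OF curve_point_affine] by (auto simp: C_def)
      have "C i \<subseteq> ?l" by (auto simp: C_def)
      from sub[OF this] show "irreducible_space (subtopology (subtopology (zariski m) ?l) (C i))"
        using irr one by (simp add: C_def)
      assume "i < 1"
      have "?c t \<in> ?l" "?c t \<notin> {?c s}" using st by auto
      then have "{?c s} \<subset> ?l" by blast
      then show "C i \<subset> C (Suc i)" using \<open>i < 1\<close> by (simp add: C_def)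
    qed
    then show "1 \<le> Sup {enat k |k. \<exists>C. (\<forall>i\<le>k. closedin (subtopology (zariski m) ?l) (C i) \<and>
       irreducible_space (subtopology (subtopology (zariski m) ?l) (C i))) \<and> (\<forall>i<k. C i \<subset> C (Suc i))}"
      unfolding one_enat_def by (intro Sup_upper) blast
  qed
  moreover have "\<forall>t. (\<lambda>i\<in>{..<m}. poly (\<phi> i) t) \<in> ?l" by (auto simp: curve_point_def)
  ultimately show ?thesis
    unfolding parametric_curve_def using closed irr deg st unfolding curve_point_def by blast
qed

lemma degree_heval_le:
  assumes z: "\<And>l. degree (z l) \<le> 1"
  shows "degree (heval (\<lambda>c. [:h c:]) p z) \<le> total_degree p"
  unfolding heval_def
proof (rule degree_sum_le)
  fix a assume a: "a \<in> Poly_Mapping.keys p"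
  have "degree ([:h (Poly_Mapping.lookup p a):] * eval_monom a z) \<le> degree (eval_monom a z)"
    using degree_mult_le[of "[:h (Poly_Mapping.lookup p a):]" "eval_monom a z"] by simp
  also have "\<dots> \<le> (\<Sum>i\<in>Poly_Mapping.keys a. Poly_Mapping.lookup a i)"
    unfolding eval_monom_def
  proof (rule order_trans[OF degree_prod_sum_le])
    have "degree (z i ^ Poly_Mapping.lookup a i) \<le> Poly_Mapping.lookup a i" for i
    proof -
      have "degree (z i ^ Poly_Mapping.lookup a i) \<le> degree (z i) * Poly_Mapping.lookup a i"
        by (rule degree_power_le)
      also have "\<dots> \<le> 1 * Poly_Mapping.lookup a i" by (rule mult_right_mono[OF z]) simp
      finally show ?thesis by simp
    qed
    then show "(\<Sum>i\<in>Poly_Mapping.keys a. (degree \<circ> (\<lambda>i. z i ^ Poly_Mapping.lookup a i)) i) \<le> (\<Sum>i\<in>Poly_Mapping.keys a. Poly_Mapping.lookup a i)"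
      unfolding o_def by (intro sum_mono)
  qed simp
  also have "\<dots> \<le> total_degree p" unfolding total_degree_def using a by (intro Max_ge) auto
  finally show "degree ([:h (Poly_Mapping.lookup p a):] * eval_monom a z) \<le> total_degree p" .
qed simp

section \<open>The set of points of non-properness\<close>

lemma nonfinite_set_iff:
  fixes F :: "nat \<Rightarrow> 'a::alg_closed_field mpoly"
  assumes F: "\<forall>i<m. F i \<in> mpolys n"
  shows "y \<in> nonfinite_set n (affine_space n) m (affine_space m) (poly_map m F) \<longleftrightarrow>
    y \<in> affine_space m \<and> (\<exists>i<n. \<forall>g\<in>leading_coeffs m F i. eval_mpoly g y = 0)"
  unfolding nonfinite_set_def
  using finite_at_imp_leading_coeff[OF F, of _ y] leading_coeffs_imp_finite_at[OF F, of y] by blast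

lemma closedin_nonfinite_set:
  fixes F :: "nat \<Rightarrow> 'a::alg_closed_field mpoly"
  assumes F: "\<forall>i<m. F i \<in> mpolys n"
  shows "closedin (zariski m) (nonfinite_set n (affine_space n) m (affine_space m) (poly_map m F))"
proof -
  have "nonfinite_set n (affine_space n) m (affine_space m) (poly_map m F) =
    (\<Union>i\<in>{..<n}. zero_locus m (leading_coeffs m F i))"
    unfolding zero_locus_def by (rule Set.set_eqI) (auto simp: nonfinite_set_iff[OF F] Bex_def)
  moreover have "closedin (zariski m) (\<Union>i\<in>{..<n}. zero_locus m (leading_coeffs m F i))"
  proof (rule closedin_Union)
    fix Z assume "Z \<in> (\<lambda>i. zero_locus m (leading_coeffs m F i)) ` {..<n}"
    then obtain i where "Z = zero_locus m (leading_coeffs m F i)" by blast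
    moreover have "leading_coeffs m F i \<subseteq> mpolys m" for i by (auto simp: leading_coeffs_def)
    ultimately show "closedin (zariski m) Z" unfolding closedin_zariski by blast
  qed simp
  ultimately show ?thesis by simp
qed

text \<open>If no component depended on \<open>x\<^sub>j\<close>, every nonempty fibre would contain a line,
  and some fibre over a point of the image is finite.\<close>

lemma generically_finite_depends:
  fixes F :: "nat \<Rightarrow> 'a::alg_closed_field mpoly"
  assumes F: "\<forall>i<m. F i \<in> mpolys n" and gf: "generically_finite n m (poly_map m F)" and j: "j < n"
  shows "\<exists>l<m. \<exists>x s. eval_mpoly (F l) (x(j := s)) \<noteq> eval_mpoly (F l) x"
proof (rule ccontr)
  assume no: "\<not> ?thesis"
  let ?f = "poly_map m F"
  obtain U where U: "openin (subtopology (zariski m) (zariski m closure_of (?f ` affine_space n))) U" "U \<noteq> {}"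
    "\<forall>y\<in>U. finite {x \<in> affine_space n. ?f x = y}"
    using gf unfolding generically_finite_def by blast
  obtain T where T: "openin (zariski m) T" "U = T \<inter> zariski m closure_of (?f ` affine_space n)"
    using U(1) unfolding openin_subtopology by blast
  obtain y where "y \<in> T" "y \<in> zariski m closure_of (?f ` affine_space n)" using U(2) T(2) by blast
  then obtain x where x: "x \<in> affine_space n" "?f x \<in> T" using T(1) unfolding in_closure_of by blast
  have "?f x \<in> zariski m closure_of (?f ` affine_space n)"
    using closure_of_subset[of "?f ` affine_space n" "zariski m"] x(1) poly_map_in_affine by (auto simp: image_subset_iff)
  then have fin: "finite {x' \<in> affine_space n. ?f x' = ?f x}" using U(3) T(2) x(2) by blast
  have "range (\<lambda>s. x(j := s)) \<subseteq> {x' \<in> affine_space n. ?f x' = ?f x}"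
  proof
    fix x' assume "x' \<in> range (\<lambda>s. x(j := s))"
    then obtain s where s: "x' = x(j := s)" by blast
    have "x' \<in> affine_space n" using x(1) j by (auto simp: s affine_space_def PiE_def extensional_def)
    moreover have "?f x' = ?f x" using no unfolding poly_map_def s by (intro restrict_ext) blast
    ultimately show "x' \<in> {x' \<in> affine_space n. ?f x' = ?f x}" by blast
  qed
  then have "finite (range (\<lambda>s. x(j := s)))" using fin finite_subset by blast
  moreover have "inj (\<lambda>s. x(j := s))" by (rule injI) (metis fun_upd_same)
  ultimately have "finite (UNIV :: 'a set)" by (rule finite_imageD)
  then show False using infinite_UNIV_alg_closed by blast
qed

text \<open>A nonconstant polynomial \<open>F l\<close> in one variable is an integral equation for the
  variable over \<open>K[F l]\<close>.\<close>

lemma leading_coeffs_one_variable: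
  fixes F :: "nat \<Rightarrow> 'a::alg_closed_field mpoly"
  assumes F: "l < m" "F l \<in> mpolys 1" and dep: "eval_mpoly (F l) (x(0 := s)) \<noteq> eval_mpoly (F l) x"
  shows "\<exists>c. c \<noteq> 0 \<and> Const c \<in> leading_coeffs m F 0"
proof -
  obtain P where P: "\<forall>k. coeff P k \<in> mpolys 0" "F l = poly P (Var 0)" using F(2) mpolys_Suc_iff[of "F l" 0] by auto
  have "\<forall>k. \<exists>c. coeff P k = Const c" using P(1) mpolys_0_iff by blast
  from choice[OF this] obtain c where c: "\<And>k. coeff P k = Const (c k)" by blast
  define r where "r = degree P"
  have r: "r > 0"
  proof (rule ccontr)
    assume "\<not> r > 0"
    then have "P = [:coeff P 0:]" unfolding r_def by (metis degree_0_id neq0_conv)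
    then have "P = [:Const (c 0):]" by (simp add: c)
    then have "F l = Const (c 0)" by (simp add: P(2))
    then show False using dep by simp
  qed
  have "P \<noteq> 0" using r by (auto simp: r_def)
  then have "coeff P r \<noteq> 0" by (simp add: r_def)
  then have "c r \<noteq> 0" unfolding c by (auto simp: Const_def)
  define a where "a k = (if k = 0 then Const (c 0) - Var l else Const (c k))" for k
  have a: "a k \<in> mpolys m" for k using F(1) by (auto simp: a_def intro!: mpolys_diff mpolys_Var)
  interpret hF: comm_ring_hom "\<lambda>p. heval Const p F" by (rule comm_ring_hom.comm_ring_hom_heval[OF comm_ring_hom_Const])
  have sa: "heval Const (a k) F = (if k = 0 then Const (c 0) - F l else Const (c k))" for k
    by (simp add: a_def hF.hom_minus heval_Const[OF comm_ring_hom_Const] heval_Var[OF comm_ring_hom_Const])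
  have "(\<Sum>k<r. heval Const (a k) F * Var 0 ^ k) = (\<Sum>k<r. Const (c k) * Var 0 ^ k - (if k = 0 then F l else 0))"
    by (intro sum.cong) (auto simp: sa)
  also have "\<dots> = (\<Sum>k<r. Const (c k) * Var 0 ^ k) - F l"
    using r by (simp add: sum_subtractf sum.delta)
  finally have "heval Const (Const (c r)) F * Var 0 ^ r + (\<Sum>k<r. heval Const (a k) F * Var 0 ^ k) =
     (\<Sum>k\<le>r. Const (c k) * Var 0 ^ k) - F l"
    by (simp add: heval_Const[OF comm_ring_hom_Const] lessThan_Suc_atMost[symmetric])
  also have "\<dots> = 0" by (simp add: P(2) poly_altdef c r_def)
  finally have "Const (c r) \<in> leading_coeffs m F 0" using a by (auto simp: leading_coeffs_def)
  then show ?thesis using \<open>c r \<noteq> 0\<close> by blast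
qed

lemma comm_ring_hom_pcompose: "comm_ring_hom (\<lambda>p. pcompose p q)"
  by unfold_locales (auto simp: pcompose_add pcompose_mult pcompose_1)

section \<open>Curves obtained by moving the generic point\<close>

lemma generic_coordinate_nonzero:
  fixes emb :: "'a::field \<Rightarrow> 'w::field"
  assumes emb: "comm_ring_hom emb" and i: "i < n"
    and gen: "\<forall>p\<in>mpolys n. heval emb p \<xi> = 0 \<longrightarrow> p = 0"
  shows "\<xi> i \<noteq> 0"
proof
  assume "\<xi> i = 0"
  then have "Var i = (0 :: 'a mpoly)"
    using gen[rule_format, OF mpolys_Var[OF i]] by (simp add: heval_Var[OF emb])
  then have "eval_mpoly (Var i :: 'a mpoly) (\<lambda>_. 1) = 0" by simp
  then show False by simp
qed

text \<open>For a point \<open>y\<close> at which all leading coefficients for \<open>x\<^sub>i\<close>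
  vanish, \<open>f(\<xi>) \<mapsto> y\<close> and \<open>1/x\<^sub>i \<mapsto> 0\<close> define a
  homomorphism on \<open>K[f(\<xi>), 1/x\<^sub>i]\<close>: an algebraic relation \<open>p\<close>,
  multiplied by a power of \<open>x\<^sub>i\<close>, is an equation for \<open>x\<^sub>i\<close>
  with leading coefficient \<open>p(f, 0)\<close>. The last variable of \<open>p\<close>, with
  index \<open>m\<close>, stands for \<open>1/x\<^sub>i\<close>.\<close>

lemma specialization_at_infinity:
  fixes F :: "nat \<Rightarrow> 'a::alg_closed_field mpoly" and emb :: "'a \<Rightarrow> 'w::field"
  assumes F: "\<forall>l<m. F l \<in> mpolys n" and emb: "comm_ring_hom emb" and i: "i < n"
    and gen: "\<forall>p\<in>mpolys n. heval emb p \<xi> = 0 \<longrightarrow> p = 0"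
    and y: "y \<in> affine_space m" "\<forall>g\<in>leading_coeffs m F i. eval_mpoly g y = 0"
    and p: "p \<in> mpolys (Suc m)"
      "heval emb p (\<lambda>l. if l < m then heval emb (F l) \<xi> else inverse (\<xi> i)) = 0" (is "heval emb p ?z = 0")
  shows "eval_mpoly p (y(m := 0)) = 0"
proof -
  interpret emb: comm_ring_hom emb by fact
  interpret hz: comm_ring_hom "\<lambda>p. heval emb p ?z" by (rule emb.comm_ring_hom_heval)
  interpret hx: comm_ring_hom "\<lambda>p. heval emb p \<xi>" by (rule emb.comm_ring_hom_heval)
  interpret ey: comm_ring_hom "\<lambda>p. eval_mpoly p y" by (rule comm_ring_hom_eval_mpoly)
  have "\<xi> i \<noteq> 0" by (rule generic_coordinate_nonzero[OF emb i gen])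
  obtain P where P: "\<forall>k. coeff P k \<in> mpolys m" "p = poly P (Var m)" using p(1) by (auto simp: mpolys_Suc_iff)
  have cz: "heval emb a ?z = heval emb (heval Const a F) \<xi>" if "a \<in> mpolys m" for a
    unfolding heval_subst[OF emb] by (rule heval_cong[OF that]) simp
  define r where "r = degree P"
  define E where "E = (\<Sum>k\<le>r. heval Const (coeff P k) F * Var i ^ (r - k))"
  have "E = 0"
  proof (rule gen[rule_format])
    show "E \<in> mpolys n"
      unfolding E_def using P(1) F i by (intro mpolys_sum mpolys_mult mpolys_power mpolys_Var mpolys_subst[of _ m]) auto
    have "heval emb E \<xi> = (\<Sum>k\<le>r. heval emb (coeff P k) ?z * \<xi> i ^ (r - k))"
      by (simp add: E_def hx.hom_sum hx.hom_mult hx.hom_power heval_Var[OF emb] cz[OF P(1)[rule_format]])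
    also have "\<dots> = \<xi> i ^ r * (\<Sum>k\<le>r. heval emb (coeff P k) ?z * inverse (\<xi> i) ^ k)"
      unfolding sum_distrib_left using \<open>\<xi> i \<noteq> 0\<close>
      by (intro sum.cong) (auto simp: power_diff field_simps)
    also have "(\<Sum>k\<le>r. heval emb (coeff P k) ?z * inverse (\<xi> i) ^ k) = heval emb p ?z"
      by (simp add: P(2) poly_altdef hz.hom_sum hz.hom_mult hz.hom_power heval_Var[OF emb] r_def)
    finally show "heval emb E \<xi> = 0" by (simp add: p(2))
  qed
  moreover have "E = heval Const (coeff P 0) F * Var i ^ r + (\<Sum>k<r. heval Const (coeff P (r - k)) F * Var i ^ k)"
  proof -
    have "E = (\<Sum>k\<le>r. heval Const (coeff P (r - k)) F * Var i ^ k)"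
      unfolding E_def by (rule sum.reindex_bij_witness[of _ "\<lambda>k. r - k" "\<lambda>k. r - k"]) auto
    then show ?thesis by (simp add: lessThan_Suc_atMost[symmetric] add.commute)
  qed
  ultimately have "coeff P 0 \<in> leading_coeffs m F i"
    using P(1) unfolding leading_coeffs_def by (intro CollectI conjI exI[of _ r] exI[of _ "\<lambda>k. coeff P (r - k)"]) auto
  then have "eval_mpoly (coeff P 0) y = 0" using y by blast
  moreover have "eval_mpoly p (y(m := 0)) = poly (map_poly (\<lambda>a. eval_mpoly a y) P) 0"
    unfolding P(2) by (rule eval_poly_Var_update) (use P(1) in \<open>simp add: polys_over_def\<close>)
  ultimately show ?thesis by (simp add: poly_0_coeff_0)
qed

text \<open>If \<open>f\<close> were constant along the line through the generic point, then \<open>f(x +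
  \<tau> e\<^sub>j) - f(x)\<close> would vanish at the generic point for each \<open>\<tau> \<in>
  K\<close>, so it would be the zero polynomial.\<close>

lemma generic_line_nonconstant:
  fixes f :: "'a::alg_closed_field mpoly" and emb :: "'a \<Rightarrow> 'w::field"
  assumes f: "f \<in> mpolys n" and emb: "comm_ring_hom emb" and j: "j < n"
    and gen: "\<forall>p\<in>mpolys n. heval emb p \<xi> = 0 \<longrightarrow> p = 0"
    and dep: "eval_mpoly f (x(j := s)) \<noteq> eval_mpoly f x"
  shows "degree (heval (\<lambda>c. [:emb c:]) f (\<lambda>k. if k = j then [:\<xi> j, 1:] else [:\<xi> k:])) > 0" (is "degree ?Z > 0")
proof (rule ccontr)
  assume "\<not> degree ?Z > 0"
  then obtain c where c: "?Z = [:c:]" using degree_eq_zeroE by blast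
  interpret emb: comm_ring_hom emb by fact
  interpret hx: comm_ring_hom "\<lambda>p. heval emb p \<xi>" by (rule emb.comm_ring_hom_heval)
  have Zt: "poly ?Z t = heval emb f (\<lambda>k. if k = j then \<xi> j + t else \<xi> k)" for t
    using heval_natural[OF comm_ring_hom_poly[of t], of "\<lambda>c. [:emb c:]" f "\<lambda>k. if k = j then [:\<xi> j, 1:] else [:\<xi> k:]"]
    by (simp add: if_distrib[of "\<lambda>p. poly p t"] cong: if_cong)
  define \<tau> where "\<tau> = s - x j"
  define E where "E = heval Const f (\<lambda>k. if k = j then Var j + Const \<tau> else Var k) - f"
  have "E = 0"
  proof (rule gen[rule_format])
    show "E \<in> mpolys n"
      unfolding E_def using f by (intro mpolys_diff mpolys_subst[OF f]) (auto intro!: mpolys_add mpolys_Var)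
    have "heval emb E \<xi> = heval emb f (\<lambda>k. if k = j then \<xi> j + emb \<tau> else \<xi> k) - heval emb f \<xi>"
      by (simp add: E_def hx.hom_minus heval_subst[OF emb] if_distrib[of "\<lambda>p. heval emb p \<xi>"] hx.hom_add
          heval_Var[OF emb] heval_Const[OF emb] cong: if_cong)
    also have "heval emb f \<xi> = heval emb f (\<lambda>k. if k = j then \<xi> j + 0 else \<xi> k)"
      by (rule arg_cong[of _ _ "heval emb f"]) auto
    also have "heval emb f (\<lambda>k. if k = j then \<xi> j + emb \<tau> else \<xi> k) - \<dots> = 0"
      unfolding Zt[symmetric] c by simp
    finally show "heval emb E \<xi> = 0" .
  qed
  then have "eval_mpoly E x = 0" by simp
  moreover have "eval_mpoly E x = eval_mpoly f (x(j := s)) - eval_mpoly f x"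
  proof -
    have "(\<lambda>l. eval_mpoly (if l = j then Var j + Const \<tau> else Var l) x) = x(j := s)"
      by (auto simp: fun_eq_iff eval_mpoly_add \<tau>_def)
    then show ?thesis by (simp add: E_def eval_diff eval_subst del: fun_upd_apply)
  qed
  ultimately show False using dep by simp
qed

text \<open>The construction described at the beginning. Here \<open>\<xi>\<close> is a generic point of the
  source with coordinates in \<open>\<Omega> = 'w\<close>, \<open>z\<close> consists of
  \<open>f(\<xi>)\<close> and \<open>1/x\<^sub>i\<close>, the ring \<open>V\<close> with ideal
  \<open>m1\<close> is the valuation ring of the generic point of the component \<open>Y\<close>,
  and \<open>G\<close> is the graph of the place refining it. The line is the point \<open>\<zeta>
  \<kappa>\<close> over \<open>\<Omega>[T]\<close>, and \<open>\<phi>\<close> is the image of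
  \<open>f(\<zeta> \<kappa>)\<close> under the place.\<close>

lemma curve_at_infinity:
  fixes F :: "nat \<Rightarrow> 'a::alg_closed_field mpoly" and emb :: "'a \<Rightarrow> 'w::alg_closed_field"
  assumes F: "\<forall>l<m. F l \<in> mpolys n" and emb: "comm_ring_hom emb"
    and gen: "\<forall>p\<in>mpolys n. heval emb p \<xi> = 0 \<longrightarrow> p = 0"
    and ij: "i < n" "j < n" "i \<noteq> j"
    and Y: "Y \<subseteq> affine_space m" "irreducible_space (subtopology (zariski m) Y)"
      "\<forall>y\<in>Y. \<forall>g\<in>leading_coeffs m F i. eval_mpoly g y = 0"
    and x: "x \<in> Y"
    and dep: "l0 < m" "eval_mpoly (F l0) (x0(j := s0)) \<noteq> eval_mpoly (F l0) x0"
  shows "\<exists>Q \<phi>. prime_ideal_of Q (mpolys m) \<and> leading_coeffs m F i \<subseteq> Q \<and> (\<forall>q\<in>Q. \<forall>y\<in>Y. eval_mpoly q y = 0) \<and>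
    (\<forall>l<m. degree (\<phi> l) \<le> total_degree (F l)) \<and> (\<exists>l<m. degree (\<phi> l) > 0) \<and>
    curve_point m \<phi> 0 = x \<and> (\<forall>q\<in>Q. \<forall>t. eval_mpoly q (curve_point m \<phi> t) = 0)"
proof -
  interpret emb: comm_ring_hom emb by fact
  define z where "z l = (if l < m then heval emb (F l) \<xi> else inverse (\<xi> i))" for l
  have z: "z = (\<lambda>l. if l < m then heval emb (F l) \<xi> else inverse (\<xi> i))" by (simp add: z_def fun_eq_iff)
  interpret hz: comm_ring_hom "\<lambda>p. heval emb p z" by (rule emb.comm_ring_hom_heval)
  note Rs = subring_setD[OF subring_mpolys[of "Suc m"]]
  define I1 where "I1 = {p \<in> mpolys (Suc m). \<forall>y\<in>Y. eval_mpoly p (y(m := 0)) = 0}"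
  have I1: "ideal_of I1 (mpolys (Suc m))"
    unfolding ideal_of_def by (auto simp: I1_def eval_mpoly_add eval_mpoly_mult mpolys_add mpolys_mult)
  have kernel: "p \<in> I1" if "p \<in> mpolys (Suc m)" "heval emb p z = 0" for p
    using specialization_at_infinity[OF F emb ij(1) gen _ _ that(1) that(2)[unfolded z]] Y(1,3) that(1)
    unfolding I1_def by blast
  have cons: "p \<in> I1" if "p \<in> mpolys (Suc m)" "q \<in> I1" "heval emb p z = heval emb q z" for p q
  proof -
    have "p - q \<in> I1" using that ideal_ofD(1)[OF I1 that(2)] by (intro kernel Rs) (auto simp: hz.hom_minus)
    then have "(p - q) + q \<in> I1" using that(2) ideal_ofD(3)[OF I1] by blast
    then show ?thesis by simp
  qed
  have I1_prime: "p \<in> I1 \<or> q \<in> I1" if pq: "p \<in> mpolys (Suc m)" "q \<in> mpolys (Suc m)" "p * q \<in> I1" for p q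
  proof -
    let ?r = "\<lambda>p. heval Const p (\<lambda>l. if l < m then Var l else 0)"
    have r: "?r p \<in> mpolys m" if "p \<in> mpolys (Suc m)" for p
      by (rule mpolys_subst[OF that]) (auto simp: mpolys_Var)
    have er: "eval_mpoly (?r p) y = eval_mpoly p (y(m := 0))" if "p \<in> mpolys (Suc m)" for p y
      unfolding eval_subst by (rule eval_mpoly_cong[OF that]) auto
    have "\<forall>y\<in>Y. eval_mpoly (?r p) y * eval_mpoly (?r q) y = 0"
      using pq(3) by (simp add: er pq I1_def eval_mpoly_mult)
    then have "(\<forall>y\<in>Y. eval_mpoly (?r p) y = 0) \<or> (\<forall>y\<in>Y. eval_mpoly (?r q) y = 0)"
      using Y(2) r[OF pq(1)] r[OF pq(2)] unfolding irreducible_zariski_iff[OF Y(1)] by blast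
    then show ?thesis using pq by (simp add: er I1_def)
  qed
  define R1 where "R1 = (\<lambda>p. heval emb p z) ` mpolys (Suc m)"
  define P1 where "P1 = (\<lambda>p. heval emb p z) ` I1"
  have R1: "subring_set R1" and P1: "ideal_of P1 R1"
    unfolding R1_def P1_def by (intro subring_set_image ideal_of_image emb.comm_ring_hom_heval subring_mpolys I1)+
  have P1_iff: "heval emb p z \<in> P1 \<longleftrightarrow> p \<in> I1" if "p \<in> mpolys (Suc m)" for p
    using cons[OF that] unfolding P1_def by blast
  have one: "1 \<notin> I1" using x by (auto simp: I1_def)
  have "\<exists>V m1. subring_set V \<and> R1 \<subseteq> V \<and> ideal_of m1 V \<and> P1 \<subseteq> m1 \<and> (R1 - P1) \<inter> m1 = {} \<and>
    (\<forall>x. x \<in> V \<or> inverse x \<in> m1)"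
  proof (rule valuation_ring_exists[OF R1 P1])
    show "1 \<in> R1 - P1" using P1_iff[of 1] one subring_setD(2)[OF R1] by simp
    fix s t assume "s \<in> R1 - P1" "t \<in> R1 - P1"
    then obtain p q where pq: "p \<in> mpolys (Suc m)" "q \<in> mpolys (Suc m)" "s = heval emb p z" "t = heval emb q z" "p \<notin> I1" "q \<notin> I1"
      unfolding R1_def using P1_iff by blast
    then have "p * q \<notin> I1" using I1_prime by blast
    then have "s * t \<notin> P1" using P1_iff[OF Rs(5)[OF pq(1,2)]] by (simp add: pq(3,4) hz.hom_mult)
    then show "s * t \<in> R1 - P1" using subring_setD(5)[OF R1] \<open>s \<in> R1 - P1\<close> \<open>t \<in> R1 - P1\<close> by blast
  qed auto
  then obtain V m1 where V: "subring_set V" "R1 \<subseteq> V" and m1: "ideal_of m1 V" "P1 \<subseteq> m1" "(R1 - P1) \<inter> m1 = {}"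
    and dich: "\<forall>x. x \<in> V \<or> inverse x \<in> m1"
    by (elim exE conjE) (rule that)
  note Vs = subring_setD[OF V(1)] and ms = ideal_ofD[OF m1(1)]
  have m1_I1: "p \<in> I1" if "p \<in> mpolys (Suc m)" "heval emb p z \<in> m1" for p
    using that P1_iff m1(3) unfolding R1_def by blast
  have "1 \<notin> m1" using m1_I1[of 1] one by auto
  then have m1_prime: "prime_ideal_of m1 V"
    using valuation_ring_prime[OF V(1) m1(1)] dich by blast

  \<comment> \<open>The place is started on \<open>R1 + m1\<close> with value \<open>0\<close> on \<open>m1\<close>.
    This is consistent because \<open>m1\<close> meets \<open>R1\<close> in the equations of
    \<open>Y\<close>, which vanish at \<open>x \<in> Y\<close>, and it forces the ring of the
    place into \<open>V\<close>.\<close>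
  define G0 where "G0 = {(heval emb p z + \<mu>, eval_mpoly p (x(m := 0))) | p \<mu>. p \<in> mpolys (Suc m) \<and> \<mu> \<in> m1}"
  have G0I: "(heval emb p z + \<mu>, eval_mpoly p (x(m := 0))) \<in> G0" if "p \<in> mpolys (Suc m)" "\<mu> \<in> m1" for p \<mu>
    using that unfolding G0_def by blast
  have "ring_relation G0"
    unfolding ring_relation_def
  proof (intro conjI allI impI)
    show "(0, 0) \<in> G0" "(1, 1) \<in> G0" using G0I[of 0 0] G0I[of 1 0] ms(2) by (simp_all add: emb.heval_0)
  next
    fix a a' b b' assume "(a, a') \<in> G0" "(b, b') \<in> G0"
    then obtain p \<mu> q \<nu> where *: "a = heval emb p z + \<mu>" "a' = eval_mpoly p (x(m := 0))"
      "b = heval emb q z + \<nu>" "b' = eval_mpoly q (x(m := 0))" "p \<in> mpolys (Suc m)" "q \<in> mpolys (Suc m)" "\<mu> \<in> m1" "\<nu> \<in> m1"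
      unfolding G0_def by blast
    have inV: "heval emb p z \<in> V" "heval emb q z \<in> V" "\<mu> \<in> V" using * V(2) ms(1) unfolding R1_def by blast+
    have "a + b = heval emb (p + q) z + (\<mu> + \<nu>)" by (simp add: * hz.hom_add)
    then show "(a + b, a' + b') \<in> G0"
      using G0I[OF Rs(3)[OF *(5,6)] ms(3)[OF *(7,8)]] by (simp only: *(2,4) eval_mpoly_add)
    have "a - b = heval emb (p - q) z + (\<mu> - \<nu>)" by (simp add: * hz.hom_minus)
    then show "(a - b, a' - b') \<in> G0"
      using G0I[OF Rs(4)[OF *(5,6)] ideal_of_diff[OF m1(1) V(1) *(7,8)]] by (simp only: *(2,4) eval_diff)
    have "a * b = heval emb (p * q) z + (heval emb p z * \<nu> + (heval emb q z * \<mu> + \<mu> * \<nu>))"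
      by (simp add: * hz.hom_mult algebra_simps)
    moreover have "heval emb p z * \<nu> + (heval emb q z * \<mu> + \<mu> * \<nu>) \<in> m1"
      by (intro ms(3) ms(4)[OF *(8)] ms(4)[OF *(7)] inV)
    ultimately show "(a * b, a' * b') \<in> G0"
      using G0I[OF Rs(5)[OF *(5,6)]] by (simp only: *(2,4) eval_mpoly_mult)
  qed
  moreover have "b = 0" if b: "(0, b) \<in> G0" for b
  proof -
    obtain p \<mu> where p: "0 = heval emb p z + \<mu>" "b = eval_mpoly p (x(m := 0))" "p \<in> mpolys (Suc m)" "\<mu> \<in> m1"
      using b unfolding G0_def by blast
    have "heval emb p z = 0 - \<mu>" using p(1) by (simp add: eq_neg_iff_add_eq_0)
    then have "heval emb p z \<in> m1" using ideal_of_diff[OF m1(1) V(1) ms(2) p(4)] by simp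
    then have "p \<in> I1" using m1_I1 p(3) by blast
    then show "b = 0" using x p(2) by (simp add: I1_def)
  qed
  ultimately have "\<exists>G. ring_relation G \<and> G0 \<subseteq> G \<and> (\<forall>b. (0, b) \<in> G \<longrightarrow> b = 0) \<and>
    (\<forall>x. (\<exists>c. (x, c) \<in> G) \<or> (inverse x, 0) \<in> G)" by (rule place_exists)
  then obtain G where G: "ring_relation G" "G0 \<subseteq> G" and G0': "\<forall>b. (0, b) \<in> G \<longrightarrow> b = 0"
    and Gd: "\<forall>x. (\<exists>c. (x, c) \<in> G) \<or> (inverse x, 0) \<in> G" by (elim exE conjE) (rule that)
  note Gs = ring_relationD[OF G(1)]
  have uniq: "b = b'" if "(a, b) \<in> G" "(a, b') \<in> G" for a b b'
  proof -
    have "(0, b - b') \<in> G" using Gs(4)[OF that] by simp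
    from G0'[rule_format, OF this] show ?thesis by simp
  qed
  have Gpoly: "(heval emb p z, eval_mpoly p (x(m := 0))) \<in> G" if "p \<in> mpolys (Suc m)" for p
    using G0I[OF that ms(2)] G(2) by auto
  have Gm1: "(\<mu>, 0) \<in> G" if "\<mu> \<in> m1" for \<mu>
    using G0I[of 0 \<mu>] that G(2) by (auto simp: emb.heval_0)
  have Gc: "(emb c, c) \<in> G" for c using Gpoly[of "Const c"] by (simp add: heval_Const[OF emb])
  have Gz: "(heval emb (F l) \<xi>, x l) \<in> G" if "l < m" for l
    using Gpoly[of "Var l"] that by (simp add: heval_Var[OF emb] z_def mpolys_Var)
  define V2 where "V2 = {a. \<exists>c. (a, c) \<in> G}"
  have V2: "subring_set V2" unfolding V2_def by (rule ring_relation_subring[OF G(1)])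
  have V2V: "V2 \<subseteq> V"
  proof
    fix b assume "b \<in> V2"
    then obtain c where c: "(b, c) \<in> G" by (auto simp: V2_def)
    show "b \<in> V"
    proof (rule ccontr)
      assume b: "b \<notin> V"
      then have "inverse b \<in> m1" using dich by blast
      then have "(b * inverse b, c * 0) \<in> G" using Gs(5)[OF c Gm1] by blast
      moreover have "b \<noteq> 0" using b Vs(1) by blast
      ultimately have "(1, 0) \<in> G" by simp
      then show False using uniq[OF _ Gs(2)] by fastforce
    qed
  qed

  define hc where "hc c = [:emb c:]" for c
  have hc: "comm_ring_hom hc"
    unfolding hc_def by (rule comm_ring_hom_comp[OF comm_ring_hom_const_poly emb])
  interpret hc: comm_ring_hom hc by (rule hc)
  define \<zeta> where "\<zeta> a k = (if k = j then [:\<xi> j, a:] else [:\<xi> k:])" for a :: 'w and k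
  define ZZ where "ZZ a l = heval hc (F l) (\<zeta> a)" for a l
  have ZZ_coeff: "coeff (ZZ a l) k = a ^ k * coeff (ZZ 1 l) k" for a l k
  proof -
    have "ZZ a l = pcompose (ZZ 1 l) [:0, a:]"
      unfolding ZZ_def heval_natural[OF comm_ring_hom_pcompose]
      by (intro arg_cong2[of _ _ _ _ "\<lambda>h z. heval h (F l) z"]) (auto simp: hc_def \<zeta>_def fun_eq_iff pcompose_pCons)
    then show ?thesis by (simp add: coeff_pcompose_linear)
  qed
  have ZZ0: "coeff (ZZ a l) 0 = heval emb (F l) \<xi>" for a l
  proof -
    have "coeff (ZZ a l) 0 = poly (ZZ a l) 0" by (simp add: poly_0_coeff_0)
    also have "\<dots> = heval (\<lambda>c. poly (hc c) 0) (F l) (\<lambda>k. poly (\<zeta> a k) 0)"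
      unfolding ZZ_def by (rule heval_natural[OF comm_ring_hom_poly])
    also have "\<dots> = heval emb (F l) \<xi>"
      by (intro arg_cong2[of _ _ _ _ "\<lambda>h z. heval h (F l) z"]) (auto simp: hc_def \<zeta>_def fun_eq_iff)
    finally show ?thesis .
  qed
  have "degree (ZZ 1 l0) > 0"
    using generic_line_nonconstant[OF _ emb ij(2) gen dep(2)] F dep(1) by (simp add: ZZ_def hc_def[abs_def] \<zeta>_def[abs_def])
  then have l0: "coeff (ZZ 1 l0) (degree (ZZ 1 l0)) \<noteq> 0" by auto
  \<comment> \<open>For a nonzero coefficient \<open>b\<close> of \<open>T\<^sup>a\<close>, scaling \<open>T\<close>
    by an \<open>a\<close>-th root \<open>\<mu>\<close> of \<open>1/b\<close> makes it
    \<open>1\<close>. Of these finitely many factors, the one divisible by all others in the ring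
    of the place is \<open>\<kappa>\<close>, which keeps the other coefficients finite.\<close>
  define B where "B = {(l, a). l < m \<and> a \<in> {1..degree (ZZ 1 l)} \<and> coeff (ZZ 1 l) a \<noteq> 0}"
  have "B \<subseteq> (SIGMA l:{..<m}. {1..degree (ZZ 1 l)})" by (auto simp: B_def)
  then have finB: "finite B" by (rule finite_subset) auto
  have neB: "B \<noteq> {}" using dep(1) l0 \<open>degree (ZZ 1 l0) > 0\<close> by (force simp: B_def)
  have "\<forall>la\<in>B. \<exists>\<mu>. \<mu> ^ snd la = inverse (coeff (ZZ 1 (fst la)) (snd la))"
    by (auto simp: B_def intro!: nth_root_exists)
  from bchoice[OF this] obtain \<mu> where \<mu>': "\<forall>la\<in>B. \<mu> la ^ snd la = inverse (coeff (ZZ 1 (fst la)) (snd la))" by blast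
  have \<mu>: "\<mu> (l, a) ^ a = inverse (coeff (ZZ 1 l) a)" if "(l, a) \<in> B" for l a
    using bspec[OF \<mu>' that] by simp
  have \<mu>0: "\<mu> (l, a) \<noteq> 0" if "(l, a) \<in> B" for l a
  proof
    assume "\<mu> (l, a) = 0"
    then have "inverse (coeff (ZZ 1 l) a) = 0" using \<mu>[OF that] that by (simp add: B_def power_0_left)
    then show False using that by (simp add: B_def)
  qed
  have "\<exists>\<kappa>\<in>\<mu> ` B. \<forall>\<nu>\<in>\<mu> ` B. \<kappa> / \<nu> \<in> V2"
  proof (rule valuation_ring_common_multiple[OF V2])
    show "x \<in> V2 \<or> inverse x \<in> V2" for x using Gd by (auto simp: V2_def)
    show "0 \<notin> \<mu> ` B" using \<mu>0 by force
  qed (use finB neB in auto)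
  then obtain l1 a1 where la: "(l1, a1) \<in> B" "\<And>l a. (l, a) \<in> B \<Longrightarrow> \<mu> (l1, a1) / \<mu> (l, a) \<in> V2" by fast
  define \<kappa> where "\<kappa> = \<mu> (l1, a1)"
  have scale: "coeff (ZZ \<kappa> l) a = (\<kappa> / \<mu> (l, a)) ^ a" if "(l, a) \<in> B" for l a
    using \<mu>[OF that] that by (simp add: ZZ_coeff[of \<kappa>] B_def divide_inverse power_mult_distrib power_inverse)
  define Z where "Z = ZZ \<kappa>"
  have Z_V2: "coeff (Z l) a \<in> V2" if "l < m" for l a
  proof (cases "(l, a) \<in> B")
    case True
    then show ?thesis unfolding Z_def scale[OF True] using la(2)[OF True]
      by (intro subring_set_power[OF V2]) (simp add: \<kappa>_def)
  next
    case False
    show ?thesis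
    proof (cases "a = 0")
      case True
      then show ?thesis using Gz[OF that] by (auto simp: Z_def ZZ0 V2_def)
    next
      case a: False
      have "coeff (ZZ 1 l) a = 0"
        using False that a by (cases "a \<le> degree (ZZ 1 l)") (auto simp: B_def coeff_eq_0)
      then show ?thesis unfolding Z_def using subring_setD(1)[OF V2] by (simp add: ZZ_coeff[of \<kappa>])
    qed
  qed
  define \<pi> where "\<pi> a = (THE c. (a, c) \<in> G)" for a
  have \<pi>: "\<pi> a = c" if "(a, c) \<in> G" for a c
    unfolding \<pi>_def using that uniq by (intro the_equality) auto
  have \<pi>0: "\<pi> 0 = 0" by (rule \<pi>[OF Gs(1)])
  define \<phi> where "\<phi> l = map_poly \<pi> (Z l)" for l
  have \<phi>c: "coeff (\<phi> l) a = \<pi> (coeff (Z l) a)" for l a by (simp add: \<phi>_def coeff_map_poly \<pi>0)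
  have Z\<phi>: "(Z l, \<phi> l) \<in> poly_relation G" if "l < m" for l
    using Z_V2[OF that] \<pi> by (auto simp: poly_relation_def \<phi>c V2_def)
  have deg: "degree (\<phi> l) \<le> total_degree (F l)" if "l < m" for l
  proof -
    have "degree (\<phi> l) \<le> degree (Z l)" unfolding \<phi>_def by (rule degree_map_poly_le)
    also have "\<dots> \<le> total_degree (F l)"
      unfolding Z_def ZZ_def hc_def[abs_def] by (rule degree_heval_le) (auto simp: \<zeta>_def)
    finally show ?thesis .
  qed
  have nonconst: "l1 < m" "degree (\<phi> l1) > 0"
  proof -
    show "l1 < m" using la(1) by (simp add: B_def)
    have "coeff (Z l1) a1 = 1" unfolding Z_def scale[OF la(1)] using \<mu>0[OF la(1)] by (simp add: \<kappa>_def)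
    then have "coeff (\<phi> l1) a1 = 1" using \<pi>[OF Gs(2)] by (simp add: \<phi>c)
    then have "a1 \<le> degree (\<phi> l1)" by (intro le_degree) simp
    then show "degree (\<phi> l1) > 0" using la(1) by (simp add: B_def)
  qed
  have start: "curve_point m \<phi> 0 = x"
  proof
    fix l show "curve_point m \<phi> 0 l = x l"
    proof (cases "l < m")
      case True
      then show ?thesis using \<pi>[OF Gz[OF True]] by (simp add: curve_point_def poly_0_coeff_0 \<phi>c Z_def ZZ0)
    next
      case False
      then show ?thesis using x Y(1) by (auto simp: curve_point_def affine_space_def PiE_def extensional_def)
    qed
  qed

  interpret hZ: comm_ring_hom "\<lambda>q. heval hc q Z" by (rule hc.comm_ring_hom_heval)
  have relG: "(heval hc q Z, heval (\<lambda>c. [:c:]) q \<phi>) \<in> poly_relation G" if "q \<in> mpolys m" for q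
    by (rule heval_ring_relation[OF ring_relation_poly_relation[OF G(1)] _ Z\<phi> that])
       (auto simp: hc_def intro!: poly_relation_const[OF G(1)] Gc)
  have ZV: "heval hc q Z \<in> polys_over V" if "q \<in> mpolys m" for q
    using relG[OF that] V2V by (auto simp: poly_relation_def polys_over_def V2_def)
  \<comment> \<open>The equations of the line after reduction modulo \<open>m1\<close>, stated by coefficients, so
    that \<open>Q\<close> is prime because the polynomials with coefficients in \<open>m1\<close>
    form a prime ideal.\<close>
  define Q where "Q = {q \<in> mpolys m. heval hc q Z \<in> polys_over m1}"
  have pm: "prime_ideal_of (polys_over m1) (polys_over V)" by (rule prime_polys_over[OF V(1) m1_prime])
  then have pmi: "ideal_of (polys_over m1) (polys_over V)" by (simp add: prime_ideal_of_def)
  have Qprime: "prime_ideal_of Q (mpolys m)"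
    unfolding prime_ideal_of_def ideal_of_def
  proof (intro conjI ballI impI)
    show "Q \<subseteq> mpolys m" by (auto simp: Q_def)
    show "0 \<in> Q" using ideal_ofD(2)[OF pmi] by (simp add: Q_def hc.heval_0)
    show "1 \<notin> Q" using pm by (simp add: Q_def prime_ideal_of_def)
  next
    fix a b :: "'a mpoly" assume "a \<in> Q" "b \<in> Q"
    then show "a + b \<in> Q" using ideal_ofD(3)[OF pmi] by (simp add: Q_def mpolys_add hZ.hom_add)
  next
    fix a b :: "'a mpoly" assume "a \<in> Q" "b \<in> mpolys m"
    then show "b * a \<in> Q" using ideal_ofD(4)[OF pmi] ZV by (simp add: Q_def mpolys_mult hZ.hom_mult)
  next
    fix a b :: "'a mpoly" assume "a \<in> mpolys m" "b \<in> mpolys m" "a * b \<in> Q"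
    then show "a \<in> Q \<or> b \<in> Q" using pm ZV by (simp add: Q_def prime_ideal_of_def hZ.hom_mult)
  qed
  have "\<xi> i \<noteq> 0" by (rule generic_coordinate_nonzero[OF emb ij(1) gen])
  have inv: "inverse (\<xi> i) \<in> m1"
  proof -
    have "Var m \<in> I1" by (simp add: I1_def mpolys_Var)
    then have "heval emb (Var m) z \<in> P1" unfolding P1_def by blast
    then show ?thesis using m1(2) by (auto simp: heval_Var[OF emb] z_def)
  qed
  have LQ: "leading_coeffs m F i \<subseteq> Q"
  proof
    fix g assume "g \<in> leading_coeffs m F i"
    then obtain r a where g: "g \<in> mpolys m" and a: "\<And>k. k < r \<Longrightarrow> a k \<in> mpolys m"
      and eq: "heval Const g F * Var i ^ r + (\<Sum>k<r. heval Const (a k) F * Var i ^ k) = 0"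
      by (auto simp: leading_coeffs_def)
    interpret h\<zeta>: comm_ring_hom "\<lambda>q. heval hc q (\<zeta> \<kappa>)" by (rule hc.comm_ring_hom_heval)
    have sub: "heval hc (heval Const q F) (\<zeta> \<kappa>) = heval hc q Z" for q
      unfolding heval_subst[OF hc] Z_def ZZ_def ..
    \<comment> \<open>Since \<open>i \<noteq> j\<close>, the equation for \<open>x\<^sub>i\<close> holds along the line
      with the constant \<open>\<xi> i\<close>. Dividing by its \<open>r\<close>-th power exhibits
      each coefficient of \<open>g\<close> along the line as a combination of positive powers of
      \<open>1/x\<^sub>i \<in> m1\<close>.\<close>
    have eqZ: "heval hc g Z * [:\<xi> i ^ r:] + (\<Sum>k<r. heval hc (a k) Z * [:\<xi> i ^ k:]) = 0"
      using arg_cong[OF eq, of "\<lambda>q. heval hc q (\<zeta> \<kappa>)"] ij(3)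
      by (simp add: h\<zeta>.hom_add h\<zeta>.hom_mult h\<zeta>.hom_sum h\<zeta>.hom_power sub heval_Var[OF hc] \<zeta>_def poly_const_pow hc.heval_0)
    have eqc: "coeff (heval hc g Z) c * \<xi> i ^ r + (\<Sum>k<r. coeff (heval hc (a k) Z) c * \<xi> i ^ k) = 0" for c
      using arg_cong[OF eqZ, of "\<lambda>p. coeff p c"] by (simp add: coeff_sum mult.commute)
    have "coeff (heval hc g Z) c \<in> m1" for c
    proof -
      have "coeff (heval hc g Z) c * \<xi> i ^ r = - (\<Sum>k<r. coeff (heval hc (a k) Z) c * \<xi> i ^ k)"
        using eqc[of c] by (simp add: eq_neg_iff_add_eq_0)
      then have "coeff (heval hc g Z) c = - (\<Sum>k<r. coeff (heval hc (a k) Z) c * \<xi> i ^ k) * inverse (\<xi> i) ^ r"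
        using \<open>\<xi> i \<noteq> 0\<close> by (simp add: field_simps)
      also have "\<dots> = 0 - (\<Sum>k<r. coeff (heval hc (a k) Z) c * inverse (\<xi> i) ^ (r - k))"
      proof -
        have "(\<Sum>k<r. coeff (heval hc (a k) Z) c * \<xi> i ^ k) * inverse (\<xi> i) ^ r =
          (\<Sum>k<r. coeff (heval hc (a k) Z) c * inverse (\<xi> i) ^ (r - k))"
          unfolding sum_distrib_right using \<open>\<xi> i \<noteq> 0\<close>
          by (intro sum.cong) (auto simp: power_diff field_simps)
        then show ?thesis by simp
      qed
      also have "\<dots> \<in> m1"
      proof (intro ideal_of_diff[OF m1(1) V(1)] ms(2) ideal_of_sum[OF m1(1)])
        fix k assume k: "k \<in> {..<r}"
        obtain e where e: "r - k = Suc e" using k by (metis Suc_diff_Suc lessThan_iff)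
        have "inverse (\<xi> i) ^ (r - k) = inverse (\<xi> i) ^ e * inverse (\<xi> i)"
          unfolding e by (rule power_Suc2)
        moreover have "inverse (\<xi> i) ^ e * inverse (\<xi> i) \<in> m1"
          by (intro ms(4)[OF inv] subring_set_power[OF V(1)] ms(1)[OF inv])
        moreover have "coeff (heval hc (a k) Z) c \<in> V" using ZV[OF a, of k] k by (simp add: polys_over_def)
        ultimately show "coeff (heval hc (a k) Z) c * inverse (\<xi> i) ^ (r - k) \<in> m1" using ms(4) by metis
      qed
      finally show ?thesis .
    qed
    then show "g \<in> Q" using g by (simp add: Q_def polys_over_def)
  qed
  have QX: "eval_mpoly q y = 0" if q: "q \<in> Q" and "y \<in> Y" for q y
  proof -
    have qm: "q \<in> mpolys m" using q by (simp add: Q_def)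
    then have qSm: "q \<in> mpolys (Suc m)" using mpolys_mono[of m "Suc m"] by auto
    have "coeff (heval hc q Z) 0 = poly (heval hc q Z) 0" by (simp add: poly_0_coeff_0)
    also have "\<dots> = heval (\<lambda>c. poly (hc c) 0) q (\<lambda>l. poly (Z l) 0)"
      by (rule heval_natural[OF comm_ring_hom_poly])
    also have "\<dots> = heval emb q (\<lambda>l. heval emb (F l) \<xi>)"
      by (simp add: hc_def poly_0_coeff_0 Z_def ZZ0)
    also have "\<dots> = heval emb q z" by (rule heval_cong[OF qm]) (simp add: z_def)
    finally have "coeff (heval hc q Z) 0 = heval emb q z" .
    moreover have "coeff (heval hc q Z) 0 \<in> m1" using q unfolding Q_def polys_over_def by blast
    ultimately have "heval emb q z \<in> m1" by simp
    then have "eval_mpoly q (y(m := 0)) = 0" using m1_I1[OF qSm] \<open>y \<in> Y\<close> by (simp add: I1_def)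
    moreover have "eval_mpoly q (y(m := 0)) = eval_mpoly q y" by (rule eval_mpoly_cong[OF qm]) simp
    ultimately show ?thesis by simp
  qed
  have Qcurve: "eval_mpoly q (curve_point m \<phi> t) = 0" if q: "q \<in> Q" for q t
  proof -
    have qm: "q \<in> mpolys m" using q by (simp add: Q_def)
    have "coeff (heval (\<lambda>c. [:c:]) q \<phi>) k = 0" for k
    proof -
      have "(coeff (heval hc q Z) k, coeff (heval (\<lambda>c. [:c:]) q \<phi>) k) \<in> G"
        using relG[OF qm] by (simp add: poly_relation_def)
      moreover have "(coeff (heval hc q Z) k, 0) \<in> G" using q by (intro Gm1) (simp add: Q_def polys_over_def)
      ultimately show ?thesis by (rule uniq)
    qed
    then have "heval (\<lambda>c. [:c:]) q \<phi> = 0" by (simp add: poly_eq_iff)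
    then show ?thesis by (simp add: eval_curve_point[OF qm])
  qed
  show ?thesis
    by (intro exI[of _ Q] exI[of _ \<phi>] conjI ballI allI impI Qprime LQ QX deg start Qcurve exI[of _ l1] nonconst)
qed

theorem theorem2p3:
  fixes F :: "nat \<Rightarrow> 'a::alg_closed_field mpoly" and n m d :: nat
  assumes "\<forall>i<m. F i \<in> mpolys n"
    and "map_degree m F = d"
    and "generically_finite n m (poly_map m F)"
  shows "uniruled_degree_le m d
           (nonfinite_set n (affine_space n) m (affine_space m) (poly_map m F))"
proof -
  note F = assms(1)
  let ?S = "nonfinite_set n (affine_space n) m (affine_space m) (poly_map m F)"
  have Saff: "?S \<subseteq> affine_space m" by (auto simp: nonfinite_set_def)
  define emb where "emb c = to_ac (to_fract (Const c))" for c :: 'a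
  define \<xi> where "\<xi> k = to_ac (to_fract (Var k :: 'a mpoly))" for k
  have ac: "comm_ring_hom (\<lambda>p :: 'a mpoly. to_ac (to_fract p))" by unfold_locales auto
  have emb: "comm_ring_hom emb"
    unfolding emb_def by (rule comm_ring_hom_comp[OF ac comm_ring_hom_Const])
  have gen: "\<forall>p\<in>mpolys n. heval emb p \<xi> = 0 \<longrightarrow> p = 0"
  proof (intro ballI impI)
    fix p assume "heval emb p \<xi> = 0"
    moreover have "to_ac (to_fract (heval Const p Var)) = heval emb p \<xi>"
      using heval_natural[OF ac, of Const p Var] by (simp add: emb_def[abs_def] \<xi>_def[abs_def])
    ultimately show "p = 0" by (simp add: heval_Const_Var)
  qed
  show ?thesis
    unfolding uniruled_degree_le_def
  proof (intro conjI ballI)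
    show "closedin (zariski m) ?S" by (rule closedin_nonfinite_set[OF F])
    fix Y x assume "Y \<in> irreducible_components (subtopology (zariski m) ?S)" and x: "x \<in> Y"
    then have YS: "Y \<subseteq> ?S" and Yirr: "irreducible_space (subtopology (zariski m) Y)"
      and Ymax: "\<And>D. D \<subseteq> ?S \<Longrightarrow> irreducible_space (subtopology (zariski m) D) \<Longrightarrow> Y \<subseteq> D \<Longrightarrow> D = Y"
      using Saff unfolding irreducible_components_def subtopology_subtopology
      by (auto simp: Int_absorb1)
    have Yaff: "Y \<subseteq> affine_space m" using YS Saff by blast
    \<comment> \<open>\<open>Y\<close> is irreducible and covered by finitely many closed sets, one for each coordinate
      that may tend to infinity.\<close>
    have "\<exists>i<n. \<forall>y\<in>Y. \<forall>g\<in>leading_coeffs m F i. eval_mpoly g y = 0"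
    proof (rule ccontr)
      assume no: "\<not> ?thesis"
      have "\<forall>i\<in>{..<n}. \<exists>g. g \<in> leading_coeffs m F i \<and> (\<exists>y\<in>Y. eval_mpoly g y \<noteq> 0)" using no by blast
      from bchoice[OF this] obtain g where g: "\<And>i. i < n \<Longrightarrow> g i \<in> leading_coeffs m F i"
        "\<And>i. i < n \<Longrightarrow> \<exists>y\<in>Y. eval_mpoly (g i) y \<noteq> 0" by auto
      have gm: "g i \<in> mpolys m" if "i < n" for i using g(1)[OF that] by (simp add: leading_coeffs_def)
      have "\<exists>y\<in>Y. eval_mpoly (\<Prod>i<k. g i) y \<noteq> 0" if "k \<le> n" for k
        using that
      proof (induction k)
        case (Suc k)
        have "(\<Prod>i<k. g i) \<in> mpolys m" "g k \<in> mpolys m" using gm Suc.prems by (auto intro!: mpolys_prod)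
        moreover have "\<exists>y\<in>Y. eval_mpoly (\<Prod>i<k. g i) y \<noteq> 0" "\<exists>y\<in>Y. eval_mpoly (g k) y \<noteq> 0"
          using Suc g(2) by auto
        ultimately have "\<exists>y\<in>Y. eval_mpoly (\<Prod>i<k. g i) y * eval_mpoly (g k) y \<noteq> 0"
          using Yirr unfolding irreducible_zariski_iff[OF Yaff] by blast
        then show ?case by (simp add: eval_mpoly_mult mult.commute)
      qed (use x in auto)
      then obtain y where y: "y \<in> Y" "eval_mpoly (\<Prod>i<n. g i) y \<noteq> 0" by blast
      then have "\<forall>i<n. eval_mpoly (g i) y \<noteq> 0" by (auto simp: eval_prod)
      moreover have "y \<in> ?S" using y YS by blast
      ultimately show False using g(1) unfolding nonfinite_set_iff[OF F] by blast
    qed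
    then obtain i where i: "i < n" "\<forall>y\<in>Y. \<forall>g\<in>leading_coeffs m F i. eval_mpoly g y = 0" by blast
    have "n \<noteq> 1"
    proof
      assume n: "n = 1"
      then have "0 < n" by simp
      then obtain l a s where l: "l < m" "eval_mpoly (F l) (a(0 := s)) \<noteq> eval_mpoly (F l) a"
        using generically_finite_depends[OF F assms(3)] by blast
      obtain c where c: "c \<noteq> 0" "Const c \<in> leading_coeffs m F 0"
        using leading_coeffs_one_variable[where F = F and l = l and m = m and x = a and s = s] F l n by auto
      moreover have "i = 0" using i(1) n by simp
      ultimately have "eval_mpoly (Const c) x = 0" using i(2) x by blast
      then show False using c(1) by simp
    qed
    then obtain j where j: "j < n" "i \<noteq> j" using i(1)
      by (metis One_nat_def Suc_lessI gr_implies_not0 less_one linorder_neqE_nat zero_less_Suc)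
    obtain l0 x0 s0 where dep: "l0 < m" "eval_mpoly (F l0) (x0(j := s0)) \<noteq> eval_mpoly (F l0) x0"
      using generically_finite_depends[OF F assms(3) j(1)] by blast
    from curve_at_infinity[where \<xi> = \<xi>, OF F emb gen i(1) j(1,2) Yaff Yirr i(2) x dep]
    obtain Q \<phi> l1 where Q: "prime_ideal_of Q (mpolys m)" "leading_coeffs m F i \<subseteq> Q"
       "\<forall>q\<in>Q. \<forall>y\<in>Y. eval_mpoly q y = 0"
      and deg: "\<forall>l<m. degree (\<phi> l) \<le> total_degree (F l)" and l1: "l1 < m" "degree (\<phi> l1) > 0"
      and start: "curve_point m \<phi> 0 = x" and Qc: "\<forall>q\<in>Q. \<forall>t. eval_mpoly q (curve_point m \<phi> t) = 0"
      by (elim exE conjE) (rule that)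
    have Qi: "ideal_of Q (mpolys m)" using Q(1) by (simp add: prime_ideal_of_def)
    let ?W = "zero_locus m Q"
    have Waff: "?W \<subseteq> affine_space m" by (auto simp: zero_locus_def)
    have YW: "Y \<subseteq> ?W" using Q(3) Yaff by (auto simp: zero_locus_def)
    have WS: "?W \<subseteq> ?S" using subsetD[OF Q(2)] i(1) by (auto simp: nonfinite_set_iff[OF F] zero_locus_def intro!: exI[of _ i])
    have vanish: "a \<in> Q" if a: "a \<in> mpolys m" "\<forall>y\<in>?W. eval_mpoly a y = 0" for a
    proof (rule ccontr)
      assume "a \<notin> Q"
      then have "a ^ N \<notin> Q" for N using prime_ideal_of_power[OF Q(1) subring_mpolys a(1)] by blast
      from nullstellensatz[OF Qi a(1) this] show False using a(2) by (auto simp: zero_locus_def)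
    qed
    have "irreducible_space (subtopology (zariski m) ?W)"
      unfolding irreducible_zariski_iff[OF Waff]
    proof (intro conjI ballI impI)
      show "?W \<noteq> {}" using YW x by blast
      fix a b :: "'a mpoly" assume ab: "a \<in> mpolys m" "b \<in> mpolys m" "\<forall>y\<in>?W. eval_mpoly a y * eval_mpoly b y = 0"
      then have "a * b \<in> Q" by (intro vanish mpolys_mult) (auto simp: eval_mpoly_mult)
      then have "a \<in> Q \<or> b \<in> Q" using Q(1) ab(1,2) by (simp add: prime_ideal_of_def)
      then show "(\<forall>y\<in>?W. eval_mpoly a y = 0) \<or> (\<forall>y\<in>?W. eval_mpoly b y = 0)" by (auto simp: zero_locus_def)
    qed
    then have WY: "?W = Y" using Ymax[OF WS _ YW] by blast
    have tot: "total_degree (F l) \<le> d" if "l < m" for l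
      unfolding assms(2)[symmetric] map_degree_def using that by (intro Max_ge) auto
    have "degree (\<phi> l) \<le> d" if "l < m" for l using deg tot[OF that] that order_trans by blast
    then have "parametric_curve m d (range (curve_point m \<phi>))" using l1 by (rule parametric_curve_image)
    moreover have "range (curve_point m \<phi>) \<subseteq> Y"
      unfolding WY[symmetric] using Qc curve_point_affine by (auto simp: zero_locus_def)
    moreover have "x \<in> range (curve_point m \<phi>)" using start by blast
    ultimately show "\<exists>l. parametric_curve m d l \<and> l \<subseteq> Y \<and> x \<in> l" by blast
  qed
qed

end
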